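(* Let $\rho$ be a density matrix, let $(X_1,\Phi_1),(X_2,\Phi_2),\dots$ be i.i.d. with values in $\mathbb{R}\times[0,\pi]$ and probability density $p_\rho$, and let $N(n)$ be a sequence of positive integers with $N(n)\to\infty$ and $N(n)=o(n^{3/7})$. Let $$\widehat W^{(n)}(q,p)=\sum_{k,j=0}^{N(n)-1}\Big(\frac1n\sum_{\ell=1}^nF_{k,j}(X_\ell,\Phi_\ell)\Big)W_{k,j}(q,p),\qquad W_\rho^{(n)}(q,p)=\sum_{k,j=0}^{N(n)-1}\rho_{k,j}W_{k,j}(q,p).$$ Then, as $n\to\infty$, $$\mathbb{E}\|\widehat W^{(n)}-W_\rho\|_2^2=\|W_\rho^{(n)}-W_\rho\|_2^2+O\!\left(\frac{N(n)^{7/3}}{n}\right).$$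
   Context: For $k\ge 0$ let $\psi_k(x)=H_k(x)e^{-x^2/2}$, where $H_k$ is the Hermite polynomial of degree $k$ (for the weight $e^{-x^2}$) normalized so that $\int_{\mathbb{R}}\psi_k^2=1$; $\{\psi_k\}_{k\ge0}$ is an orthonormal basis of $L_2(\mathbb{R})$. A density matrix is an infinite complex matrix $\rho=[\rho_{j,k}]_{j,k\ge 0}$ representing (in the basis $\{\psi_k\}$) a positive semidefinite self-adjoint operator on $L_2(\mathbb{R})$ with $\mathrm{Tr}\,\rho=1$. To $\rho$ is associated the probability density on $\mathbb{R}\times[0,\pi]$ (with respect to $dx\,d\phi$) $$p_\rho(x,\phi)=\frac1\pi\sum_{j,k=0}^\infty\rho_{j,k}\,\psi_k(x)\psi_j(x)e^{-i(j-k)\phi}.$$ Pattern functions: for $j\ge k\ge0$, $f_{k,j}(x)=\frac{d}{dx}\big(\psi_k(x)\varphi_j(x)\big)$ and $f_{j,k}=f_{k,j}$, where $\varphi_j$ is the unbounded real solution of $-\frac12\varphi''+\frac12x^2\varphi=(j+\tfrac12)\varphi$ having parity opposite to that of $\psi_j$ and normalized by the Wronskian condition $\psi_j\varphi_j'-\psi_j'\varphi_j=2$. These are bounded real functions. Put $F_{k,j}(x,\phi)=f_{k,j}(x)e^{-i(j-k)\phi}$; with this normalization $\int_0^\pi\int_{\mathbb{R}}F_{k,j}(x,\phi)\,p_\rho(x,\phi)\,dx\,d\phi=\rho_{k,j}$ for every density matrix $\rho$. Wigner function: let $(\mathbf{Q}\psi)(x)=x\psi(x)$ and $(\mathbf{P}\psi)(x)=-i\psi'(x)$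 on $L_2(\mathbb{R})$. For a trace class operator $A$ on $L_2(\mathbb{R})$, $W_A\in L_2(\mathbb{R}^2)$ is the function whose Fourier transform is $$\iint e^{-iuq-ivp}W_A(q,p)\,dq\,dp=\mathrm{Tr}\big(A\exp(-iu\mathbf{Q}-iv\mathbf{P})\big).$$ $W_\rho$ is the Wigner function of $\rho$, and $W_{k,j}$ is the function $W_A$ for $A$ the operator whose matrix in the basis $\{\psi_k\}$ has $(k,j)$ entry equal to $1$ and all other entries $0$; thus $W_\rho=\sum_{k,j}\rho_{k,j}W_{k,j}$. The norm $\|\cdot\|_2$ is that of $L_2(\mathbb{R}^2,dq\,dp)$. *)

theory Defs
  imports "HOL-Probability.Probability" "HOL-Complex_Analysis.Complex_Analysis"
begin

subsection \<open>Square-integrable functions and operators on them\<close>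

text \<open>Elements of \<open>L\<^sub>2\<close> are represented by functions, not by classes modulo null sets; hence
  linearity of operators is only required almost everywhere.\<close>

definition L2 :: "'a measure \<Rightarrow> ('a \<Rightarrow> complex) set" where
  "L2 M = {f \<in> borel_measurable M. integrable M (\<lambda>x. (cmod (f x))\<^sup>2)}"

definition L2_inner :: "'a measure \<Rightarrow> ('a \<Rightarrow> complex) \<Rightarrow> ('a \<Rightarrow> complex) \<Rightarrow> complex" where
  "L2_inner M f g = (\<integral>x. cnj (f x) * g x \<partial>M)"

definition L2_norm :: "'a measure \<Rightarrow> ('a \<Rightarrow> complex) \<Rightarrow> real" where
  "L2_norm M f = sqrt (\<integral>x. (cmod (f x))\<^sup>2 \<partial>M)"

type_synonym operator = "(real \<Rightarrow> complex) \<Rightarrow> (real \<Rightarrow> complex)"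

definition bounded_operator :: "operator \<Rightarrow> bool" where
  "bounded_operator A \<longleftrightarrow>
     (\<forall>f \<in> L2 lborel. A f \<in> L2 lborel) \<and>
     (\<forall>f \<in> L2 lborel. \<forall>g \<in> L2 lborel. \<forall>a b.
        AE x in lborel. A (\<lambda>y. a * f y + b * g y) x = a * A f x + b * A g x) \<and>
     (\<exists>C. \<forall>f \<in> L2 lborel. L2_norm lborel (A f) \<le> C * L2_norm lborel f)"

definition self_adjoint :: "operator \<Rightarrow> bool" where
  "self_adjoint A \<longleftrightarrow>
     (\<forall>f \<in> L2 lborel. \<forall>g \<in> L2 lborel. L2_inner lborel f (A g) = L2_inner lborel (A f) g)"

definition positive_semidefinite :: "operator \<Rightarrow> bool" where
  "positive_semidefinite A \<longleftrightarrow> (\<forall>f \<in> L2 lborel. 0 \<le> Re (L2_inner lborel f (A f)))"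


subsection \<open>Hermite functions\<close>

primrec hermite :: "nat \<Rightarrow> real poly" where
  "hermite 0 = 1"
| "hermite (Suc k) = [:0, 2:] * hermite k - pderiv (hermite k)"

lemma hermite_Rodrigues:
  "(deriv ^^ k) (\<lambda>x. exp (- x\<^sup>2)) = (\<lambda>x::real. (- 1) ^ k * poly (hermite k) x * exp (- x\<^sup>2))"
proof (induction k)
  case (Suc k)
  have "((\<lambda>x. (- 1) ^ k * poly (hermite k) x * exp (- x\<^sup>2)) has_real_derivative
      (- 1) ^ Suc k * poly (hermite (Suc k)) x * exp (- x\<^sup>2)) (at x)" for x
    by (auto intro!: derivative_eq_intros simp: algebra_simps)
  then have "deriv (\<lambda>x. (- 1) ^ k * poly (hermite k) x * exp (- x\<^sup>2)) =
      (\<lambda>x. (- 1) ^ Suc k * poly (hermite (Suc k)) x * exp (- x\<^sup>2))"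
    by (auto intro!: DERIV_imp_deriv)
  with Suc show ?case by simp
qed simp

definition hermite_fun :: "nat \<Rightarrow> real \<Rightarrow> real" where
  "hermite_fun k x = poly (hermite k) x * exp (- x\<^sup>2 / 2) /
     sqrt (\<integral>y. (poly (hermite k) y * exp (- y\<^sup>2 / 2))\<^sup>2 \<partial>lborel)"

abbreviation hermite_vec :: "nat \<Rightarrow> real \<Rightarrow> complex" where
  "hermite_vec k \<equiv> \<lambda>x. complex_of_real (hermite_fun k x)"

definition has_matrix :: "operator \<Rightarrow> (nat \<Rightarrow> nat \<Rightarrow> complex) \<Rightarrow> bool" where
  "has_matrix A m \<longleftrightarrow>
     (\<forall>j k. m j k = L2_inner lborel (hermite_vec j) (A (hermite_vec k)))"

definition has_trace :: "operator \<Rightarrow> complex \<Rightarrow> bool" where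
  "has_trace A t \<longleftrightarrow> (\<lambda>k. L2_inner lborel (hermite_vec k) (A (hermite_vec k))) sums t"

definition density_matrix :: "(nat \<Rightarrow> nat \<Rightarrow> complex) \<Rightarrow> bool" where
  "density_matrix \<rho> \<longleftrightarrow>
     (\<exists>A. bounded_operator A \<and> self_adjoint A \<and> positive_semidefinite A \<and>
          has_trace A 1 \<and> has_matrix A \<rho>)"


subsection \<open>The law of the observations\<close>

definition quadrature_space :: "(real \<times> real) measure" where
  "quadrature_space = lborel \<Otimes>\<^sub>M restrict_space lborel {0..pi}"

text \<open>For a density matrix the double series need not converge absolutely at a given point.
  Its square partial sums always converge in \<open>L\<^sub>1\<close>, because truncations of a trace class operator
  converge in trace norm; the density is their limit, determined up to null sets.\<close>

definition quadrature_density :: "(nat \<Rightarrow> nat \<Rightarrow> complex) \<Rightarrow> (real \<times> real \<Rightarrow> real) \<Rightarrow> bool" where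
  "quadrature_density \<rho> p \<longleftrightarrow>
     integrable quadrature_space p \<and>
     (\<lambda>m. \<integral>(x, \<phi>). cmod (complex_of_real (p (x, \<phi>)) -
         1 / of_real pi * (\<Sum>j<m. \<Sum>k<m. \<rho> j k *
           of_real (hermite_fun k x * hermite_fun j x) *
           exp (- \<i> * (of_nat j - of_nat k) * of_real \<phi>)))
       \<partial>quadrature_space) \<longlonglongrightarrow> 0"


subsection \<open>Pattern functions\<close>

definition irregular_solution :: "nat \<Rightarrow> (real \<Rightarrow> real) \<Rightarrow> bool" where
  "irregular_solution j g \<longleftrightarrow>
     (\<exists>g' g''.
        (\<forall>x. (g has_real_derivative g' x) (at x)) \<and>
        (\<forall>x. (g' has_real_derivative g'' x) (at x)) \<and>
        (\<forall>x. - (1 / 2) * g'' x + 1 / 2 * x\<^sup>2 * g x = (real j + 1 / 2) * g x) \<and>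
        (\<forall>x. hermite_fun j x * g' x - deriv (hermite_fun j) x * g x = 2)) \<and>
     (\<forall>x. g (- x) = (- 1) ^ Suc j * g x) \<and>
     \<not> bounded (range g)"

definition irregular_fun :: "nat \<Rightarrow> real \<Rightarrow> real" where
  "irregular_fun j = (THE g. irregular_solution j g)"

definition pattern_fun :: "nat \<Rightarrow> nat \<Rightarrow> real \<Rightarrow> real" where
  "pattern_fun k j =
     deriv (\<lambda>x. hermite_fun (min k j) x * irregular_fun (max k j) x)"

definition pattern_kernel :: "nat \<Rightarrow> nat \<Rightarrow> real \<times> real \<Rightarrow> complex" where
  "pattern_kernel k j = (\<lambda>(x, \<phi>).
     of_real (pattern_fun k j x) * exp (- \<i> * (of_nat j - of_nat k) * of_real \<phi>))"


subsection \<open>Wigner functions\<close>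

definition position :: operator where
  "position f = (\<lambda>x. of_real x * f x)"

definition momentum :: operator where
  "momentum f = (\<lambda>x. - \<i> * vector_derivative f (at x))"

definition operator_exp :: "operator \<Rightarrow> operator" where
  "operator_exp T f = (\<lambda>x. \<Sum>n. (T ^^ n) f x / fact n)"

text \<open>The exponential series is only meaningful on analytic vectors. Hermite functions are such
  vectors for \<open>-\<i>uQ - \<i>vP\<close>, and the trace below evaluates the exponential on nothing else.
  On them the series gives the values of the unitary operator: multiplication by a phase
  after translation, see \<open>weyl_hermite_vec\<close>.\<close>

definition weyl :: "real \<Rightarrow> real \<Rightarrow> operator" where
  "weyl u v = operator_exp
     (\<lambda>f x. - \<i> * of_real u * position f x - \<i> * of_real v * momentum f x)"

lemma weyl_hermite_vec:
  "weyl u v (hermite_vec k) x =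
     exp (- \<i> * of_real (u * x) + \<i> * of_real (u * v) / 2) * hermite_vec k (x - v)"
proof -
  define T :: operator where
    "T = (\<lambda>f x. - \<i> * of_real u * position f x - \<i> * of_real v * momentum f x)"
  define G :: "complex poly \<Rightarrow> real \<Rightarrow> complex" where
    "G = (\<lambda>p x. poly p (of_real x) * exp (- (of_real x)\<^sup>2 / 2))"
  define S :: "complex poly \<Rightarrow> complex poly" where
    "S = (\<lambda>p. [:0, of_real v - \<i> * of_real u:] * p - smult (of_real v) (pderiv p))"
  define F :: "complex poly \<Rightarrow> complex \<Rightarrow> complex" where
    "F = (\<lambda>p t. exp (- \<i> * t * of_real u * of_real x + \<i> * t\<^sup>2 * of_real u * of_real v / 2)
        * (poly p (of_real x - t * of_real v) * exp (- (of_real x - t * of_real v)\<^sup>2 / 2)))"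
  have TG: "T (G p) = G (S p)" for p
  proof
    fix y :: real
    define h :: "complex \<Rightarrow> complex" where "h = (\<lambda>z. poly p z * exp (- z\<^sup>2 / 2))"
    have "(h has_field_derivative
        (poly (pderiv p) y - y * poly p y) * exp (- (of_real y)\<^sup>2 / 2)) (at (of_real y))"
      unfolding h_def by (auto intro!: derivative_eq_intros simp: algebra_simps)
    from field_vector_diff_chain_at[OF has_vector_derivative_of_real[OF DERIV_ident] this]
    have "(G p has_vector_derivative
        (poly (pderiv p) y - y * poly p y) * exp (- (of_real y)\<^sup>2 / 2)) (at y)"
      by (simp add: G_def h_def o_def)
    then have vd: "vector_derivative (G p) (at y) =
        (poly (pderiv p) y - y * poly p y) * exp (- (of_real y)\<^sup>2 / 2)"
      by (rule vector_derivative_at)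
    show "T (G p) y = G (S p) y"
      unfolding T_def position_def momentum_def vd
      by (simp add: S_def G_def algebra_simps)
  qed
  have DF: "(F p has_field_derivative F (S p) t) (at t)" for p t
  proof -
    let ?e = "\<lambda>t. exp (- \<i> * t * of_real u * of_real x + \<i> * t\<^sup>2 * of_real u * of_real v / 2)"
    let ?y = "\<lambda>t. of_real x - t * of_real v :: complex"
    let ?g = "\<lambda>t. exp (- (?y t)\<^sup>2 / 2)"
    have e: "(?e has_field_derivative ?e t * (- \<i> * of_real u * ?y t)) (at t)"
      by (auto intro!: derivative_eq_intros simp: algebra_simps)
    have y: "(?y has_field_derivative - of_real v) (at t)"
      by (auto intro!: derivative_eq_intros)
    have p: "((\<lambda>t. poly p (?y t)) has_field_derivative poly (pderiv p) (?y t) * - of_real v) (at t)"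
      by (rule DERIV_chain2[OF poly_DERIV y])
    have g: "(?g has_field_derivative ?g t * (?y t * of_real v)) (at t)"
      by (rule derivative_eq_intros y refl | simp)+
    show ?thesis
      unfolding F_def S_def
      by (rule DERIV_cong[OF DERIV_mult[OF e DERIV_mult[OF p g]]])
         (simp only: poly_diff poly_mult poly_smult poly_pCons poly_0, algebra)
  qed
  have Tn: "(T ^^ n) (G p) = G ((S ^^ n) p)" for n p
    by (induction n) (simp_all add: TG)
  have Dn: "(deriv ^^ n) (F p) = F ((S ^^ n) p)" for n p
    by (induction n) (auto intro!: DERIV_imp_deriv DF)
  have F0: "F p 0 = G p x" for p
    by (simp add: F_def G_def)
  have "F p holomorphic_on ball 0 2" for p
    using DF by (auto intro: holomorphic_on_subset[of _ UNIV] simp: holomorphic_on_open)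
  from holomorphic_power_series[OF this, of 1]
  have sums: "(\<lambda>n. (T ^^ n) (G p) x / fact n) sums F p 1" for p
    by (simp add: Dn Tn F0)
  define c where "c = sqrt (\<integral>y. (poly (hermite k) y * exp (- y\<^sup>2 / 2))\<^sup>2 \<partial>lborel)"
  define q where "q = smult (inverse (of_real c)) (map_poly complex_of_real (hermite k))"
  have of_real_poly: "poly (map_poly complex_of_real r) (of_real y) = of_real (poly r y)"
    for r :: "real poly" and y
    by (induction r) (simp_all add: map_poly_pCons)
  have of_real_gauss: "complex_of_real (exp (- y\<^sup>2 / 2)) = exp (- (of_real y)\<^sup>2 / 2)" for y
    unfolding exp_of_real[symmetric] by simp
  have q: "hermite_vec k = G q"
  proof
    fix y
    have "hermite_vec k y = of_real (poly (hermite k) y) * of_real (exp (- y\<^sup>2 / 2)) / of_real c"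
      by (simp only: hermite_fun_def c_def of_real_divide of_real_mult)
    then show "hermite_vec k y = G q y"
      unfolding of_real_gauss by (simp only: G_def q_def of_real_poly poly_smult divide_inverse mult_ac)
  qed
  have "weyl u v (hermite_vec k) x = F q 1"
    unfolding weyl_def operator_exp_def T_def[symmetric] q
    by (rule sums_unique[OF sums, symmetric])
  also have "F q 1 = exp (- \<i> * of_real (u * x) + \<i> * of_real (u * v) / 2) * G q (x - v)"
    by (simp add: F_def G_def mult.assoc)
  also have "G q (x - v) = hermite_vec k (x - v)"
    by (rule fun_cong[OF q, symmetric])
  finally show ?thesis .
qed

text \<open>The Fourier transform on \<open>L\<^sub>2\<close> is the \<open>L\<^sub>2\<close>-limit of the transforms of the truncations
  to discs.\<close>

definition has_L2_fourier :: "(real \<times> real \<Rightarrow> complex) \<Rightarrow> (real \<times> real \<Rightarrow> complex) \<Rightarrow> bool" where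
  "has_L2_fourier f g \<longleftrightarrow>
     f \<in> L2 lborel \<and> g \<in> L2 lborel \<and>
     ((\<lambda>R. L2_norm lborel (\<lambda>(u, v).
         (LINT (q, p) : cball 0 R | lborel.
            exp (- \<i> * of_real (u * q) - \<i> * of_real (v * p)) * f (q, p)) - g (u, v)))
       \<longlongrightarrow> 0) at_top"

text \<open>\<open>W\<close> is a representative of the Wigner function of the operator with matrix \<open>m\<close>; the
  notion is meant for matrices of trace class operators, such as density matrices and
  matrix units.\<close>

definition wigner_function :: "(nat \<Rightarrow> nat \<Rightarrow> complex) \<Rightarrow> (real \<times> real \<Rightarrow> complex) \<Rightarrow> bool" where
  "wigner_function m W \<longleftrightarrow>
     (\<exists>A g. bounded_operator A \<and> has_matrix A m \<and>
        (\<forall>u v. has_trace (\<lambda>f. A (weyl u v f)) (g (u, v))) \<and> has_L2_fourier W g)"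

definition unit_matrix :: "nat \<Rightarrow> nat \<Rightarrow> nat \<Rightarrow> nat \<Rightarrow> complex" where
  "unit_matrix k j a b = (if a = k \<and> b = j then 1 else 0)"


subsection \<open>The estimator\<close>

definition wigner_truncation ::
  "(nat \<Rightarrow> nat \<Rightarrow> complex) \<Rightarrow> (nat \<Rightarrow> nat \<Rightarrow> real \<times> real \<Rightarrow> complex) \<Rightarrow> nat \<Rightarrow> real \<times> real \<Rightarrow> complex" where
  "wigner_truncation c W m z = (\<Sum>k<m. \<Sum>j<m. c k j * W k j z)"

definition matrix_estimator :: "(nat \<Rightarrow> real \<times> real) \<Rightarrow> nat \<Rightarrow> nat \<Rightarrow> nat \<Rightarrow> complex" where
  "matrix_estimator s n k j = 1 / of_nat n * (\<Sum>l=1..n. pattern_kernel k j (s l))"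

end

theory Submission
  imports Defs
begin

text \<open>
  Everything rests on the matrix elements \<open>weyl_matrix k j u v\<close> of the Weyl operators in the
  Hermite basis, which satisfy ladder relations in \<open>k\<close> and \<open>j\<close>.

  On the axis \<open>v = 0\<close> they are the Fourier transforms of \<open>\<psi>\<^sub>k \<psi>\<^sub>j\<close>. The ladder relations are shared by
  \<open>\<psi>\<^sub>k \<phi>\<^sub>j\<close> and by the Hilbert transform of \<open>\<psi>\<^sub>k \<psi>\<^sub>j\<close>, so these agree up to a factor for \<open>k \<le> j\<close>, and
  \<open>f\<^sub>k\<^sub>j(x)\<close> is half the integral over \<open>r\<close> of \<open>\<bar>r\<bar> * weyl_matrix k j r 0 * exp (\<i> r x)\<close>. Unbiasedness of
  the estimator becomes an orthogonality relation with weight \<open>\<bar>r\<bar>\<close>. For the variance, cut the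
  integral at \<open>R = N powr (11/18)\<close>: the part \<open>\<bar>r\<bar> \<le> R\<close> is the matrix of multiplication by a function
  whose squared norm is of order \<open>R\<^sup>3\<close>, so Bessel's inequality and \<open>(\<Sum>k<N. \<psi>\<^sub>k\<^sup>2) \<le> sqrt (2 N)\<close> bound
  the sum of its squares by a multiple of \<open>sqrt N * R\<^sup>3 = N powr (7/3)\<close>; the rest is of lower order, as
  \<open>weyl_matrix k j r 0\<close> decays rapidly beyond \<open>r\<close> of order \<open>sqrt N\<close>.

  In the plane, the ladder relations give the orthogonality of the Fourier transforms of the Wigner
  functions \<open>W\<^sub>k\<^sub>j\<close>, hence of the latter. The mean square error then splits into the bias, a cross
  term that vanishes by unbiasedness, and the sum of the variances divided by \<open>2 \<pi>\<close>.
\<close>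

subsection \<open>Superexponentially decaying functions\<close>

text \<open>The exponent \<open>11/18\<close> is the largest that the low part tolerates, as
  \<open>1/2 + 3 * 11/18 = 7/3\<close>. What matters is that it exceeds \<open>1/2\<close>, since
  the matrix elements decay only beyond \<open>r\<close> of order \<open>sqrt N\<close>; the excess
  \<open>1/9\<close> makes sixteen powers of \<open>r\<close> sufficient for the rest. Entrywise
  bounds on the low part would have to be paid for \<open>N^2\<close> entries, which is why it is
  treated as a matrix.

  The phases run over the half circle \<open>{0..pi}\<close>, where exponentials of odd frequency
  are not orthogonal to the constants. Unbiasedness therefore rests on two facts: the orthogonality
  with weight \<open>\<bar>r\<bar>\<close> on the diagonals \<open>k + b = j + a\<close>, where the
  frequency is 0, and a parity argument when the frequency is odd.

  Neither the irregular solutions nor the Wigner functions come with formulas. The former are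
  definite descriptions, so a solution has to be built and shown to be unique. The latter are known
  only through an \<open>L\<^sub>2\<close>-limit of transforms, so duality, inversion and
  Plancherel's identity in the plane have to be established first.\<close>

definition rapid :: "('a::real_normed_vector \<Rightarrow> 'b::real_normed_vector) \<Rightarrow> bool" where
  "rapid f \<longleftrightarrow> (\<forall>c. \<exists>C. \<forall>z. norm (f z) * exp (c * norm z) \<le> C)"

lemma rapidE:
  assumes "rapid f"
  obtains C where "C \<ge> 0" "\<And>z. norm (f z) \<le> C * exp (- c * norm z)"
proof -
  obtain C where C: "\<And>z. norm (f z) * exp (c * norm z) \<le> C"
    using assms unfolding rapid_def by blast
  have "0 \<le> norm (f 0) * exp (c * norm (0::'a))" by simp
  also have "\<dots> \<le> C" by (rule C)
  finally have "C \<ge> 0" .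
  moreover have "norm (f z) \<le> C * exp (- c * norm z)" for z
    using C[of z] by (simp add: exp_minus field_simps)
  ultimately show thesis by (rule that)
qed

text \<open>Decay against every exponential rate leaves room to absorb a factor of exponential
  growth. Hence the class is stable under multiplication by polynomials, by
  \<open>\<bar>x\<bar>\<close> and by the phase space coordinates, and integrability never has to be
  checked by hand.\<close>

lemma rapid_bound:
  assumes "rapid f" and "\<And>z. norm (g z) \<le> C * exp (c * norm z) * norm (f z)"
  shows "rapid g"
  unfolding rapid_def
proof
  fix d
  obtain K where K: "K \<ge> 0" "\<And>z. norm (f z) \<le> K * exp (- (c + d) * norm z)"
    using rapidE[OF assms(1)] by blast
  have "norm (g z) * exp (d * norm z) \<le> \<bar>C\<bar> * K" for z
  proof -
    have "norm (g z) \<le> \<bar>C\<bar> * exp (c * norm z) * norm (f z)"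
      by (rule order_trans[OF assms(2)]) (intro mult_right_mono; simp)
    also have "\<dots> \<le> \<bar>C\<bar> * exp (c * norm z) * (K * exp (- (c + d) * norm z))"
      by (intro mult_left_mono K) auto
    finally have "norm (g z) * exp (d * norm z)
        \<le> \<bar>C\<bar> * exp (c * norm z) * (K * exp (- (c + d) * norm z)) * exp (d * norm z)"
      by (rule mult_right_mono) simp
    also have "\<dots> = \<bar>C\<bar> * K * (exp (c * norm z) * exp (- (c + d) * norm z) * exp (d * norm z))"
      by simp
    also have "exp (c * norm z) * exp (- (c + d) * norm z) * exp (d * norm z) = 1"
      unfolding exp_add[symmetric] by (simp add: algebra_simps)
    finally show ?thesis by simp
  qed
  then show "\<exists>C. \<forall>z. norm (g z) * exp (d * norm z) \<le> C" by blast
qed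

lemma rapid_dominated: "rapid f \<Longrightarrow> (\<And>z. norm (g z) \<le> norm (f z)) \<Longrightarrow> rapid g"
  by (rule rapid_bound[where C = 1 and c = 0]) auto

lemma rapid_add:
  assumes "rapid f" "rapid g" shows "rapid (\<lambda>z. f z + g z)"
  unfolding rapid_def
proof
  fix c
  obtain K where K: "\<And>z. norm (f z) * exp (c * norm z) \<le> K"
    using assms(1) unfolding rapid_def by blast
  obtain L where L: "\<And>z. norm (g z) * exp (c * norm z) \<le> L"
    using assms(2) unfolding rapid_def by blast
  have "norm (f z + g z) * exp (c * norm z) \<le> K + L" for z
  proof -
    have "norm (f z + g z) * exp (c * norm z) \<le> (norm (f z) + norm (g z)) * exp (c * norm z)"
      by (intro mult_right_mono norm_triangle_ineq) simp
    also have "\<dots> \<le> K + L" using K[of z] L[of z] by (simp add: algebra_simps)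
    finally show ?thesis .
  qed
  then show "\<exists>C. \<forall>z. norm (f z + g z) * exp (c * norm z) \<le> C" by blast
qed

lemma rapid_cmult: "rapid f \<Longrightarrow> rapid (\<lambda>z. c * f z)" for c :: "'b::real_normed_algebra"
  by (rule rapid_bound[where C = "norm c" and c = 0]) (auto intro: norm_mult_ineq)

lemma rapid_cmult2: "rapid f \<Longrightarrow> rapid (\<lambda>z. f z * c)" for c :: "'b::real_normed_algebra"
  by (rule rapid_bound[where C = "norm c" and c = 0])
     (auto intro: order_trans[OF norm_mult_ineq] simp: mult.commute)

lemma rapid_uminus: "rapid f \<Longrightarrow> rapid (\<lambda>z. - f z)"
  by (rule rapid_dominated) auto

lemma rapid_diff: "rapid f \<Longrightarrow> rapid g \<Longrightarrow> rapid (\<lambda>z. f z - g z)"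
  using rapid_add[of f "\<lambda>z. - g z"] rapid_uminus[of g] by simp

lemma rapid_zero: "rapid (\<lambda>z. 0)"
  unfolding rapid_def by auto

lemma rapid_sum: "(\<And>i. i \<in> I \<Longrightarrow> rapid (f i)) \<Longrightarrow> rapid (\<lambda>z. \<Sum>i\<in>I. f i z)"
  by (induction I rule: infinite_finite_induct) (auto intro: rapid_zero rapid_add)

lemma rapid_of_real: "rapid f \<Longrightarrow> rapid (\<lambda>z. of_real (f z) :: 'b::real_normed_algebra_1)"
  by (rule rapid_dominated) auto

lemma rapid_bounded:
  assumes "rapid f" obtains C where "C \<ge> 0" "\<And>z. norm (f z) \<le> C"
  using rapidE[OF assms, where c = 0] by (metis exp_zero mult.right_neutral mult_zero_left neg_0_equal_iff_equal)

lemma rapid_mult: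
  fixes f g :: "'a::real_normed_vector \<Rightarrow> 'b::real_normed_algebra"
  assumes "rapid f" "rapid g" shows "rapid (\<lambda>z. f z * g z)"
proof -
  obtain C where C: "C \<ge> 0" "\<And>z. norm (f z) \<le> C" using rapid_bounded[OF assms(1)] by blast
  have "norm (f z * g z) \<le> C * exp (0 * norm z) * norm (g z)" for z
    using order_trans[OF norm_mult_ineq mult_right_mono[OF C(2)]] by simp
  then show ?thesis by (rule rapid_bound[OF assms(2)])
qed

lemma rapid_shift:
  assumes "rapid f" shows "rapid (\<lambda>x. f (x - v))"
  unfolding rapid_def
proof
  fix c :: real
  obtain K where K: "K \<ge> 0" "\<And>z. norm (f z) \<le> K * exp (- \<bar>c\<bar> * norm z)"
    using rapidE[OF assms] by blast
  have "norm (f (x - v)) * exp (c * norm x) \<le> K * exp (\<bar>c\<bar> * norm v)" for x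
  proof -
    have "c * norm x \<le> \<bar>c\<bar> * norm x" by (intro mult_right_mono) auto
    also have "\<bar>c\<bar> * norm x \<le> \<bar>c\<bar> * (norm (x - v) + norm v)"
      by (intro mult_left_mono) (auto simp: norm_diff_triangle_le norm_triangle_sub add.commute)
    finally have "exp (c * norm x) \<le> exp (\<bar>c\<bar> * norm (x - v)) * exp (\<bar>c\<bar> * norm v)"
      unfolding exp_add[symmetric] by (simp add: algebra_simps)
    then have "norm (f (x - v)) * exp (c * norm x) \<le>
        (K * exp (- \<bar>c\<bar> * norm (x - v))) * (exp (\<bar>c\<bar> * norm (x - v)) * exp (\<bar>c\<bar> * norm v))"
      by (intro mult_mono K) (auto simp: K)
    also have "\<dots> = K * (exp (- \<bar>c\<bar> * norm (x - v)) * exp (\<bar>c\<bar> * norm (x - v))) * exp (\<bar>c\<bar> * norm v)"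
      by (simp only: mult_ac)
    also have "\<dots> = K * exp (\<bar>c\<bar> * norm v)" unfolding exp_add[symmetric] by simp
    finally show ?thesis .
  qed
  then show "\<exists>C. \<forall>x. norm (f (x - v)) * exp (c * norm x) \<le> C" by blast
qed

lemma one_plus_square_le_exp: "1 + x\<^sup>2 \<le> exp (2 * \<bar>x\<bar>)" for x :: real
proof -
  have "1 + x\<^sup>2 \<le> (1 + \<bar>x\<bar>)\<^sup>2" by (simp add: power2_eq_square algebra_simps)
  also have "\<dots> \<le> (exp \<bar>x\<bar>)\<^sup>2" by (intro power_mono) (auto simp: exp_ge_add_one_self)
  also have "\<dots> = exp (2 * \<bar>x\<bar>)" by (simp add: exp_double)
  finally show ?thesis .
qed

lemma integrable_inverse_one_plus_square: "integrable lborel (\<lambda>x::real. 1 / (1 + x\<^sup>2))"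
  using integrable_inverse_1_plus_square
  by (simp add: set_integrable_def einterval_def inverse_eq_divide)

lemma integral_inverse_one_plus_square: "(LBINT x. 1 / (1 + (x::real)\<^sup>2)) = pi"
  using LBINT_inverse_1_plus_square
  by (simp add: interval_lebesgue_integral_def set_lebesgue_integral_def einterval_def inverse_eq_divide)

lemma rapid_inverse_square_bound:
  assumes "rapid f"
  obtains C where "C \<ge> 0" "\<And>x::real. norm (f x) \<le> C * (1 / (1 + x\<^sup>2))"
proof -
  obtain K where K: "K \<ge> 0" "\<And>z. norm (f z) \<le> K * exp (- 2 * norm z)"
    using rapidE[OF assms] by blast
  have "norm (f x) \<le> K * (1 / (1 + x\<^sup>2))" for x
  proof -
    have pos: "0 < 1 + x\<^sup>2" by (simp add: add_pos_nonneg)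
    have "exp (- 2 * norm x) \<le> 1 / (1 + x\<^sup>2)"
      using one_plus_square_le_exp[of x] pos by (simp add: exp_minus divide_inverse del: inverse_eq_divide)
    then show ?thesis using K by (meson mult_left_mono order_trans)
  qed
  with K(1) show thesis by (rule that)
qed

lemma rapid_integrable:
  fixes f :: "real \<Rightarrow> 'b::{banach, second_countable_topology}"
  assumes "rapid f" and [measurable]: "f \<in> borel_measurable borel"
  shows "integrable lborel f"
proof -
  obtain C where C: "C \<ge> 0" "\<And>x::real. norm (f x) \<le> C * (1 / (1 + x\<^sup>2))"
    using rapid_inverse_square_bound[OF assms(1)] by blast
  show ?thesis
    by (rule Bochner_Integration.integrable_bound[OF
          integrable_mult_right[OF integrable_inverse_one_plus_square, of C]])
       (use C in auto)
qed

lemma integrable_prod_mult: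
  fixes f :: "'a \<Rightarrow> 'c::{real_normed_field, banach, second_countable_topology}"
  assumes "sigma_finite_measure M" "sigma_finite_measure N"
    and f[measurable]: "integrable M f" and g[measurable]: "integrable N g"
  shows "integrable (M \<Otimes>\<^sub>M N) (\<lambda>(x, y). f x * g y)"
proof -
  interpret M: sigma_finite_measure M by fact
  interpret N: sigma_finite_measure N by fact
  interpret pair_sigma_finite M N ..
  show ?thesis
  proof (rule Fubini_integrable)
    show "AE x in M. integrable N (\<lambda>y. case (x, y) of (x, y) \<Rightarrow> f x * g y)" using g by simp
    show "integrable M (\<lambda>x. \<integral>y. norm (case (x, y) of (x, y) \<Rightarrow> f x * g y) \<partial>N)"
      using f by (simp add: norm_mult)
  qed simp
qed

lemma integrable_lborel_prod_mult:
  fixes f g :: "real \<Rightarrow> 'c::{real_normed_field, banach, second_countable_topology}"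
  assumes "integrable lborel f" "integrable lborel g"
  shows "integrable lborel (\<lambda>(x, y). f x * g y)"
  unfolding lborel_prod[symmetric]
  by (intro integrable_prod_mult assms lborel.sigma_finite_measure_axioms)

lemma rapid_integrable2:
  fixes f :: "real \<times> real \<Rightarrow> 'b::{banach, second_countable_topology}"
  assumes "rapid f" and [measurable]: "f \<in> borel_measurable borel"
  shows "integrable lborel f"
proof -
  obtain K where K: "K \<ge> 0" "\<And>z. norm (f z) \<le> K * exp (- 4 * norm z)"
    using rapidE[OF assms(1)] by blast
  have bnd: "norm (f (u, v)) \<le> K * (1 / (1 + u\<^sup>2) * (1 / (1 + v\<^sup>2)))" for u v
  proof -
    have "\<bar>u\<bar> \<le> norm (u, v)" "\<bar>v\<bar> \<le> norm (u, v)"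
      using norm_fst_le[of u v] norm_snd_le[of v u] by auto
    then have "exp (- 4 * norm (u, v)) \<le> exp (- (2 * \<bar>u\<bar>)) * exp (- (2 * \<bar>v\<bar>))"
      unfolding exp_add[symmetric] by simp
    also have "\<dots> \<le> 1 / (1 + u\<^sup>2) * (1 / (1 + v\<^sup>2))"
    proof -
      have "exp (- (2 * \<bar>x\<bar>)) \<le> 1 / (1 + x\<^sup>2)" for x :: real
        using one_plus_square_le_exp[of x] add_pos_nonneg[of 1 "x\<^sup>2"]
        by (simp add: exp_minus divide_inverse del: inverse_eq_divide)
      then show ?thesis by (intro mult_mono) auto
    qed
    finally show ?thesis using K by (meson mult_left_mono order_trans)
  qed
  have int: "integrable lborel (\<lambda>(u::real, v::real). K * (1 / (1 + u\<^sup>2) * (1 / (1 + v\<^sup>2))))"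
    using integrable_lborel_prod_mult[OF integrable_inverse_one_plus_square integrable_inverse_one_plus_square]
    by (auto simp: case_prod_unfold simp del: times_divide_eq_left times_divide_eq_right intro: integrable_mult_right)
  show ?thesis
    by (rule Bochner_Integration.integrable_bound[OF int]) (use bnd K in auto)
qed

section \<open>Boundary terms in integrals of derivatives\<close>

lemma rapid_tendsto_0:
  assumes "rapid f" shows "(f \<longlongrightarrow> 0) at_infinity"
proof -
  obtain K where K: "K \<ge> 0" "\<And>z. norm (f z) \<le> K * exp (- 1 * norm z)"
    using rapidE[OF assms] by blast
  have "((\<lambda>z::'a. K * exp (- norm z)) \<longlongrightarrow> K * 0) at_infinity"
  proof (intro tendsto_mult tendsto_const)
    have "filterlim (\<lambda>z::'a. - norm z) at_bot at_infinity"
      by (intro filterlim_uminus_at_top[THEN iffD1] filterlim_at_infinity_imp_norm_at_top filterlim_ident)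
    then show "((\<lambda>z::'a. exp (- norm z)) \<longlongrightarrow> 0) at_infinity"
      by (rule filterlim_compose[OF exp_at_bot])
  qed
  then have "((\<lambda>z::'a. K * exp (- norm z)) \<longlongrightarrow> 0) at_infinity"
    by (simp only: mult_zero_right)
  moreover have "\<forall>\<^sub>F z in at_infinity. norm (f z) \<le> K * exp (- norm z)"
    using K(2) by (intro always_eventually) simp
  ultimately show ?thesis by (rule Lim_null_comparison[rotated])
qed

text \<open>Integration by parts in the form used throughout: an identity between integrals is
  proved by exhibiting the difference of the integrands as a total derivative. The ladder relations
  of the Weyl matrix elements arise in this way.\<close>

lemma integral_derivative_rapid:
  fixes F F' :: "real \<Rightarrow> 'b::euclidean_space"
  assumes d: "\<And>x. (F has_vector_derivative F' x) (at x)" and c: "continuous_on UNIV F'"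
    and r: "rapid F" "rapid F'"
  shows "(LBINT x. F' x) = 0"
proof -
  have int: "integrable lborel F'"
    using r(2) by (rule rapid_integrable) (intro borel_measurable_continuous_onI c)
  have lim: "(F \<longlongrightarrow> 0) at_top" "(F \<longlongrightarrow> 0) at_bot"
    using rapid_tendsto_0[OF r(1)] by (auto intro: tendsto_mono[OF at_top_le_at_infinity] tendsto_mono[OF at_bot_le_at_infinity])
  have "(LBINT x=-\<infinity>..\<infinity>. F' x) = 0 - 0"
  proof (rule interval_integral_FTC_integrable)
    show "isCont F' x" for x using c by (simp add: continuous_on_eq_continuous_at)
    show "set_integrable lborel (einterval (-\<infinity>) \<infinity>) F'"
      using int by (simp add: set_integrable_def einterval_def)
    show "((F \<circ> real_of_ereal) \<longlongrightarrow> 0) (at_right (-\<infinity>))"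
      unfolding ereal_tendsto_simps1 by (rule lim(2))
    show "((F \<circ> real_of_ereal) \<longlongrightarrow> 0) (at_left \<infinity>)"
      unfolding ereal_tendsto_simps1 by (rule lim(1))
  qed (use d in auto)
  then show ?thesis
    by (simp add: interval_lebesgue_integral_def set_lebesgue_integral_def einterval_def)
qed

text \<open>On a half line the boundary term at 0 survives. It yields the pointwise bound on sums of
  squared Hermite functions and every nonzero constant that arises from the jump of
  \<open>sgn\<close>.\<close>

lemma integral_derivative_rapid_half:
  fixes F F' :: "real \<Rightarrow> 'b::euclidean_space"
  assumes d: "\<And>x. (F has_vector_derivative F' x) (at x)" and c: "continuous_on UNIV F'"
    and r: "rapid F" "rapid F'"
  shows "(LBINT x. indicator {0<..} x *\<^sub>R F' x) = - F 0"
proof -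
  have int: "integrable lborel F'"
    using r(2) by (rule rapid_integrable) (intro borel_measurable_continuous_onI c)
  have lim: "(F \<longlongrightarrow> 0) at_top"
    using rapid_tendsto_0[OF r(1)] by (auto intro: tendsto_mono[OF at_top_le_at_infinity])
  have lim0: "(F \<longlongrightarrow> F 0) (at_right 0)"
    using has_vector_derivative_continuous[OF d[of 0]]
    unfolding continuous_at by (rule tendsto_mono[OF at_le[OF subset_UNIV]])
  have "(LBINT x=0..\<infinity>. F' x) = 0 - F 0"
  proof (rule interval_integral_FTC_integrable)
    show "isCont F' x" for x using c by (simp add: continuous_on_eq_continuous_at)
    show "set_integrable lborel (einterval 0 \<infinity>) F'"
      unfolding set_integrable_def using int by (intro integrable_mult_indicator) auto
    show "((F \<circ> real_of_ereal) \<longlongrightarrow> F 0) (at_right 0)"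
      unfolding zero_ereal_def ereal_tendsto_simps1 by (rule lim0)
    show "((F \<circ> real_of_ereal) \<longlongrightarrow> 0) (at_left \<infinity>)"
      unfolding ereal_tendsto_simps1 by (rule lim)
  qed (use d in auto)
  then show ?thesis
    by (simp add: interval_lebesgue_integral_def set_lebesgue_integral_def einterval_def zero_ereal_def greaterThan_def)
qed

subsection \<open>Hermite functions\<close>

text \<open>Closed form of the integral under the root in \<open>hermite_fun\<close>, as confirmed
  by \<open>hermite_inner\<close> at \<open>j = k\<close>.\<close>

definition hermite_norm2 :: "nat \<Rightarrow> real" where
  "hermite_norm2 k = 2 ^ k * fact k * sqrt pi"

lemma hermite_norm2_pos: "hermite_norm2 k > 0"
  by (simp add: hermite_norm2_def)

lemma hermite_norm2_0: "hermite_norm2 0 = sqrt pi"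
  by (simp add: hermite_norm2_def)

lemma hermite_norm2_Suc: "hermite_norm2 (Suc k) = 2 * real (Suc k) * hermite_norm2 k"
  by (simp add: hermite_norm2_def)

lemma pderiv_hermite: "pderiv (hermite (Suc k)) = smult (2 * real (Suc k)) (hermite k)"
proof (induction k)
  case 0
  then show ?case by (simp add: pderiv_pCons pderiv_minus)
next
  case (Suc k)
  have "pderiv (hermite (Suc (Suc k))) =
      smult 2 (hermite (Suc k)) + [:0, 2:] * pderiv (hermite (Suc k)) - pderiv (pderiv (hermite (Suc k)))"
    unfolding hermite.simps(2)[of "Suc k"] pderiv_diff pderiv_mult
    by (simp add: pderiv_pCons del: hermite.simps)
  also have "\<dots> = smult 2 (hermite (Suc k)) + smult (2 * real (Suc k)) (hermite (Suc k))"
    unfolding Suc.IH pderiv_smult by (simp add: smult_diff_right)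
  finally show ?case by (simp add: smult_add_left[symmetric] algebra_simps del: hermite.simps)
qed

lemma rapid_gauss: "rapid (\<lambda>x::real. exp (- (a * x\<^sup>2)))" if "a > 0"
  unfolding rapid_def
proof
  fix c :: real
  have "norm (exp (- (a * x\<^sup>2))) * exp (c * norm x) \<le> exp (c\<^sup>2 / (4 * a))" for x :: real
  proof -
    \<comment> \<open>The square is the one that locates the maximum \<open>c^2 / (4 * a)\<close> of
      \<open>c * \<bar>x\<bar> - a * x^2\<close>.\<close>
    have "0 \<le> (2 * a * \<bar>x\<bar> - c)\<^sup>2" by simp
    then have "c * \<bar>x\<bar> - a * x\<^sup>2 \<le> c\<^sup>2 / (4 * a)"
      using that by (simp add: field_simps power2_eq_square)
    then show ?thesis by (simp add: exp_add[symmetric])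
  qed
  then show "\<exists>C. \<forall>x::real. norm (exp (- (a * x\<^sup>2))) * exp (c * norm x) \<le> C" by blast
qed

lemma norm_power_le_exp: "norm x ^ n \<le> fact n * exp (norm x)" for x :: "'a::real_normed_vector"
proof -
  have "norm x ^ n / fact n \<le> exp (norm x)"
  proof -
    have "(\<Sum>k\<in>{n}. norm x ^ k / fact k) \<le> (\<Sum>k. norm x ^ k / fact k)"
      using summable_exp[of "norm x"] by (intro sum_le_suminf) (auto simp: divide_inverse mult.commute)
    then show ?thesis by (simp add: exp_def divide_inverse mult.commute)
  qed
  then show ?thesis by (simp add: field_simps)
qed

lemma rapid_power_mult:
  fixes f :: "'a::real_normed_field \<Rightarrow> 'a"
  shows "rapid f \<Longrightarrow> rapid (\<lambda>x. x ^ n * f x)"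
  by (erule rapid_bound[where C = "fact n" and c = 1])
     (auto simp: norm_mult norm_power intro!: mult_right_mono norm_power_le_exp)

lemma rapid_ident_mult:
  fixes f :: "'a::real_normed_field \<Rightarrow> 'a"
  shows "rapid f \<Longrightarrow> rapid (\<lambda>x. x * f x)"
  using rapid_power_mult[of f 1] by simp

lemma rapid_poly_mult:
  fixes f :: "'a::real_normed_field \<Rightarrow> 'a"
  assumes "rapid f" shows "rapid (\<lambda>x. poly p x * f x)"
proof (induction p)
  case 0 then show ?case by (simp add: rapid_zero)
next
  case (pCons a p)
  have "rapid (\<lambda>x. a * f x + x * (poly p x * f x))"
    by (intro rapid_add rapid_cmult assms rapid_ident_mult pCons.IH)
  then show ?case by (simp add: algebra_simps)
qed

lemma integral_gauss: "(\<integral>x. exp (- x\<^sup>2) \<partial>(lborel :: real measure)) = sqrt pi"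
proof -
  have "has_bochner_integral lborel (\<lambda>x::real. exp (- x\<^sup>2)) (sqrt pi)"
    using has_bochner_integral_even_function[OF gaussian_moment_0] by simp
  then show ?thesis by (rule has_bochner_integral_integral_eq)
qed

text \<open>For the Gaussian weight the raising operator is adjoint to differentiation: the weighted
  polynomial of degree \<open>Suc k\<close> is minus the derivative of the one of degree
  \<open>k\<close>. Together with \<open>pderiv_hermite\<close> this lowers both degrees at once,
  which is the induction behind \<open>hermite_inner\<close>.\<close>

lemma hermite_inner_pderiv:
  "(LBINT x. poly (hermite (Suc k)) x * poly q x * exp (- x\<^sup>2)) =
   (LBINT x. poly (hermite k) x * poly (pderiv q) x * exp (- x\<^sup>2))"
proof -
  let ?F = "\<lambda>x. poly (hermite k * q) x * exp (- x\<^sup>2)"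
  let ?F1 = "\<lambda>x. poly (hermite k * pderiv q) x * exp (- x\<^sup>2)"
  let ?F2 = "\<lambda>x. poly (hermite (Suc k) * q) x * exp (- x\<^sup>2)"
  have r: "rapid (\<lambda>x::real. poly p x * exp (- x\<^sup>2))" for p
    using rapid_poly_mult[OF rapid_gauss[of 1]] by simp
  have i: "integrable lborel (\<lambda>x::real. poly p x * exp (- x\<^sup>2))" for p
    by (intro rapid_integrable r borel_measurable_continuous_onI continuous_intros)
  have "(LBINT x. ?F1 x - ?F2 x) = 0"
  proof (rule integral_derivative_rapid)
    show "(?F has_vector_derivative ?F1 x - ?F2 x) (at x)" for x
      unfolding has_real_derivative_iff_has_vector_derivative[symmetric]
      by (auto intro!: derivative_eq_intros simp: algebra_simps)
    show "continuous_on UNIV (\<lambda>x. ?F1 x - ?F2 x)" by (intro continuous_intros)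
  qed (intro r rapid_diff)+
  then have "(LBINT x. ?F1 x) = (LBINT x. ?F2 x)"
    by (subst (asm) Bochner_Integration.integral_diff[OF i i]) simp
  then show ?thesis by (simp only: poly_mult)
qed

lemma hermite_inner:
  "(LBINT x. poly (hermite k) x * poly (hermite j) x * exp (- x\<^sup>2)) =
    (if k = j then hermite_norm2 k else 0)"
proof (induction k arbitrary: j)
  case 0
  have "(LBINT x. poly (hermite (Suc i)) x * poly 1 x * exp (- x\<^sup>2)) = 0" for i
    unfolding hermite_inner_pderiv by simp
  then show ?case by (cases j) (auto simp: integral_gauss hermite_norm2_0 simp del: hermite.simps(2))
next
  case (Suc k)
  show ?case
  proof (cases j)
    case 0
    show ?thesis unfolding hermite_inner_pderiv 0 by simp
  next
    case (Suc i)
    have "(LBINT x. poly (hermite (Suc k)) x * poly (hermite (Suc i)) x * exp (- x\<^sup>2)) =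
       (LBINT x. (2 * real (Suc i)) * (poly (hermite k) x * poly (hermite i) x * exp (- x\<^sup>2)))"
      unfolding hermite_inner_pderiv pderiv_hermite by (intro Bochner_Integration.integral_cong) auto
    also have "\<dots> = 2 * real (Suc i) * (if k = i then hermite_norm2 k else 0)"
      by (simp only: integral_mult_right_zero Suc.IH)
    finally show ?thesis using Suc by (auto simp: hermite_norm2_Suc simp del: hermite.simps)
  qed
qed

section \<open>Normalized Hermite functions and their ladder relations\<close>

lemma hermite_fun_altdef:
  "hermite_fun k x = poly (hermite k) x * exp (- x\<^sup>2 / 2) / sqrt (hermite_norm2 k)"
proof -
  have e: "(exp (- y\<^sup>2 / 2))\<^sup>2 = exp (- y\<^sup>2)" for y :: real
    by (simp add: exp_double[symmetric])
  have "(LBINT y. (poly (hermite k) y * exp (- y\<^sup>2 / 2))\<^sup>2) = hermite_norm2 k"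
    using hermite_inner[of k k] by (simp only: power_mult_distrib e power2_eq_square[of "poly _ _"] if_True simp_thms)
  then show ?thesis unfolding hermite_fun_def by simp
qed

lemma hermite_fun_rapid: "rapid (hermite_fun k)"
proof -
  have "rapid (\<lambda>x::real. exp (- x\<^sup>2 / 2))"
    using rapid_gauss[of "1 / 2"] by simp
  then have "rapid (\<lambda>x. poly (hermite k) x * exp (- x\<^sup>2 / 2) * inverse (sqrt (hermite_norm2 k)))"
    by (intro rapid_cmult2 rapid_poly_mult)
  also have "(\<lambda>x. poly (hermite k) x * exp (- x\<^sup>2 / 2) * inverse (sqrt (hermite_norm2 k))) = hermite_fun k"
    unfolding fun_eq_iff hermite_fun_altdef divide_inverse[of "_ * _" "sqrt _"] by (rule allI refl)+
  finally show ?thesis .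
qed

lemma continuous_on_hermite_fun [continuous_intros]:
  "continuous_on A f \<Longrightarrow> continuous_on A (\<lambda>x. hermite_fun k (f x))"
  unfolding hermite_fun_altdef using hermite_norm2_pos[of k] by (intro continuous_intros) auto

lemma borel_measurable_hermite_fun [measurable]: "hermite_fun k \<in> borel_measurable borel"
  by (intro borel_measurable_continuous_onI continuous_intros)

lemma hermite_fun_integrable: "integrable lborel (\<lambda>x. hermite_fun k x * hermite_fun j x)"
  by (intro rapid_integrable rapid_mult hermite_fun_rapid) simp

lemma hermite_fun_orthonormal:
  "(LBINT x. hermite_fun k x * hermite_fun j x) = (if k = j then 1 else 0)"
proof -
  have e: "exp (- x\<^sup>2 / 2) * exp (- x\<^sup>2 / 2) = exp (- x\<^sup>2)" for x :: real
    by (simp add: exp_add[symmetric])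
  have "hermite_fun k x * hermite_fun j x =
     poly (hermite k) x * poly (hermite j) x * exp (- x\<^sup>2) * inverse (sqrt (hermite_norm2 k) * sqrt (hermite_norm2 j))" for x
    unfolding hermite_fun_altdef e[symmetric] by (simp add: field_simps)
  then have "(LBINT x. hermite_fun k x * hermite_fun j x) =
     (if k = j then hermite_norm2 k else 0) * inverse (sqrt (hermite_norm2 k) * sqrt (hermite_norm2 j))"
    by (simp only: integral_mult_left_zero hermite_inner)
  also have "\<dots> = (if k = j then 1 else 0)"
  proof -
    have "a * inverse (sqrt a * sqrt a) = 1" if "a > 0" for a :: real
      using that by (simp del: inverse_mult_distrib)
    then show ?thesis using hermite_norm2_pos[of j] by (simp del: inverse_mult_distrib)
  qed
  finally show ?thesis .
qed

lemma hermite_fun_Suc: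
  "sqrt 2 * sqrt (real (Suc k)) * hermite_fun (Suc k) x =
   poly (hermite (Suc k)) x * exp (- x\<^sup>2 / 2) / sqrt (hermite_norm2 k)"
proof -
  have "sqrt (hermite_norm2 (Suc k)) = sqrt 2 * sqrt (real (Suc k)) * sqrt (hermite_norm2 k)"
    unfolding hermite_norm2_Suc real_sqrt_mult ..
  moreover have "sqrt 2 * sqrt (real (Suc k)) \<noteq> 0" by simp
  ultimately show ?thesis unfolding hermite_fun_altdef by (simp del: hermite.simps)
qed

text \<open>At \<open>k = 0\<close> the truncated index \<open>k - 1\<close> is harmless, because
  its coefficient \<open>sqrt (real k)\<close> vanishes. All ladder relations below rely on this
  convention and need no separate case for 0.\<close>

lemma hermite_fun_pred:
  "sqrt 2 * sqrt (real k) * hermite_fun (k - 1) x =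
   poly (pderiv (hermite k)) x * exp (- x\<^sup>2 / 2) / sqrt (hermite_norm2 k)"
proof (cases k)
  case (Suc i)
  have s: "sqrt (hermite_norm2 (Suc i)) = sqrt 2 * sqrt (real (Suc i)) * sqrt (hermite_norm2 i)"
    unfolding hermite_norm2_Suc real_sqrt_mult ..
  have t: "sqrt 2 * sqrt (real (Suc i)) * (sqrt 2 * sqrt (real (Suc i))) = 2 * real (Suc i)"
    by (simp add: real_sqrt_mult[symmetric])
  have nz: "sqrt 2 * sqrt (real (Suc i)) \<noteq> 0" "sqrt (hermite_norm2 i) \<noteq> 0"
    using hermite_norm2_pos[of i] by simp_all
  have q: "p * (A / B) = q * A / (p * B)" if "p * p = q" "p \<noteq> 0" for p q A B :: real
    using that by auto
  have "sqrt 2 * sqrt (real (Suc i)) * (A / B) = 2 * real (Suc i) * A / (sqrt 2 * sqrt (real (Suc i)) * B)" for A B :: real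
    by (rule q[OF t nz(1)])
  then show ?thesis
    unfolding Suc pderiv_hermite s by (simp add: hermite_fun_altdef mult.assoc)
qed simp

lemma x_hermite_fun:
  "sqrt 2 * x * hermite_fun k x =
    sqrt (real k) * hermite_fun (k - 1) x + sqrt (real (Suc k)) * hermite_fun (Suc k) x"
proof -
  have "sqrt 2 * (sqrt 2 * x * hermite_fun k x) = 2 * x * hermite_fun k x" by simp
  also have "\<dots> =
     sqrt 2 * sqrt (real k) * hermite_fun (k - 1) x + sqrt 2 * sqrt (real (Suc k)) * hermite_fun (Suc k) x"
    unfolding hermite_fun_pred hermite_fun_Suc unfolding hermite_fun_altdef
    by (simp add: algebra_simps diff_divide_distrib)
  finally have "sqrt 2 * (sqrt 2 * x * hermite_fun k x) = sqrt 2 *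
    (sqrt (real k) * hermite_fun (k - 1) x + sqrt (real (Suc k)) * hermite_fun (Suc k) x)"
    by (simp only: distrib_left mult.assoc)
  then show ?thesis by simp
qed

text \<open>The derivative in lowering form; \<open>hermite_fun'_altdef\<close> is the raising form.
  Choosing the right form for each factor of a product makes the terms with \<open>x\<close>
  cancel.\<close>

definition hermite_fun' :: "nat \<Rightarrow> real \<Rightarrow> real" where
  "hermite_fun' k x = sqrt 2 * sqrt (real k) * hermite_fun (k - 1) x - x * hermite_fun k x"

lemma has_real_derivative_hermite_fun:
  "(hermite_fun k has_real_derivative hermite_fun' k x) (at x)"
proof -
  have "((\<lambda>x. poly (hermite k) x * exp (- x\<^sup>2 / 2)) has_real_derivative
     poly (pderiv (hermite k)) x * exp (- x\<^sup>2 / 2) - x * (poly (hermite k) x * exp (- x\<^sup>2 / 2))) (at x)"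
    by (auto intro!: derivative_eq_intros simp: algebra_simps)
  from DERIV_cdivide[OF this, of "sqrt (hermite_norm2 k)"]
  have "((\<lambda>x. poly (hermite k) x * exp (- x\<^sup>2 / 2) / sqrt (hermite_norm2 k)) has_real_derivative
     poly (pderiv (hermite k)) x * exp (- x\<^sup>2 / 2) / sqrt (hermite_norm2 k)
     - x * (poly (hermite k) x * exp (- x\<^sup>2 / 2) / sqrt (hermite_norm2 k))) (at x)"
    by (simp only: diff_divide_distrib times_divide_eq_right)
  then show ?thesis unfolding hermite_fun'_def hermite_fun_pred unfolding hermite_fun_altdef[abs_def] .
qed

lemma hermite_fun'_altdef:
  "hermite_fun' k x = x * hermite_fun k x - sqrt 2 * sqrt (real (Suc k)) * hermite_fun (Suc k) x"
proof -
  have "2 * x * hermite_fun k x = sqrt 2 * (sqrt 2 * x * hermite_fun k x)" by simp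
  also have "\<dots> = sqrt 2 * sqrt (real k) * hermite_fun (k - 1) x + sqrt 2 * sqrt (real (Suc k)) * hermite_fun (Suc k) x"
    unfolding x_hermite_fun by (simp add: algebra_simps)
  finally show ?thesis unfolding hermite_fun'_def by simp
qed

lemma hermite_fun'_ladder:
  "sqrt 2 * hermite_fun' k x = sqrt (real k) * hermite_fun (k - 1) x - sqrt (real (Suc k)) * hermite_fun (Suc k) x"
proof -
  have "sqrt 2 * hermite_fun' k x = 2 * sqrt (real k) * hermite_fun (k - 1) x - sqrt 2 * x * hermite_fun k x"
    unfolding hermite_fun'_def by (simp add: algebra_simps)
  then show ?thesis unfolding x_hermite_fun by simp
qed

lemma hermite_fun_minus: "hermite_fun k (- x) = (- 1) ^ k * hermite_fun k x"
proof -
  have "poly (hermite k) (- x) = (- 1) ^ k * poly (hermite k) x \<and>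
        poly (hermite (Suc k)) (- x) = (- 1) ^ Suc k * poly (hermite (Suc k)) x"
  proof (induction k)
    case (Suc k)
    have rec: "poly (hermite (Suc (Suc k))) y = 2 * y * poly (hermite (Suc k)) y - 2 * real (Suc k) * poly (hermite k) y" for y
      using hermite.simps(2)[of "Suc k"] pderiv_hermite[of k] by (simp del: hermite.simps)
    show ?case
      unfolding rec using Suc by (simp del: hermite.simps add: algebra_simps)
  qed (simp add: pderiv_1)
  then show ?thesis unfolding hermite_fun_altdef by simp
qed

text \<open>The derivative of the sum telescopes to a single product of neighbouring Hermite
  functions. Integrating it from \<open>y\<close> to infinity and using
  \<open>2 * a * b \<le> a^2 + b^2\<close> with the normalization gives a bound that is uniform in
  \<open>y\<close> and grows only like \<open>sqrt n\<close>.\<close>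

lemma sum_hermite_fun_square_le: "(\<Sum>k<n. (hermite_fun k y)\<^sup>2) \<le> sqrt (2 * real n)"
proof (cases n)
  case (Suc m)
  let ?F = "\<lambda>x. \<Sum>k<n. (hermite_fun k (x + y))\<^sup>2"
  \<comment> \<open>By \<open>hermite_fun'_ladder\<close> the raising term of index \<open>k\<close>
    cancels against the lowering term of index \<open>Suc k\<close>, so only the top term is
    left.\<close>
  have tel: "(\<Sum>k<n. 2 * hermite_fun k x * hermite_fun' k x) = - (sqrt 2 * sqrt (real n) * hermite_fun (n - 1) x * hermite_fun n x)" for n x
  proof (induction n)
    case (Suc n)
    have "2 * hermite_fun n x * hermite_fun' n x = sqrt 2 * hermite_fun n x * (sqrt 2 * hermite_fun' n x)" by simp
    then show ?case unfolding sum.lessThan_Suc Suc.IH hermite_fun'_ladder by (simp add: algebra_simps)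
  qed simp
  let ?G = "\<lambda>x. - (sqrt 2 * sqrt (real n) * hermite_fun (n - 1) (x + y) * hermite_fun n (x + y))"
  have rs: "rapid (\<lambda>x. hermite_fun k (x + y))" for k
    using rapid_shift[OF hermite_fun_rapid, of k "- y"] by simp
  have "(LBINT x. indicator {0<..} x *\<^sub>R ?G x) = - ?F 0"
  proof (rule integral_derivative_rapid_half)
    show "(?F has_vector_derivative ?G x) (at x)" for x
      unfolding tel[symmetric] has_real_derivative_iff_has_vector_derivative[symmetric]
      by (auto intro!: derivative_eq_intros has_real_derivative_hermite_fun[THEN DERIV_chain2] sum.cong)
    show "continuous_on UNIV ?G" by (intro continuous_intros)
    show "rapid ?F" unfolding power2_eq_square by (intro rapid_sum rapid_mult rs)
    show "rapid ?G" using rapid_uminus[OF rapid_cmult[OF rapid_mult[OF rs[of "n-1"] rs[of n]], of "sqrt 2 * sqrt (real n)"]]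
      by (simp add: mult.assoc)
  qed
  then have "(\<Sum>k<n. (hermite_fun k y)\<^sup>2) = (LBINT x. indicator {0<..} x *\<^sub>R (- ?G x))"
    by (simp del: scaleR_minus_right add: scaleR_minus_right[symmetric])
  \<comment> \<open>The majorant is nonnegative, so the half line may be enlarged to the whole line,
    where both squares have integral 1.\<close>
  also have "\<dots> \<le> (LBINT x. sqrt (2 * real n) * (((hermite_fun (n - 1) (x + y))\<^sup>2 + (hermite_fun n (x + y))\<^sup>2) / 2))"
  proof (rule integral_mono')
    show "integrable lborel (\<lambda>x. sqrt (2 * real n) * (((hermite_fun (n - 1) (x + y))\<^sup>2 + (hermite_fun n (x + y))\<^sup>2) / 2))"
      unfolding power2_eq_square
      by (intro integrable_mult_right integrable_divide Bochner_Integration.integrable_add rapid_integrable rapid_mult rs) simp_all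
    fix x
    have "hermite_fun (n - 1) (x + y) * hermite_fun n (x + y) \<le> ((hermite_fun (n - 1) (x + y))\<^sup>2 + (hermite_fun n (x + y))\<^sup>2) / 2"
      using sum_squares_bound[of "hermite_fun (n - 1) (x + y)" "hermite_fun n (x + y)"] by simp
    from mult_left_mono[OF this, of "sqrt (2 * real n)"]
    show "indicator {0<..} x *\<^sub>R (- ?G x) \<le> sqrt (2 * real n) * (((hermite_fun (n - 1) (x + y))\<^sup>2 + (hermite_fun n (x + y))\<^sup>2) / 2)"
      by (auto simp: indicator_def real_sqrt_mult mult.assoc)
  qed auto
  also have "\<dots> = sqrt (2 * real n)"
  proof -
    have sh: "(LBINT x. (hermite_fun k (x + y))\<^sup>2) = 1" for k
      using lborel_integral_real_affine[of 1 "\<lambda>x. (hermite_fun k x)\<^sup>2" y] hermite_fun_orthonormal[of k k]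
      by (simp add: power2_eq_square add.commute)
    have "integrable lborel (\<lambda>x. (hermite_fun k (x + y))\<^sup>2)" for k
      unfolding power2_eq_square by (intro rapid_integrable rapid_mult rs) simp
    then show ?thesis by (simp add: sh)
  qed
  finally show ?thesis .
qed simp

subsection \<open>Square-integrable functions\<close>

lemma borel_measurable_cnj [measurable (raw)]:
  "f \<in> borel_measurable M \<Longrightarrow> (\<lambda>x. cnj (f x)) \<in> borel_measurable M"
  by (rule borel_measurable_continuous_on[where f = cnj]) (auto intro: continuous_intros)

lemma cnj_integral: "cnj (\<integral>x. f x \<partial>M) = (\<integral>x. cnj (f x) \<partial>M)"
  by simp

lemma L2_product:
  fixes f g :: "'a \<Rightarrow> complex"
  assumes [measurable]: "f \<in> borel_measurable M" "g \<in> borel_measurable M"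
    and f: "integrable M (\<lambda>x. (cmod (f x))\<^sup>2)" and g: "integrable M (\<lambda>x. (cmod (g x))\<^sup>2)"
  shows "integrable M (\<lambda>x. f x * g x)" (is ?I)
    and "cmod (\<integral>x. f x * g x \<partial>M) \<le> sqrt (\<integral>x. (cmod (f x))\<^sup>2 \<partial>M) * sqrt (\<integral>x. (cmod (g x))\<^sup>2 \<partial>M)" (is ?B)
proof -
  have "integrable M (\<lambda>x. (cmod (f x))\<^sup>2 + (cmod (g x))\<^sup>2)" using f g by simp
  then show i: ?I
  proof (rule Bochner_Integration.integrable_bound)
    show "AE x in M. norm (f x * g x) \<le> norm ((cmod (f x))\<^sup>2 + (cmod (g x))\<^sup>2)"
    proof (intro AE_I2)
      fix x
      have "2 * (cmod (f x) * cmod (g x)) \<le> (cmod (f x))\<^sup>2 + (cmod (g x))\<^sup>2"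
        using sum_squares_bound[of "cmod (f x)" "cmod (g x)"] by simp
      moreover have "0 \<le> cmod (f x) * cmod (g x)" by simp
      ultimately have "cmod (f x) * cmod (g x) \<le> (cmod (f x))\<^sup>2 + (cmod (g x))\<^sup>2" by linarith
      then show "norm (f x * g x) \<le> norm ((cmod (f x))\<^sup>2 + (cmod (g x))\<^sup>2)"
        unfolding norm_mult by simp
    qed
  qed simp
  let ?A = "\<integral>x. (cmod (f x))\<^sup>2 \<partial>M" and ?D = "\<integral>x. (cmod (g x))\<^sup>2 \<partial>M"
  let ?N = "\<integral>x. cmod (f x) * cmod (g x) \<partial>M"
  have n: "integrable M (\<lambda>x. cmod (f x) * cmod (g x))" using integrable_norm[OF i] by (simp add: norm_mult)
  have "(ennreal ?N)\<^sup>2 = (\<integral>\<^sup>+x. ennreal (cmod (f x)) * ennreal (cmod (g x)) \<partial>M)\<^sup>2"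
    using n by (subst nn_integral_eq_integral[symmetric]) (auto simp: ennreal_mult')
  also have "\<dots> \<le> (\<integral>\<^sup>+x. (ennreal (cmod (f x)))\<^sup>2 \<partial>M) * (\<integral>\<^sup>+x. (ennreal (cmod (g x)))\<^sup>2 \<partial>M)"
    by (rule Cauchy_Schwarz_nn_integral) auto
  also have "\<dots> = ennreal ?A * ennreal ?D"
    using f g by (subst (1 2) nn_integral_eq_integral[symmetric]) (auto simp: ennreal_power)
  finally have "ennreal (?N\<^sup>2) \<le> ennreal (?A * ?D)"
    by (simp add: ennreal_power ennreal_mult'[symmetric])
  then have "?N\<^sup>2 \<le> ?A * ?D" by (subst (asm) ennreal_le_iff) auto
  then have "?N \<le> sqrt (?A * ?D)" by (rule real_le_rsqrt)
  moreover have "cmod (\<integral>x. f x * g x \<partial>M) \<le> ?N"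
    using integral_norm_bound[of M "\<lambda>x. f x * g x"] by (simp add: norm_mult)
  ultimately show ?B by (simp add: real_sqrt_mult)
qed

lemma L2_diff:
  fixes f g :: "'a \<Rightarrow> complex"
  assumes [measurable]: "f \<in> borel_measurable M" "g \<in> borel_measurable M"
    and f: "integrable M (\<lambda>x. (cmod (f x))\<^sup>2)" and g: "integrable M (\<lambda>x. (cmod (g x))\<^sup>2)"
  shows "integrable M (\<lambda>x. (cmod (f x - g x))\<^sup>2)"
proof (rule Bochner_Integration.integrable_bound)
  show "integrable M (\<lambda>x. 2 * (cmod (f x))\<^sup>2 + 2 * (cmod (g x))\<^sup>2)" using f g by simp
  have "(cmod (f x - g x))\<^sup>2 \<le> 2 * (cmod (f x))\<^sup>2 + 2 * (cmod (g x))\<^sup>2" for x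
  proof -
    have "(cmod (f x - g x))\<^sup>2 \<le> (cmod (f x) + cmod (g x))\<^sup>2" by (intro power_mono norm_triangle_ineq4) simp
    also have "\<dots> \<le> 2 * (cmod (f x))\<^sup>2 + 2 * (cmod (g x))\<^sup>2"
      using sum_squares_bound[of "cmod (f x)" "cmod (g x)"] by (simp add: power2_sum)
    finally show ?thesis .
  qed
  then show "AE x in M. norm ((cmod (f x - g x))\<^sup>2) \<le> norm (2 * (cmod (f x))\<^sup>2 + 2 * (cmod (g x))\<^sup>2)" by simp
qed simp

lemma L2_lincomb:
  assumes "f \<in> L2 M" "g \<in> L2 M" shows "(\<lambda>x. a * f x + b * g x) \<in> L2 M"
proof -
  have [measurable]: "f \<in> borel_measurable M" "g \<in> borel_measurable M" using assms by (auto simp: L2_def)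
  have "integrable M (\<lambda>x. (cmod (a * f x - (- b * g x)))\<^sup>2)"
    using assms by (intro L2_diff) (auto simp: L2_def norm_mult power_mult_distrib)
  then show ?thesis by (simp add: L2_def)
qed

lemma L2_cnj: "f \<in> L2 M \<Longrightarrow> (\<lambda>x. cnj (f x)) \<in> L2 M"
  by (auto simp: L2_def)

lemma L2_mult_integrable: "f \<in> L2 M \<Longrightarrow> g \<in> L2 M \<Longrightarrow> integrable M (\<lambda>x. f x * g x)"
  by (rule L2_product) (auto simp: L2_def)

lemma L2_inner_lincomb:
  assumes "h \<in> L2 M" "f \<in> L2 M" "g \<in> L2 M"
  shows "L2_inner M h (\<lambda>x. a * f x + b * g x) = a * L2_inner M h f + b * L2_inner M h g"
proof -
  note i = L2_mult_integrable[OF L2_cnj[OF assms(1)] assms(2)] L2_mult_integrable[OF L2_cnj[OF assms(1)] assms(3)]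
  have "(\<integral>x. cnj (h x) * (a * f x + b * g x) \<partial>M) = (\<integral>x. a * (cnj (h x) * f x) + b * (cnj (h x) * g x) \<partial>M)"
    by (simp only: distrib_left mult_ac)
  also have "\<dots> = a * (\<integral>x. cnj (h x) * f x \<partial>M) + b * (\<integral>x. cnj (h x) * g x \<partial>M)"
    by (simp only: Bochner_Integration.integral_add[OF integrable_mult_right[OF i(1)] integrable_mult_right[OF i(2)]] integral_mult_right_zero)
  finally show ?thesis by (simp only: L2_inner_def)
qed

lemma L2_inner_bound:
  assumes "h \<in> L2 M" "f \<in> L2 M" shows "cmod (L2_inner M h f) \<le> L2_norm M h * L2_norm M f"
  using L2_product(2)[of "\<lambda>x. cnj (h x)" M f] L2_cnj[OF assms(1)] assms
  by (simp add: L2_def L2_inner_def L2_norm_def)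

lemma L2_inner_cong_AE:
  assumes "h \<in> L2 M" "f \<in> L2 M" "g \<in> L2 M" "AE x in M. f x = g x"
  shows "L2_inner M h f = L2_inner M h g"
  unfolding L2_inner_def
proof (rule integral_cong_AE)
  show "AE x in M. cnj (h x) * f x = cnj (h x) * g x" using assms(4) by eventually_elim simp
qed (use assms in \<open>auto simp: L2_def\<close>)

text \<open>Pythagoras with a remainder \<open>R\<close> that need not be orthogonal to the
  \<open>w i\<close>. It is used twice: with \<open>c = 1\<close> and the negative coefficients of
  \<open>R\<close> it gives Bessel's inequality, and with \<open>c = 1 / (2 * pi)\<close> and
  \<open>R\<close> the bias it splits the mean square error.\<close>

lemma L2_orthogonal_expansion:
  assumes fin: "finite I" and w: "\<And>i. i \<in> I \<Longrightarrow> w i \<in> L2 M" and R: "R \<in> L2 M"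
    and orth: "\<And>i j. i \<in> I \<Longrightarrow> j \<in> I \<Longrightarrow> (\<integral>z. w i z * cnj (w j z) \<partial>M) = (if i = j then of_real c else 0)"
  shows "(\<integral>z. (cmod ((\<Sum>i\<in>I. a i * w i z) + R z))\<^sup>2 \<partial>M) =
    c * (\<Sum>i\<in>I. (cmod (a i))\<^sup>2) + 2 * Re (\<Sum>i\<in>I. a i * (\<integral>z. w i z * cnj (R z) \<partial>M)) + (\<integral>z. (cmod (R z))\<^sup>2 \<partial>M)"
proof -
  have n2: "x * cnj x = of_real ((cmod x)\<^sup>2)" for x by (rule complex_norm_square[symmetric])
  have iww: "integrable M (\<lambda>z. w i z * cnj (w j z))" if "i \<in> I" "j \<in> I" for i j
    using that by (intro L2_mult_integrable L2_cnj w)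
  have iwR: "integrable M (\<lambda>z. w i z * cnj (R z))" if "i \<in> I" for i
    using that by (intro L2_mult_integrable L2_cnj w R)
  have iRw: "integrable M (\<lambda>z. R z * cnj (w i z))" if "i \<in> I" for i
    using that by (intro L2_mult_integrable L2_cnj w R)
  have iRR: "integrable M (\<lambda>z. R z * cnj (R z))" by (intro L2_mult_integrable L2_cnj R)
  let ?s = "\<lambda>z. (\<Sum>i\<in>I. a i * w i z) + R z"
  have "?s z * cnj (?s z) = (\<Sum>i\<in>I. \<Sum>j\<in>I. a i * cnj (a j) * (w i z * cnj (w j z)))
      + (\<Sum>i\<in>I. a i * (w i z * cnj (R z))) + (\<Sum>i\<in>I. cnj (a i) * (R z * cnj (w i z))) + R z * cnj (R z)" for z
    by (simp add: distrib_left distrib_right sum_product sum_distrib_left sum_distrib_right mult_ac)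
       (rule sum.swap)
  then have "(\<integral>z. ?s z * cnj (?s z) \<partial>M) = (\<Sum>i\<in>I. \<Sum>j\<in>I. a i * cnj (a j) * (\<integral>z. w i z * cnj (w j z) \<partial>M))
      + (\<Sum>i\<in>I. a i * (\<integral>z. w i z * cnj (R z) \<partial>M)) + (\<Sum>i\<in>I. cnj (a i) * (\<integral>z. R z * cnj (w i z) \<partial>M)) + (\<integral>z. R z * cnj (R z) \<partial>M)"
    by (simp add: iww iwR iRw iRR)
  also have "(\<Sum>i\<in>I. \<Sum>j\<in>I. a i * cnj (a j) * (\<integral>z. w i z * cnj (w j z) \<partial>M)) = (\<Sum>i\<in>I. of_real (c * (cmod (a i))\<^sup>2))"
  proof (intro sum.cong refl)
    fix i assume i: "i \<in> I"
    have "(\<Sum>j\<in>I. a i * cnj (a j) * (\<integral>z. w i z * cnj (w j z) \<partial>M)) = (\<Sum>j\<in>I. if i = j then a i * cnj (a j) * of_real c else 0)"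
      using i by (intro sum.cong) (auto simp: orth)
    also have "\<dots> = a i * cnj (a i) * of_real c" using i fin by simp
    finally show "(\<Sum>j\<in>I. a i * cnj (a j) * (\<integral>z. w i z * cnj (w j z) \<partial>M)) = of_real (c * (cmod (a i))\<^sup>2)"
      unfolding n2 by simp
  qed
  also have "(\<Sum>i\<in>I. cnj (a i) * (\<integral>z. R z * cnj (w i z) \<partial>M)) = cnj (\<Sum>i\<in>I. a i * (\<integral>z. w i z * cnj (R z) \<partial>M))"
    by (simp add: cnj_integral mult.commute)
  finally have "complex_of_real (\<integral>z. (cmod (?s z))\<^sup>2 \<partial>M) = of_real (c * (\<Sum>i\<in>I. (cmod (a i))\<^sup>2)) +
     ((\<Sum>i\<in>I. a i * (\<integral>z. w i z * cnj (R z) \<partial>M)) + cnj (\<Sum>i\<in>I. a i * (\<integral>z. w i z * cnj (R z) \<partial>M)))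
     + of_real (\<integral>z. (cmod (R z))\<^sup>2 \<partial>M)"
    unfolding n2 integral_complex_of_real by (simp add: sum_distrib_left)
  then show ?thesis
    unfolding complex_add_cnj of_real_add[symmetric] of_real_eq_iff .
qed

lemma rapid_L2:
  fixes f :: "real \<Rightarrow> complex"
  assumes "rapid f" "f \<in> borel_measurable borel" shows "f \<in> L2 lborel"
proof -
  have [measurable]: "f \<in> borel_measurable borel" by fact
  have "rapid (\<lambda>x. (cmod (f x))\<^sup>2)"
    unfolding power2_eq_square by (intro rapid_mult rapid_dominated[OF assms(1)]) auto
  then have "integrable lborel (\<lambda>x. (cmod (f x))\<^sup>2)" by (rule rapid_integrable) simp
  then show ?thesis by (simp add: L2_def)
qed

lemma hermite_vec_L2: "hermite_vec k \<in> L2 lborel"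
  by (intro rapid_L2 rapid_of_real hermite_fun_rapid) simp

text \<open>The squared norm of \<open>q\<close> minus its projection is nonnegative. The pairing
  carries no conjugate because the Hermite functions are real.\<close>

lemma hermite_bessel:
  assumes q: "q \<in> L2 lborel"
  shows "(\<Sum>j<n. (cmod (LBINT y. of_real (hermite_fun j y) * q y))\<^sup>2) \<le> (LBINT y. (cmod (q y))\<^sup>2)"
proof -
  define c where "c = (\<lambda>j. LBINT y. hermite_vec j y * q y)"
  have orth: "(LBINT y. hermite_vec i y * cnj (hermite_vec j y)) = (if i = j then of_real 1 else 0)" for i j
  proof -
    have "(LBINT y. hermite_vec i y * cnj (hermite_vec j y)) = of_real (LBINT y. hermite_fun i y * hermite_fun j y)"
      unfolding integral_complex_of_real[symmetric] by simp
    then show ?thesis unfolding hermite_fun_orthonormal by simp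
  qed
  have "(LBINT y. hermite_vec j y * cnj (q y)) = cnj (c j)" for j
    unfolding c_def cnj_integral by simp
  then have eq: "(LBINT y. (cmod ((\<Sum>j<n. - c j * hermite_vec j y) + q y))\<^sup>2) =
      1 * (\<Sum>j<n. (cmod (- c j))\<^sup>2) + 2 * Re (\<Sum>j<n. - c j * cnj (c j)) + (LBINT y. (cmod (q y))\<^sup>2)"
    using L2_orthogonal_expansion[OF _ hermite_vec_L2 q orth, of "{..<n}" "\<lambda>j. - c j"] by simp
  have "0 \<le> 1 * (\<Sum>j<n. (cmod (- c j))\<^sup>2) + 2 * Re (\<Sum>j<n. - c j * cnj (c j)) + (LBINT y. (cmod (q y))\<^sup>2)"
    unfolding eq[symmetric] by (rule integral_nonneg_AE) simp
  moreover have "Re (- c j * cnj (c j)) = - (cmod (c j))\<^sup>2" for j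
    unfolding cmod_power2 by (simp add: power2_eq_square)
  ultimately have "(\<Sum>j<n. (cmod (c j))\<^sup>2) \<le> (LBINT y. (cmod (q y))\<^sup>2)"
    by (simp only: Re_sum sum_negf norm_minus_cancel)
  then show ?thesis unfolding c_def .
qed

subsection \<open>Matrix elements of the Weyl operators\<close>

lemma rapid_gauss_norm: "rapid (\<lambda>z::'a::real_normed_vector. exp (- (a * (norm z)\<^sup>2)))" if pos: "a > 0"
  unfolding rapid_def
proof
  fix c :: real
  obtain C where "\<And>x::real. norm (exp (- (a * x\<^sup>2))) * exp (c * norm x) \<le> C"
    using rapid_gauss[OF pos] unfolding rapid_def by blast
  from this[of "norm (_::'a)"]
  show "\<exists>C. \<forall>z::'a. norm (exp (- (a * (norm z)\<^sup>2))) * exp (c * norm z) \<le> C" by auto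
qed

lemma fourier_gauss:
  assumes "a > 0"
  shows "(LBINT x. exp (- \<i> * of_real (u * x)) * of_real (exp (- (a * x\<^sup>2)))) =
    complex_of_real (sqrt (pi / a) * exp (- u\<^sup>2 / (4 * a)))"
proof -
  \<comment> \<open>The substitution \<open>x \<mapsto> c * x\<close> turns \<open>a * x^2\<close>
    into \<open>x^2 / 2\<close>, so the integral becomes the characteristic function of the standard
    normal distribution.\<close>
  define c where "c = 1 / sqrt (2 * a)"
  have c: "c > 0" "c\<^sup>2 = 1 / (2 * a)" using assms by (auto simp: c_def power_divide)
  have "complex_of_real (exp (- (u * c)\<^sup>2 / 2)) = char std_normal_distribution (- u * c)"
    by (simp add: char_std_normal_distribution)
  also have "\<dots> = (LBINT x. std_normal_density x *\<^sub>R iexp (- u * c * x))"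
    unfolding char_def by (rule integral_density) auto
  finally have ch: "(LBINT x. std_normal_density x *\<^sub>R iexp (- u * c * x)) =
     complex_of_real (exp (- (u * c)\<^sup>2 / 2))" ..
  have pt: "exp (- \<i> * of_real (u * (c * x))) * of_real (exp (- (a * (c * x)\<^sup>2))) =
      complex_of_real (sqrt (2 * pi)) * (std_normal_density x *\<^sub>R iexp (- u * c * x))" for x
  proof -
    have "a * (c * x)\<^sup>2 = x\<^sup>2 / 2" using assms by (simp add: power_mult_distrib c(2))
    then show ?thesis by (simp add: std_normal_density_def scaleR_conv_of_real mult_ac)
  qed
  have "(LBINT x. exp (- \<i> * of_real (u * x)) * of_real (exp (- (a * x\<^sup>2)))) =
     \<bar>c\<bar> *\<^sub>R (LBINT x. exp (- \<i> * of_real (u * (0 + c * x))) * complex_of_real (exp (- (a * (0 + c * x)\<^sup>2))))"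
    by (rule lborel_integral_real_affine) (use c in auto)
  also have "\<dots> = of_real (c * sqrt (2 * pi) * exp (- (u * c)\<^sup>2 / 2))"
    unfolding add_0 pt integral_mult_right_zero ch using c by (simp add: scaleR_conv_of_real)
  also have "c * sqrt (2 * pi) = sqrt (pi / a)"
    by (simp add: c_def real_sqrt_divide real_sqrt_mult)
  also have "- (u * c)\<^sup>2 / 2 = - u\<^sup>2 / (4 * a)" by (simp add: power_mult_distrib c(2))
  finally show ?thesis .
qed

definition weyl_integrand :: "nat \<Rightarrow> nat \<Rightarrow> real \<Rightarrow> real \<Rightarrow> real \<Rightarrow> complex" where
  "weyl_integrand k j u v x = of_real (hermite_fun j x) *
     (exp (- \<i> * of_real (u * x) + \<i> * of_real (u * v) / 2) * of_real (hermite_fun k (x - v)))"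

text \<open>The first index is the argument of the operator and the second the test vector, the
  reverse of the usual order. In this order the element with indices \<open>k j\<close> is the trace
  of the Weyl operator against the matrix unit with the same indices.\<close>

definition weyl_matrix :: "nat \<Rightarrow> nat \<Rightarrow> real \<Rightarrow> real \<Rightarrow> complex" where
  "weyl_matrix k j u v = (LBINT x. weyl_integrand k j u v x)"

lemma L2_inner_weyl:
  "L2_inner lborel (hermite_vec j) (weyl u v (hermite_vec k)) = weyl_matrix k j u v"
  unfolding L2_inner_def weyl_matrix_def weyl_integrand_def weyl_hermite_vec[abs_def] by simp

lemma norm_weyl_integrand:
  "cmod (weyl_integrand k j u v x) = \<bar>hermite_fun j x\<bar> * \<bar>hermite_fun k (x - v)\<bar>"
  by (simp add: weyl_integrand_def norm_mult norm_exp_eq_Re)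

lemma rapid_weyl_integrand: "rapid (weyl_integrand k j u v)"
  by (rule rapid_dominated[OF rapid_mult[OF hermite_fun_rapid[of j] rapid_shift[OF hermite_fun_rapid[of k], of v]]])
     (simp add: norm_weyl_integrand abs_mult)

lemma continuous_on_weyl_integrand: "continuous_on A (weyl_integrand k j u v)"
  unfolding weyl_integrand_def by (intro continuous_intros)

lemma borel_measurable_weyl_integrand [measurable]: "weyl_integrand k j u v \<in> borel_measurable borel"
  by (intro borel_measurable_continuous_onI continuous_on_weyl_integrand)

lemma integrable_weyl_integrand: "integrable lborel (weyl_integrand k j u v)"
  by (intro rapid_integrable rapid_weyl_integrand) simp

text \<open>The complex coordinate of phase space in which Weyl operators become displacement
  operators. The matrix elements are polynomials in it and its conjugate times a Gaussian.\<close>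

definition weyl_arg :: "real \<Rightarrow> real \<Rightarrow> complex" where
  "weyl_arg u v = (of_real v - \<i> * of_real u) / of_real (sqrt 2)"

section \<open>Ladder relations of the matrix elements\<close>

lemma weyl_integrand_derivative:
  "(weyl_integrand k j u v has_vector_derivative
     of_real (hermite_fun' j x) *
     (exp (- \<i> * of_real (u * x) + \<i> * of_real (u * v) / 2) * of_real (hermite_fun k (x - v))) +
     of_real (hermite_fun j x) *
     (exp (- \<i> * of_real (u * x) + \<i> * of_real (u * v) / 2) *
       (of_real (hermite_fun' k (x - v)) - \<i> * of_real u * of_real (hermite_fun k (x - v))))) (at x)"
proof -
  have h: "((\<lambda>x. complex_of_real (hermite_fun j x)) has_vector_derivative of_real (hermite_fun' j x)) (at x)" for j x
    by (intro has_vector_derivative_of_real has_real_derivative_hermite_fun)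
  have hs: "((\<lambda>x. complex_of_real (hermite_fun k (x - v))) has_vector_derivative of_real (hermite_fun' k (x - v))) (at x)"
  proof (intro has_vector_derivative_of_real)
    show "((\<lambda>x. hermite_fun k (x - v)) has_real_derivative hermite_fun' k (x - v)) (at x)"
      by (rule DERIV_cong[OF DERIV_chain2[OF has_real_derivative_hermite_fun]])
         (auto intro!: derivative_eq_intros)
  qed
  have "((\<lambda>z. exp (- \<i> * of_real u * z + \<i> * of_real (u * v) / 2)) has_field_derivative
      exp (- \<i> * of_real u * of_real x + \<i> * of_real (u * v) / 2) * (- \<i> * of_real u)) (at (of_real x))"
    by (auto intro!: derivative_eq_intros)
  from field_vector_diff_chain_at[OF has_vector_derivative_of_real[OF DERIV_ident] this]
  have e: "((\<lambda>x. exp (- \<i> * of_real (u * x) + \<i> * of_real (u * v) / 2)) has_vector_derivative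
      exp (- \<i> * of_real (u * x) + \<i> * of_real (u * v) / 2) * (- \<i> * of_real u)) (at x)"
    by (simp add: o_def mult.assoc)
  show ?thesis
    unfolding weyl_integrand_def[abs_def]
    by (rule has_vector_derivative_eq_rhs[OF has_vector_derivative_mult[OF h has_vector_derivative_mult[OF e hs]]])
       (simp add: algebra_simps)
qed

text \<open>Integrate the derivative of the integrand, with the raising form for index
  \<open>j\<close> at \<open>x\<close> and the lowering form for index \<open>k\<close> at
  \<open>x - v\<close>. The terms \<open>x\<close> and \<open>-(x - v)\<close> leave the constant
  \<open>v\<close>, the phase contributes \<open>- \<i> * u\<close>, and together they are
  \<open>sqrt 2 * weyl_arg u v\<close>. This is the commutation rule of a Weyl operator with the
  creation operator.\<close>

lemma weyl_matrix_raise: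
  "of_real (sqrt (real (Suc j))) * weyl_matrix k (Suc j) u v =
    weyl_arg u v * weyl_matrix k j u v + of_real (sqrt (real k)) * weyl_matrix (k - 1) j u v"
proof -
  let ?s = "complex_of_real (sqrt 2)"
  let ?D = "\<lambda>x. (of_real v - \<i> * of_real u) * weyl_integrand k j u v x
     - ?s * of_real (sqrt (real (Suc j))) * weyl_integrand k (Suc j) u v x
     + ?s * of_real (sqrt (real k)) * weyl_integrand (k - 1) j u v x"
  have "(LBINT x. ?D x) = 0"
  proof (rule integral_derivative_rapid)
    show "(weyl_integrand k j u v has_vector_derivative ?D x) (at x)" for x
      by (rule has_vector_derivative_eq_rhs[OF weyl_integrand_derivative])
         (simp add: hermite_fun'_altdef[of j] hermite_fun'_def[of k] weyl_integrand_def algebra_simps)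
  qed (intro continuous_intros continuous_on_weyl_integrand rapid_diff rapid_add rapid_cmult rapid_weyl_integrand)+
  then have "(of_real v - \<i> * of_real u) * weyl_matrix k j u v
     - ?s * of_real (sqrt (real (Suc j))) * weyl_matrix k (Suc j) u v
     + ?s * of_real (sqrt (real k)) * weyl_matrix (k - 1) j u v = 0"
    by (simp add: weyl_matrix_def integrable_weyl_integrand)
  moreover have "of_real v - \<i> * of_real u = ?s * weyl_arg u v"
    by (simp add: weyl_arg_def)
  ultimately have "?s * (weyl_arg u v * weyl_matrix k j u v + of_real (sqrt (real k)) * weyl_matrix (k - 1) j u v) =
     ?s * (of_real (sqrt (real (Suc j))) * weyl_matrix k (Suc j) u v)"
    by (simp add: algebra_simps)
  then show ?thesis by simp
qed

text \<open>The same total derivative with the two forms exchanged: now \<open>j\<close> is lowered,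
  \<open>k\<close> is raised, and the constant becomes the negative conjugate.\<close>

lemma weyl_matrix_raise':
  "of_real (sqrt (real (Suc k))) * weyl_matrix (Suc k) j u v =
    of_real (sqrt (real j)) * weyl_matrix k (j - 1) u v - cnj (weyl_arg u v) * weyl_matrix k j u v"
proof -
  let ?s = "complex_of_real (sqrt 2)"
  let ?D = "\<lambda>x. - (of_real v + \<i> * of_real u) * weyl_integrand k j u v x
     + ?s * of_real (sqrt (real j)) * weyl_integrand k (j - 1) u v x
     - ?s * of_real (sqrt (real (Suc k))) * weyl_integrand (Suc k) j u v x"
  have "(LBINT x. ?D x) = 0"
  proof (rule integral_derivative_rapid)
    show "(weyl_integrand k j u v has_vector_derivative ?D x) (at x)" for x
      by (rule has_vector_derivative_eq_rhs[OF weyl_integrand_derivative])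
         (simp add: hermite_fun'_altdef[of k] hermite_fun'_def[of j] weyl_integrand_def algebra_simps)
  qed (intro continuous_intros continuous_on_weyl_integrand rapid_diff rapid_add rapid_cmult rapid_weyl_integrand)+
  then have "- (of_real v + \<i> * of_real u) * weyl_matrix k j u v
     + ?s * of_real (sqrt (real j)) * weyl_matrix k (j - 1) u v
     - ?s * of_real (sqrt (real (Suc k))) * weyl_matrix (Suc k) j u v = 0"
    by (simp add: weyl_matrix_def integrable_weyl_integrand)
  moreover have "of_real v + \<i> * of_real u = ?s * cnj (weyl_arg u v)"
    by (simp add: weyl_arg_def)
  ultimately have "?s * (of_real (sqrt (real j)) * weyl_matrix k (j - 1) u v - cnj (weyl_arg u v) * weyl_matrix k j u v) =
     ?s * (of_real (sqrt (real (Suc k))) * weyl_matrix (Suc k) j u v)"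
    by (simp add: algebra_simps)
  then show ?thesis by simp
qed

lemma weyl_matrix_0_0: "weyl_matrix 0 0 u v = of_real (exp (- ((u\<^sup>2 + v\<^sup>2) / 4)))"
proof -
  \<comment> \<open>Centring at \<open>v / 2\<close> makes the product of the two Gaussians even and
    cancels the phase \<open>u * v / 2\<close> of the Weyl operator.\<close>
  have pt: "weyl_integrand 0 0 u v (v / 2 + x) = of_real (exp (- v\<^sup>2 / 4) / sqrt pi) *
     (exp (- \<i> * of_real (u * x)) * of_real (exp (- (1 * x\<^sup>2))))" for x
  proof -
    have "hermite_fun 0 (v / 2 + x) * hermite_fun 0 (v / 2 + x - v) =
       exp (- (v / 2 + x)\<^sup>2 / 2) * exp (- (v / 2 + x - v)\<^sup>2 / 2) / sqrt pi"
      by (simp add: hermite_fun_altdef hermite_norm2_0 real_sqrt_mult_self)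
    also have "exp (- (v / 2 + x)\<^sup>2 / 2) * exp (- (v / 2 + x - v)\<^sup>2 / 2) = exp (- v\<^sup>2 / 4) * exp (- (1 * x\<^sup>2))"
      unfolding exp_add[symmetric] by (rule arg_cong[of _ _ exp]) (simp add: power2_eq_square field_simps)
    finally have r: "hermite_fun 0 (v / 2 + x) * hermite_fun 0 (v / 2 + x - v) =
       exp (- v\<^sup>2 / 4) * exp (- (1 * x\<^sup>2)) / sqrt pi" .
    have p: "- \<i> * complex_of_real (u * (v / 2 + x)) + \<i> * complex_of_real (u * v) / 2 = - \<i> * complex_of_real (u * x)"
      by (simp add: algebra_simps)
    have "weyl_integrand 0 0 u v (v / 2 + x) = exp (- \<i> * of_real (u * x)) *
      of_real (hermite_fun 0 (v / 2 + x) * hermite_fun 0 (v / 2 + x - v))"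
      unfolding weyl_integrand_def p by (simp only: of_real_mult mult_ac)
    then show ?thesis unfolding r by simp
  qed
  have "weyl_matrix 0 0 u v = (LBINT x. weyl_integrand 0 0 u v (v / 2 + x))"
    unfolding weyl_matrix_def using lborel_integral_real_affine[of 1 "weyl_integrand 0 0 u v" "v / 2"] by simp
  also have "\<dots> = of_real (exp (- v\<^sup>2 / 4) / sqrt pi) * of_real (sqrt (pi / 1) * exp (- u\<^sup>2 / (4 * 1)))"
    unfolding pt integral_mult_right_zero by (subst fourier_gauss) auto
  also have "\<dots> = of_real (exp (- v\<^sup>2 / 4) * exp (- u\<^sup>2 / 4))"
    by simp
  also have "exp (- v\<^sup>2 / 4) * exp (- u\<^sup>2 / 4) = exp (- ((u\<^sup>2 + v\<^sup>2) / 4))"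
    unfolding exp_add[symmetric] by (simp add: field_simps)
  finally show ?thesis .
qed

text \<open>The ladder relations generate every matrix element from the Gaussian, first along
  \<open>k = 0\<close> and then by raising \<open>k\<close>. Properties that survive linear
  combinations and multiplication by the coordinate and its conjugate thus hold for all of them;
  decay and continuity are obtained this way.\<close>

lemma weyl_matrix_induct:
  assumes base: "P (\<lambda>z. weyl_matrix 0 0 (fst z) (snd z))"
    and lin: "\<And>f g a b. P f \<Longrightarrow> P g \<Longrightarrow> P (\<lambda>z. a * f z + b * g z)"
    and mult: "\<And>f. P f \<Longrightarrow> P (\<lambda>z. weyl_arg (fst z) (snd z) * f z)"
      "\<And>f. P f \<Longrightarrow> P (\<lambda>z. cnj (weyl_arg (fst z) (snd z)) * f z)"
  shows "P (\<lambda>z. weyl_matrix k j (fst z) (snd z))"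
proof (induction k arbitrary: j)
  case 0
  show ?case
  proof (induction j)
    case (Suc j)
    let ?c = "complex_of_real (sqrt (real (Suc j)))"
    have nz: "?c \<noteq> 0" by (simp del: of_nat_Suc)
    \<comment> \<open>The summand with coefficient 0 only serves to fit the shape of
      \<open>lin\<close>.\<close>
    have e: "(\<lambda>z. weyl_matrix 0 (Suc j) (fst z) (snd z)) =
       (\<lambda>z. inverse ?c * (weyl_arg (fst z) (snd z) * weyl_matrix 0 j (fst z) (snd z)) + 0 * weyl_matrix 0 j (fst z) (snd z))"
    proof
      fix z :: "real \<times> real"
      have "weyl_arg (fst z) (snd z) * weyl_matrix 0 j (fst z) (snd z) = ?c * weyl_matrix 0 (Suc j) (fst z) (snd z)"
        using weyl_matrix_raise[of j 0 "fst z" "snd z"] by (simp del: of_nat_Suc)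
      with nz show "weyl_matrix 0 (Suc j) (fst z) (snd z) = inverse ?c * (weyl_arg (fst z) (snd z) * weyl_matrix 0 j (fst z) (snd z)) + 0 * weyl_matrix 0 j (fst z) (snd z)"
        by (simp add: mult.assoc[symmetric] del: of_nat_Suc)
    qed
    show ?case unfolding e by (intro lin mult Suc.IH)
  qed (rule base)
next
  case (Suc k)
  let ?c = "complex_of_real (sqrt (real (Suc k)))"
  have nz: "?c \<noteq> 0" by (simp del: of_nat_Suc)
  let ?R = "\<lambda>z. (inverse ?c * of_real (sqrt (real j))) * weyl_matrix k (j - 1) (fst z) (snd z)
     + (- inverse ?c) * (cnj (weyl_arg (fst z) (snd z)) * weyl_matrix k j (fst z) (snd z))"
  have e: "(\<lambda>z. weyl_matrix (Suc k) j (fst z) (snd z)) = ?R"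
  proof
    fix z :: "real \<times> real"
    have "?R z = inverse ?c * (of_real (sqrt (real j)) * weyl_matrix k (j - 1) (fst z) (snd z)
         - cnj (weyl_arg (fst z) (snd z)) * weyl_matrix k j (fst z) (snd z))"
      by (simp add: algebra_simps del: of_nat_Suc)
    also have "\<dots> = inverse ?c * (?c * weyl_matrix (Suc k) j (fst z) (snd z))"
      using weyl_matrix_raise'[of k j "fst z" "snd z"] by simp
    also have "\<dots> = weyl_matrix (Suc k) j (fst z) (snd z)" using nz by (simp add: mult.assoc[symmetric] del: of_nat_Suc)
    finally show "weyl_matrix (Suc k) j (fst z) (snd z) = ?R z" ..
  qed
  show ?case unfolding e by (intro lin mult Suc.IH)
qed

section \<open>Decay and symmetries of the matrix elements\<close>

lemma cmod_weyl_arg_le: "cmod (weyl_arg u v) \<le> 2 * exp (norm (u, v))"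
proof -
  have "cmod (weyl_arg u v) = cmod (of_real v - \<i> * of_real u) / sqrt 2"
    by (simp add: weyl_arg_def norm_divide)
  also have "\<dots> \<le> cmod (of_real v - \<i> * of_real u)"
    using mult_left_mono[of 1 "sqrt 2" "cmod (of_real v - \<i> * of_real u)"] by (simp add: field_simps)
  also have "\<dots> \<le> \<bar>v\<bar> + \<bar>u\<bar>" using norm_triangle_ineq4[of "of_real v" "\<i> * of_real u"] by (simp add: norm_mult)
  also have "\<dots> \<le> 2 * norm (u, v)" using norm_fst_le[of u v] norm_snd_le[of v u] by simp
  also have "\<dots> \<le> 2 * exp (norm (u, v))" using exp_ge_add_one_self[of "norm (u, v)"] by linarith
  finally show ?thesis .
qed

lemma rapid_weyl_matrix: "rapid (\<lambda>z. weyl_matrix k j (fst z) (snd z))"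
proof (rule weyl_matrix_induct)
  have "rapid (\<lambda>z::real \<times> real. exp (- ((1 / 4) * (norm z)\<^sup>2)))" by (rule rapid_gauss_norm) simp
  then show "rapid (\<lambda>z. weyl_matrix 0 0 (fst z) (snd z))"
    unfolding weyl_matrix_0_0 by (intro rapid_of_real) (simp add: norm_prod_def)
next
  fix f :: "real \<times> real \<Rightarrow> complex" assume "rapid f"
  then show "rapid (\<lambda>z. weyl_arg (fst z) (snd z) * f z)" "rapid (\<lambda>z. cnj (weyl_arg (fst z) (snd z)) * f z)"
    by (rule rapid_bound[where C = 2 and c = 1];
        use cmod_weyl_arg_le in \<open>auto simp: norm_mult intro!: mult_right_mono\<close>)+
qed (intro rapid_add rapid_cmult)

lemma continuous_on_weyl_matrix: "continuous_on UNIV (\<lambda>z. weyl_matrix k j (fst z) (snd z))"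
  by (rule weyl_matrix_induct) (auto simp: weyl_matrix_0_0 weyl_arg_def intro!: continuous_intros)

lemma continuous_on_weyl_matrix' [continuous_intros]:
  assumes "continuous_on A f" "continuous_on A g"
  shows "continuous_on A (\<lambda>x. weyl_matrix k j (f x) (g x))"
  using continuous_on_compose2[OF continuous_on_weyl_matrix continuous_on_Pair[OF assms]] by simp

lemma borel_measurable_weyl_matrix [measurable]:
  "f \<in> borel_measurable M \<Longrightarrow> g \<in> borel_measurable M \<Longrightarrow> (\<lambda>x. weyl_matrix k j (f x) (g x)) \<in> borel_measurable M"
  using measurable_compose[OF borel_measurable_Pair borel_measurable_continuous_onI[OF continuous_on_weyl_matrix]]
  by simp

lemma rapid_weyl_matrix_axis: "rapid (\<lambda>u. weyl_matrix k j u 0)"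
  unfolding rapid_def
proof
  fix c :: real
  obtain C where "\<And>z. norm (weyl_matrix k j (fst z) (snd z)) * exp (c * norm z) \<le> C"
    using rapid_weyl_matrix unfolding rapid_def by blast
  from this[of "(_, 0)"] show "\<exists>C. \<forall>u. norm (weyl_matrix k j u 0) * exp (c * norm u) \<le> C"
    by (auto simp: norm_Pair)
qed

lemma cmod_weyl_matrix_le_1: "cmod (weyl_matrix k j u v) \<le> 1"
proof -
  have sh: "(LBINT x. (hermite_fun k (x - v))\<^sup>2) = 1"
    using lborel_integral_real_affine[of 1 "\<lambda>x. (hermite_fun k x)\<^sup>2" "- v"] hermite_fun_orthonormal[of k k]
    by (simp add: power2_eq_square)
  have i: "integrable lborel (\<lambda>x. (hermite_fun k (x - v))\<^sup>2)" for k v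
    unfolding power2_eq_square by (intro rapid_integrable rapid_mult rapid_shift hermite_fun_rapid) simp
  have "cmod (weyl_matrix k j u v) \<le> (LBINT x. cmod (weyl_integrand k j u v x))"
    unfolding weyl_matrix_def by (rule integral_norm_bound)
  also have "\<dots> \<le> (LBINT x. ((hermite_fun j x)\<^sup>2 + (hermite_fun k (x - v))\<^sup>2) / 2)"
  proof (rule integral_mono)
    show "integrable lborel (\<lambda>x. cmod (weyl_integrand k j u v x))"
      by (intro integrable_norm integrable_weyl_integrand)
    show "integrable lborel (\<lambda>x. ((hermite_fun j x)\<^sup>2 + (hermite_fun k (x - v))\<^sup>2) / 2)"
      using i[of j 0] i[of k v] by auto
    show "cmod (weyl_integrand k j u v x) \<le> ((hermite_fun j x)\<^sup>2 + (hermite_fun k (x - v))\<^sup>2) / 2" for x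
      unfolding norm_weyl_integrand
      using sum_squares_bound[of "\<bar>hermite_fun j x\<bar>" "\<bar>hermite_fun k (x - v)\<bar>"] by simp
  qed
  also have "\<dots> = 1"
    using i[of j 0] i[of k v] sh hermite_fun_orthonormal[of j j] by (simp add: power2_eq_square)
  finally show ?thesis .
qed

text \<open>Each factor \<open>u\<close> is traded for two neighbouring elements with coefficients
  at most \<open>sqrt n\<close>, at the price \<open>2 * sqrt 2 * sqrt n = sqrt (8 * n)\<close>.
  Since \<open>m\<close> is free, the elements with indices below \<open>n\<close> are negligible
  once \<open>\<bar>u\<bar>\<close> exceeds \<open>sqrt n\<close> by a power of
  \<open>n\<close>.\<close>

lemma weyl_matrix_decay:
  assumes "k < n" "j < n"
  shows "\<bar>u\<bar> ^ m * cmod (weyl_matrix k j u 0) \<le> sqrt (8 * (real n + real m)) ^ m"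
  using assms
proof (induction m arbitrary: k j n)
  case 0
  then show ?case by (simp add: cmod_weyl_matrix_le_1)
next
  case (Suc m)
  \<comment> \<open>Raising \<open>j\<close> may reach the index \<open>n\<close>, so the induction
    hypothesis is applied at \<open>Suc n\<close>; the sum \<open>Suc n + m = n + Suc m\<close>
    keeps the bound in shape.\<close>
  let ?B = "sqrt (8 * (real (Suc n) + real m)) ^ m"
  have B: "?B \<ge> 0" by simp
  have a: "cmod (weyl_arg u 0) = \<bar>u\<bar> / sqrt 2" by (simp add: weyl_arg_def norm_divide norm_mult)
  have "\<bar>u\<bar> * cmod (weyl_matrix k j u 0) = sqrt 2 * cmod (weyl_arg u 0 * weyl_matrix k j u 0)"
    by (simp add: norm_mult a)
  also have "weyl_arg u 0 * weyl_matrix k j u 0 =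
     of_real (sqrt (real (Suc j))) * weyl_matrix k (Suc j) u 0 - of_real (sqrt (real k)) * weyl_matrix (k - 1) j u 0"
    unfolding weyl_matrix_raise by simp
  also have "cmod \<dots> \<le> sqrt (real (Suc j)) * cmod (weyl_matrix k (Suc j) u 0) + sqrt (real k) * cmod (weyl_matrix (k - 1) j u 0)"
    by (rule norm_triangle_le_diff) (simp add: norm_mult)
  also have "\<dots> \<le> sqrt (real n) * cmod (weyl_matrix k (Suc j) u 0) + sqrt (real n) * cmod (weyl_matrix (k - 1) j u 0)"
    using Suc.prems by (intro add_mono mult_right_mono) auto
  finally have "\<bar>u\<bar> ^ Suc m * cmod (weyl_matrix k j u 0) \<le> \<bar>u\<bar> ^ m * (sqrt 2 *
     (sqrt (real n) * cmod (weyl_matrix k (Suc j) u 0) + sqrt (real n) * cmod (weyl_matrix (k - 1) j u 0)))"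
    by (simp add: mult_left_mono mult.assoc mult.left_commute[of "\<bar>u\<bar>"] del: mult_le_cancel_left)
  also have "\<dots> = sqrt 2 * sqrt (real n) * (\<bar>u\<bar> ^ m * cmod (weyl_matrix k (Suc j) u 0) + \<bar>u\<bar> ^ m * cmod (weyl_matrix (k - 1) j u 0))"
    by (simp add: algebra_simps)
  also have "\<dots> \<le> sqrt 2 * sqrt (real n) * (?B + ?B)"
    using Suc.prems by (intro mult_left_mono add_mono Suc.IH) auto
  also have "\<dots> = sqrt (8 * real n) * ?B"
    using real_sqrt_mult[of 4 2] by (simp add: real_sqrt_mult)
  also have "\<dots> \<le> sqrt (8 * (real n + real (Suc m))) * ?B"
    by (intro mult_right_mono) auto
  finally show ?case by (simp add: algebra_simps)
qed

lemma weyl_matrix_commute: "weyl_matrix k j u 0 = weyl_matrix j k u 0"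
  unfolding weyl_matrix_def weyl_integrand_def by (simp add: mult_ac)

lemma cnj_weyl_matrix: "cnj (weyl_matrix k j u 0) = weyl_matrix k j (- u) 0"
proof -
  have "cnj (weyl_matrix k j u 0) = (LBINT x. cnj (weyl_integrand k j u 0 x))"
    unfolding weyl_matrix_def by simp
  also have "\<dots> = weyl_matrix k j (- u) 0"
    unfolding weyl_matrix_def
    by (intro Bochner_Integration.integral_cong) (auto simp: weyl_integrand_def exp_cnj)
  finally show ?thesis .
qed

lemma weyl_matrix_minus: "weyl_matrix k j (- u) 0 = (- 1) ^ (k + j) * weyl_matrix k j u 0"
proof -
  have "weyl_matrix k j (- u) 0 = (LBINT x. weyl_integrand k j (- u) 0 (- x))"
    unfolding weyl_matrix_def using lborel_integral_real_affine[of "-1" "weyl_integrand k j (- u) 0" 0] by simp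
  also have "\<dots> = (LBINT x. (- 1) ^ (k + j) * weyl_integrand k j u 0 x)"
    by (intro Bochner_Integration.integral_cong) (auto simp: weyl_integrand_def hermite_fun_minus power_add)
  finally show ?thesis by (simp add: weyl_matrix_def)
qed

text \<open>The relations move a raising step from the left pair of indices to a lowering step in
  the right pair, so \<open>S\<close> is determined by its values at \<open>k = j = 0\<close>. It is
  stated for an abstract \<open>S\<close> because two different integrals satisfy the relations: the
  one over the plane and the one on the axis with weight \<open>\<bar>u\<bar>\<close>.\<close>

lemma ladder_orthogonality:
  fixes S :: "nat \<Rightarrow> nat \<Rightarrow> nat \<Rightarrow> nat \<Rightarrow> complex"
  assumes raise: "\<And>k j a b. of_real (sqrt (real (Suc j))) * S k (Suc j) a b - of_real (sqrt (real k)) * S (k - 1) j a b =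
      of_real (sqrt (real b)) * S k j a (b - 1) - of_real (sqrt (real (Suc a))) * S k j (Suc a) b"
    and raise': "\<And>k j a b. of_real (sqrt (real (Suc k))) * S (Suc k) j a b - of_real (sqrt (real j)) * S k (j - 1) a b =
      of_real (sqrt (real a)) * S k j (a - 1) b - of_real (sqrt (real (Suc b))) * S k j a (Suc b)"
    and base: "\<And>a b. S 0 0 a b = (if a = 0 \<and> b = 0 then c else 0)"
  shows "S k j a b = (if k = a \<and> j = b then c else 0)"
proof (induction k arbitrary: j a b)
  case 0
  show ?case
  proof (induction j arbitrary: a b)
    case (Suc j)
    have "of_real (sqrt (real (Suc j))) * S 0 (Suc j) a b = of_real (sqrt (real b)) * (if 0 = a \<and> j = b - 1 then c else 0)"
      using raise[of j 0 a b] unfolding Suc.IH by simp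
    also have "\<dots> = of_real (sqrt (real (Suc j))) * (if 0 = a \<and> Suc j = b then c else 0)"
      by (cases b) auto
    finally show ?case by (simp del: of_nat_Suc)
  qed (simp add: base)
next
  case (Suc k)
  have "of_real (sqrt (real (Suc k))) * S (Suc k) j a b =
      of_real (sqrt (real j)) * (if k = a \<and> j - 1 = b then c else 0) +
      of_real (sqrt (real a)) * (if k = a - 1 \<and> j = b then c else 0) -
      of_real (sqrt (real (Suc b))) * (if k = a \<and> j = Suc b then c else 0)"
    using raise'[of k j a b] unfolding Suc.IH by (simp add: algebra_simps del: of_nat_Suc)
  also have "\<dots> = of_real (sqrt (real (Suc k))) * (if Suc k = a \<and> j = b then c else 0)"
    by (cases a; cases j) (auto simp del: of_nat_Suc)
  finally show ?case by (simp del: of_nat_Suc)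
qed

subsection \<open>Orthogonality of the matrix elements\<close>

text \<open>Differentiation under the integral sign. The parameter \<open>c\<close> covers both sign
  conventions: \<open>- 1\<close> for the matrix elements on the axis and \<open>1\<close> for their
  inverse transforms.\<close>

lemma fourier_has_vector_derivative:
  fixes a :: "real \<Rightarrow> complex"
  assumes a[measurable]: "integrable lborel a" and xa: "integrable lborel (\<lambda>x. of_real x * a x)"
  shows "((\<lambda>t. LBINT x. a x * exp (\<i> * of_real (c * t * x))) has_vector_derivative
    (LBINT x. \<i> * of_real c * of_real x * a x * exp (\<i> * of_real (c * t * x)))) (at t)"
proof -
  let ?F = "\<lambda>t. \<integral>x. a x * exp (\<i> * of_real (c * t * x)) \<partial>lborel"
  let ?D = "\<integral>x. \<i> * of_real c * of_real x * a x * exp (\<i> * of_real (c * t * x)) \<partial>lborel"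
  \<comment> \<open>The first-order Taylor remainder of the exponential has a quadratic and a linear
    bound. The quadratic one tends to 0 pointwise after division by the increment, the linear one is
    the integrable majorant.\<close>
  let ?w = "\<lambda>h x. cmod (a x) * min (c\<^sup>2 * x\<^sup>2 * \<bar>h\<bar> / 2) (2 * \<bar>c\<bar> * \<bar>x\<bar>)"
  have nxa: "integrable lborel (\<lambda>x. cmod (a x) * (2 * \<bar>c\<bar> * \<bar>x\<bar>))"
    using integrable_mult_right[OF integrable_norm[OF xa], of "2 * \<bar>c\<bar>"] by (simp add: norm_mult mult_ac)
  have wi: "integrable lborel (?w h)" for h
    by (rule Bochner_Integration.integrable_bound[OF nxa]) (auto intro!: mult_left_mono simp: abs_mult)
  have fi: "integrable lborel (\<lambda>x. a x * exp (\<i> * of_real (c * t * x)))" for t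
    by (rule Bochner_Integration.integrable_bound[OF a]) (auto simp: norm_mult)
  have di: "integrable lborel (\<lambda>x. \<i> * of_real c * of_real x * a x * exp (\<i> * of_real (c * t * x)))"
    by (rule Bochner_Integration.integrable_bound[OF integrable_mult_right[OF xa, of "of_real c"]]) (auto simp: norm_mult)
  have bnd: "norm (?F y - ?F t - (y - t) *\<^sub>R ?D) / norm (y - t) \<le> (LBINT x. ?w (y - t) x)" for y
  proof (cases "y = t")
    case False
    let ?h = "y - t"
    have pt: "cmod (a x * exp (\<i> * of_real (c * y * x)) - a x * exp (\<i> * of_real (c * t * x)) -
        ?h *\<^sub>R (\<i> * of_real c * of_real x * a x * exp (\<i> * of_real (c * t * x)))) \<le> \<bar>?h\<bar> * ?w ?h x" for x
    proof -
      let ?r = "c * ?h * x"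
      have e: "exp (\<i> * of_real (c * y * x)) = exp (\<i> * of_real (c * t * x)) * iexp ?r"
        unfolding exp_add[symmetric] by (rule arg_cong[of _ _ exp]) (simp add: algebra_simps)
      have "a x * exp (\<i> * of_real (c * y * x)) - a x * exp (\<i> * of_real (c * t * x)) -
        ?h *\<^sub>R (\<i> * of_real c * of_real x * a x * exp (\<i> * of_real (c * t * x))) =
        a x * exp (\<i> * of_real (c * t * x)) * (iexp ?r - (\<Sum>k\<le>1. (\<i> * ?r) ^ k / fact k))"
        unfolding e by (simp add: algebra_simps scaleR_conv_of_real)
      then have "cmod (a x * exp (\<i> * of_real (c * y * x)) - a x * exp (\<i> * of_real (c * t * x)) -
        ?h *\<^sub>R (\<i> * of_real c * of_real x * a x * exp (\<i> * of_real (c * t * x)))) =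
        cmod (a x) * cmod (iexp ?r - (\<Sum>k\<le>1. (\<i> * ?r) ^ k / fact k))"
        by (simp only: norm_mult norm_exp_i_times mult_1_right)
      also have "\<dots> \<le> cmod (a x) * min (\<bar>?r\<bar> ^ Suc 1 / fact (Suc 1)) (2 * \<bar>?r\<bar> ^ 1 / fact 1)"
        by (intro mult_left_mono min.boundedI iexp_approx1 iexp_approx2) auto
      also have "min (\<bar>?r\<bar> ^ Suc 1 / fact (Suc 1)) (2 * \<bar>?r\<bar> ^ 1 / fact 1) =
          \<bar>?h\<bar> * min (c\<^sup>2 * x\<^sup>2 * \<bar>?h\<bar> / 2) (2 * \<bar>c\<bar> * \<bar>x\<bar>)"
      proof -
        have 1: "\<bar>?r\<bar> ^ Suc 1 / fact (Suc 1) = \<bar>?h\<bar> * (c\<^sup>2 * x\<^sup>2 * \<bar>?h\<bar> / 2)"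
        proof -
          have "\<bar>?r\<bar> ^ Suc 1 = ?r\<^sup>2" by (simp only: Suc_1 power2_abs)
          then show ?thesis by (simp add: power_mult_distrib power2_eq_square)
        qed
        have 2: "2 * \<bar>?r\<bar> ^ 1 / fact 1 = \<bar>?h\<bar> * (2 * \<bar>c\<bar> * \<bar>x\<bar>)"
          by (simp add: abs_mult)
        show ?thesis unfolding 1 2 by (simp add: min_mult_distrib_left)
      qed
      finally show ?thesis by (simp add: mult_ac)
    qed
    have eq: "?F y - ?F t - ?h *\<^sub>R ?D = (LBINT x. a x * exp (\<i> * of_real (c * y * x)) - a x * exp (\<i> * of_real (c * t * x)) -
        ?h *\<^sub>R (\<i> * of_real c * of_real x * a x * exp (\<i> * of_real (c * t * x))))"
      using fi di by (simp del: scaleR_conv_of_real)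
    have "norm (?F y - ?F t - ?h *\<^sub>R ?D) \<le> (LBINT x. \<bar>?h\<bar> * ?w ?h x)"
      unfolding eq
    proof (rule order_trans[OF integral_norm_bound integral_mono])
      show "integrable lborel (\<lambda>x. norm (a x * exp (\<i> * of_real (c * y * x)) - a x * exp (\<i> * of_real (c * t * x)) -
        ?h *\<^sub>R (\<i> * of_real c * of_real x * a x * exp (\<i> * of_real (c * t * x)))))"
        by (rule integrable_norm[OF Bochner_Integration.integrable_diff[OF
              Bochner_Integration.integrable_diff[OF fi fi] integrable_scaleR_right[OF di]]])
      show "integrable lborel (\<lambda>x. \<bar>?h\<bar> * ?w ?h x)" by (rule integrable_mult_right[OF wi])
    qed (rule pt)
    also have "\<dots> = \<bar>?h\<bar> * (LBINT x. ?w ?h x)" by (rule integral_mult_right_zero)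
    finally show ?thesis using False by (simp add: field_simps)
  qed (auto intro!: integral_nonneg_AE)
  have lim: "((\<lambda>y. LBINT x. ?w (y - t) x) \<longlongrightarrow> 0) (at t)"
    unfolding tendsto_at_iff_sequentially comp_def
  proof (intro allI impI)
    fix X :: "nat \<Rightarrow> real" assume X: "X \<longlonglongrightarrow> t"
    have "(\<lambda>n. LBINT x. ?w (X n - t) x) \<longlonglongrightarrow> (\<integral>x. 0 \<partial>(lborel::real measure))"
    proof (rule integral_dominated_convergence[OF _ _ nxa])
      show "AE x in lborel. (\<lambda>n. ?w (X n - t) x) \<longlonglongrightarrow> 0"
      proof (intro AE_I2)
        fix x
        have "(\<lambda>n. ?w (X n - t) x) \<longlonglongrightarrow> cmod (a x) * min (c\<^sup>2 * x\<^sup>2 * \<bar>t - t\<bar> / 2) (2 * \<bar>c\<bar> * \<bar>x\<bar>)"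
          by (intro tendsto_intros X) auto
        then show "(\<lambda>n. ?w (X n - t) x) \<longlonglongrightarrow> 0" by simp
      qed
      show "AE x in lborel. norm (?w (X n - t) x) \<le> cmod (a x) * (2 * \<bar>c\<bar> * \<bar>x\<bar>)" for n
        by (auto intro!: mult_left_mono simp: abs_mult)
    qed auto
    then show "(\<lambda>n. LBINT x. ?w (X n - t) x) \<longlonglongrightarrow> 0" by simp
  qed
  show ?thesis
    unfolding has_vector_derivative_def has_derivative_iff_norm
  proof
    show "((\<lambda>y. norm (?F y - ?F t - (y - t) *\<^sub>R ?D) / norm (y - t)) \<longlongrightarrow> 0) (at t)"
      using bnd by (intro tendsto_sandwich[OF _ _ tendsto_const lim]) auto
  qed (rule bounded_linear_scaleR_left)
qed

text \<open>The two half lines contribute the same boundary value instead of cancelling, because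
  \<open>sgn\<close> jumps by 2 at the origin.\<close>

lemma integral_sgn_derivative:
  fixes F F' :: "real \<Rightarrow> complex"
  assumes d: "\<And>x. (F has_vector_derivative F' x) (at x)" and c: "continuous_on UNIV F'"
    and r: "rapid F" "rapid F'"
  shows "(LBINT x. of_real (sgn x) * F' x) = - 2 * F 0"
proof -
  have m[measurable]: "F' \<in> borel_measurable borel" by (intro borel_measurable_continuous_onI c)
  have i: "integrable lborel F'" using r(2) by (rule rapid_integrable) simp
  have p: "(LBINT x. indicator {0<..} x *\<^sub>R F' x) = - F 0"
    by (rule integral_derivative_rapid_half[OF d c r])
  have rm: "rapid (\<lambda>x. f (- x))" if "rapid f" for f :: "real \<Rightarrow> complex"
    unfolding rapid_def
  proof
    fix c :: real
    obtain C where "\<And>z. norm (f z) * exp (c * norm z) \<le> C" using \<open>rapid f\<close> unfolding rapid_def by blast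
    from this[of "- _"] show "\<exists>C. \<forall>z. norm (f (- z)) * exp (c * norm z) \<le> C" by auto
  qed
  have n: "(LBINT x. indicator {0<..} x *\<^sub>R - F' (- x)) = - F (- 0)"
  proof (rule integral_derivative_rapid_half)
    show "((\<lambda>x. F (- x)) has_vector_derivative - F' (- x)) (at x)" for x
    proof -
      have "(uminus has_vector_derivative (- 1 :: real)) (at x)"
        unfolding has_real_derivative_iff_has_vector_derivative[symmetric]
        by (auto intro!: derivative_eq_intros)
      from vector_diff_chain_at[OF this d[of "- x"]] show ?thesis by (simp add: o_def)
    qed
    show "continuous_on UNIV (\<lambda>x. - F' (- x))"
      by (intro continuous_on_minus continuous_on_compose2[OF c]) (auto intro!: continuous_intros)
  qed (intro rm r rapid_uminus)+
  have "(LBINT x. indicator {..<0} x *\<^sub>R F' x) = (LBINT x. indicator {..<0} (- x) *\<^sub>R F' (- x))"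
    using lborel_integral_real_affine[of "-1" "\<lambda>x. indicator {..<0::real} x *\<^sub>R F' x" 0] by simp
  also have "\<dots> = - (LBINT x. indicator {0<..} x *\<^sub>R - F' (- x))"
    unfolding scaleR_minus_right by (simp, intro Bochner_Integration.integral_cong) (auto simp: indicator_def)
  also have "\<dots> = F 0" using n by simp
  finally have q: "(LBINT x. indicator {..<0} x *\<^sub>R F' x) = F 0" .
  have "(LBINT x. of_real (sgn x) * F' x) = (LBINT x. indicator {0<..} x *\<^sub>R F' x - indicator {..<0} x *\<^sub>R F' x)"
    by (intro Bochner_Integration.integral_cong) (auto simp: indicator_def sgn_real_def)
  also have "\<dots> = - F 0 - F 0"
    unfolding p[symmetric] q[symmetric] using i
    by (subst Bochner_Integration.integral_diff) (auto intro!: integrable_mult_indicator simp: p q)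
  finally show ?thesis by simp
qed

text \<open>Both sides are \<open>weyl_arg u v\<close> times the product of the two elements: the
  coordinate is read through \<open>weyl_matrix_raise\<close> on the left factor and through the
  conjugate of \<open>weyl_matrix_raise'\<close> on the right one.\<close>

lemma weyl_matrix_ladder:
  "(of_real (sqrt (real (Suc j))) * weyl_matrix k (Suc j) u v - of_real (sqrt (real k)) * weyl_matrix (k - 1) j u v) * cnj (weyl_matrix a b u v)
   = weyl_matrix k j u v * (of_real (sqrt (real b)) * cnj (weyl_matrix a (b - 1) u v) - of_real (sqrt (real (Suc a))) * cnj (weyl_matrix (Suc a) b u v))"
proof -
  have 1: "of_real (sqrt (real (Suc j))) * weyl_matrix k (Suc j) u v - of_real (sqrt (real k)) * weyl_matrix (k - 1) j u v =
    weyl_arg u v * weyl_matrix k j u v"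
    unfolding weyl_matrix_raise by simp
  have "of_real (sqrt (real b)) * cnj (weyl_matrix a (b - 1) u v) - of_real (sqrt (real (Suc a))) * cnj (weyl_matrix (Suc a) b u v)
     = cnj (of_real (sqrt (real b)) * weyl_matrix a (b - 1) u v - of_real (sqrt (real (Suc a))) * weyl_matrix (Suc a) b u v)"
    by simp
  also have "\<dots> = weyl_arg u v * cnj (weyl_matrix a b u v)"
    unfolding weyl_matrix_raise' by simp
  finally show ?thesis unfolding 1 by simp
qed

lemma weyl_matrix_ladder':
  "(of_real (sqrt (real (Suc k))) * weyl_matrix (Suc k) j u v - of_real (sqrt (real j)) * weyl_matrix k (j - 1) u v) * cnj (weyl_matrix a b u v)
   = weyl_matrix k j u v * (of_real (sqrt (real a)) * cnj (weyl_matrix (a - 1) b u v) - of_real (sqrt (real (Suc b))) * cnj (weyl_matrix a (Suc b) u v))"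
proof -
  have "cnj ((of_real (sqrt (real (Suc k))) * weyl_matrix (Suc k) j u v - of_real (sqrt (real j)) * weyl_matrix k (j - 1) u v) * cnj (weyl_matrix a b u v))
   = cnj (weyl_matrix k j u v * (of_real (sqrt (real a)) * cnj (weyl_matrix (a - 1) b u v) - of_real (sqrt (real (Suc b))) * cnj (weyl_matrix a (Suc b) u v)))"
    using weyl_matrix_ladder[of b a u v k j] by (simp add: algebra_simps)
  then show ?thesis by (simp only: complex_cnj_cancel_iff)
qed

text \<open>The ladder identities hold pointwise, so they survive integration against any weight for
  which the products are integrable.\<close>

lemma weyl_matrix_ladder_integral:
  assumes i: "\<And>k j a b. integrable M (\<lambda>z. w z * (weyl_matrix k j (U z) (V z) * cnj (weyl_matrix a b (U z) (V z))))"
  defines "S \<equiv> \<lambda>k j a b. \<integral>z. w z * (weyl_matrix k j (U z) (V z) * cnj (weyl_matrix a b (U z) (V z))) \<partial>M"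
  shows "of_real (sqrt (real (Suc j))) * S k (Suc j) a b - of_real (sqrt (real k)) * S (k - 1) j a b =
      of_real (sqrt (real b)) * S k j a (b - 1) - of_real (sqrt (real (Suc a))) * S k j (Suc a) b" (is ?A)
    and "of_real (sqrt (real (Suc k))) * S (Suc k) j a b - of_real (sqrt (real j)) * S k (j - 1) a b =
      of_real (sqrt (real a)) * S k j (a - 1) b - of_real (sqrt (real (Suc b))) * S k j a (Suc b)" (is ?B)
proof -
  let ?t = "\<lambda>k j a b z. w z * (weyl_matrix k j (U z) (V z) * cnj (weyl_matrix a b (U z) (V z)))"
  have lin: "c * (\<integral>z. ?t k j a b z \<partial>M) - d * (\<integral>z. ?t k' j' a' b' z \<partial>M) =
      (\<integral>z. c * ?t k j a b z - d * ?t k' j' a' b' z \<partial>M)" for c d k j a b k' j' a' b'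
    by (simp add: i)
  show ?A
    unfolding S_def lin
  proof (intro Bochner_Integration.integral_cong refl)
    fix z
    show "of_real (sqrt (real (Suc j))) * ?t k (Suc j) a b z - of_real (sqrt (real k)) * ?t (k - 1) j a b z =
      of_real (sqrt (real b)) * ?t k j a (b - 1) z - of_real (sqrt (real (Suc a))) * ?t k j (Suc a) b z"
      using arg_cong[OF weyl_matrix_ladder[of j k "U z" "V z" a b], of "\<lambda>x. w z * x"]
      by (simp only: right_diff_distrib left_diff_distrib mult_ac)
  qed
  show ?B
    unfolding S_def lin
  proof (intro Bochner_Integration.integral_cong refl)
    fix z
    show "of_real (sqrt (real (Suc k))) * ?t (Suc k) j a b z - of_real (sqrt (real j)) * ?t k (j - 1) a b z =
      of_real (sqrt (real a)) * ?t k j (a - 1) b z - of_real (sqrt (real (Suc b))) * ?t k j a (Suc b) z"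
      using arg_cong[OF weyl_matrix_ladder'[of k j "U z" "V z" a b], of "\<lambda>x. w z * x"]
      by (simp only: right_diff_distrib left_diff_distrib mult_ac)
  qed
qed

lemma weyl_matrix_axis_derivative:
  "((\<lambda>u. weyl_matrix k j u 0) has_vector_derivative
    - \<i> / of_real (sqrt 2) * (of_real (sqrt (real k)) * weyl_matrix (k - 1) j u 0 +
      of_real (sqrt (real (Suc k))) * weyl_matrix (Suc k) j u 0)) (at u)"
proof -
  let ?a = "\<lambda>k x. complex_of_real (hermite_fun j x * hermite_fun k x)"
  have r: "rapid (?a k)" for k by (intro rapid_of_real rapid_mult hermite_fun_rapid)
  have f: "weyl_matrix k j u 0 = (LBINT x. ?a k x * exp (\<i> * of_real (- 1 * u * x)))" for k u
    by (simp add: weyl_matrix_def weyl_integrand_def[abs_def] mult_ac)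
  have i: "integrable lborel (\<lambda>x. ?a k x * exp (\<i> * of_real (- 1 * u * x)))" for k
    using integrable_weyl_integrand[of k j u 0] by (simp add: weyl_integrand_def[abs_def] mult_ac)
  have x: "- \<i> / of_real (sqrt 2) * (of_real (sqrt (real k)) * ?a (k - 1) x + of_real (sqrt (real (Suc k))) * ?a (Suc k) x)
      = \<i> * of_real (- 1) * of_real x * ?a k x" for x
  proof -
    have "sqrt 2 * (x * (hermite_fun j x * hermite_fun k x)) = sqrt (real k) * (hermite_fun j x * hermite_fun (k - 1) x) +
       sqrt (real (Suc k)) * (hermite_fun j x * hermite_fun (Suc k) x)"
      using arg_cong[OF x_hermite_fun[of x k], of "\<lambda>y. hermite_fun j x * y"] by (simp only: distrib_left mult_ac)
    then have "of_real (sqrt (real k)) * ?a (k - 1) x + of_real (sqrt (real (Suc k))) * ?a (Suc k) x =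
       complex_of_real (sqrt 2) * (of_real x * ?a k x)"
      unfolding of_real_mult[symmetric] of_real_add[symmetric] by simp
    then show ?thesis by (simp only:) simp
  qed
  have "((\<lambda>t. LBINT x. ?a k x * exp (\<i> * of_real (- 1 * t * x))) has_vector_derivative
     (LBINT x. \<i> * of_real (- 1) * of_real x * ?a k x * exp (\<i> * of_real (- 1 * u * x)))) (at u)"
  proof (rule fourier_has_vector_derivative)
    show "integrable lborel (?a k)" by (intro rapid_integrable r) simp
    have "rapid (\<lambda>x. of_real x * ?a k x)"
      using rapid_of_real[OF rapid_ident_mult[OF rapid_mult[OF hermite_fun_rapid[of j] hermite_fun_rapid[of k]]]] by simp
    then show "integrable lborel (\<lambda>x. of_real x * ?a k x)" by (rule rapid_integrable) simp
  qed
  also have "(LBINT x. \<i> * of_real (- 1) * of_real x * ?a k x * exp (\<i> * of_real (- 1 * u * x))) =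
     (LBINT x. - \<i> / of_real (sqrt 2) * (of_real (sqrt (real k)) * (?a (k - 1) x * exp (\<i> * of_real (- 1 * u * x)))
       + of_real (sqrt (real (Suc k))) * (?a (Suc k) x * exp (\<i> * of_real (- 1 * u * x)))))"
    unfolding x[symmetric] by (intro Bochner_Integration.integral_cong refl) (simp only: distrib_right distrib_left mult_ac)
  also have "\<dots> = - \<i> / of_real (sqrt 2) * (of_real (sqrt (real k)) * weyl_matrix (k - 1) j u 0 +
      of_real (sqrt (real (Suc k))) * weyl_matrix (Suc k) j u 0)"
    unfolding f by (simp only: integral_mult_right_zero Bochner_Integration.integral_add[OF integrable_mult_right[OF i] integrable_mult_right[OF i]])
  finally show ?thesis unfolding f[symmetric] .
qed

lemma weyl_matrix_0: "weyl_matrix k j 0 0 = (if k = j then 1 else 0)"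
proof -
  have "weyl_matrix k j 0 0 = of_real (LBINT x. hermite_fun j x * hermite_fun k x)"
    unfolding weyl_matrix_def integral_complex_of_real[symmetric] by (simp add: weyl_integrand_def[abs_def])
  then show ?thesis by (simp add: hermite_fun_orthonormal)
qed

lemma rapid_abs_mult:
  fixes f :: "real \<Rightarrow> complex"
  shows "rapid f \<Longrightarrow> rapid (\<lambda>x. of_real \<bar>x\<bar> * f x)"
  by (erule rapid_bound[where C = 1 and c = 1])
     (auto simp: norm_mult intro!: mult_right_mono order_trans[OF _ exp_ge_add_one_self])

lemma rapid_sgn_mult:
  fixes f :: "real \<Rightarrow> complex"
  shows "rapid f \<Longrightarrow> rapid (\<lambda>x. of_real (sgn x) * f x)"
  by (erule rapid_dominated) (auto simp: norm_mult sgn_real_def)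

text \<open>The integral with weight \<open>\<bar>u\<bar>\<close> is linked to integrals with weight
  \<open>sgn u\<close> in two ways: by the ladder relation, and by integrating a derivative against
  \<open>sgn\<close>, where the boundary value is 1 for every \<open>a\<close>. The two equations
  determine \<open>?P a\<close> independently of \<open>a\<close>. Since \<open>?Q a\<close> is
  \<open>?P (a - 1)\<close> for positive \<open>a\<close> and vanishes for \<open>a = 0\<close>, the
  difference \<open>?P a - ?Q a\<close> is nonzero only at \<open>a = 0\<close>.\<close>

lemma weyl_matrix_radial_base:
  "(LBINT u. of_real \<bar>u\<bar> * (weyl_matrix 0 0 u 0 * weyl_matrix a a u 0)) = (if a = 0 then 2 else 0)"
proof -
  let ?m = "\<lambda>k j u. weyl_matrix k j u 0"
  let ?I = "\<lambda>a. \<integral>u. of_real \<bar>u\<bar> * (?m 0 0 u * ?m a a u) \<partial>lborel"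
  let ?J = "\<lambda>k j. \<integral>u. of_real (sgn u) * (?m 0 0 u * ?m k j u) \<partial>lborel"
  let ?s = "complex_of_real (sqrt 2)"
  let ?P = "\<lambda>a. of_real (sqrt (real (Suc a))) * ?J a (Suc a)"
  let ?Q = "\<lambda>a. of_real (sqrt (real a)) * ?J (a - 1) a"
  have r: "rapid (\<lambda>u. ?m 0 0 u * ?m k j u)" for k j by (intro rapid_mult rapid_weyl_matrix_axis)
  have iJ: "integrable lborel (\<lambda>u. of_real (sgn u) * (?m 0 0 u * ?m k j u))" for k j
    by (intro rapid_integrable rapid_sgn_mult r) simp
  have iI: "integrable lborel (\<lambda>u. of_real \<bar>u\<bar> * (?m 0 0 u * ?m k j u))" for k j
    by (intro rapid_integrable rapid_abs_mult r) simp
  have s: "?s * ?s = 2" by (simp add: of_real_mult[symmetric] del: of_real_mult)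
  have snz: "?s \<noteq> 0" by simp
  \<comment> \<open>Here \<open>\<bar>u\<bar>\<close> is split as \<open>sgn u * u\<close>, and the
    factor \<open>u\<close> is absorbed by the ladder relation.\<close>
  have A: "- \<i> / ?s * ?I a = ?P a - ?Q a" for a
  proof -
    have "- \<i> / ?s * (of_real \<bar>u\<bar> * (?m 0 0 u * ?m a a u)) =
       of_real (sqrt (real (Suc a))) * (of_real (sgn u) * (?m 0 0 u * ?m a (Suc a) u)) -
       of_real (sqrt (real a)) * (of_real (sgn u) * (?m 0 0 u * ?m (a - 1) a u))" for u
    proof -
      have w: "- \<i> / ?s * of_real \<bar>u\<bar> = of_real (sgn u) * weyl_arg u 0"
        by (auto simp: weyl_arg_def sgn_real_def)
      have "- \<i> / ?s * (of_real \<bar>u\<bar> * (?m 0 0 u * ?m a a u)) = of_real (sgn u) * ?m 0 0 u * (weyl_arg u 0 * ?m a a u)"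
        unfolding mult.assoc[symmetric] w by (simp only: mult_ac)
      also have "weyl_arg u 0 * ?m a a u = of_real (sqrt (real (Suc a))) * ?m a (Suc a) u - of_real (sqrt (real a)) * ?m (a - 1) a u"
        unfolding weyl_matrix_raise by simp
      finally show ?thesis by (simp only: right_diff_distrib mult_ac)
    qed
    then show ?thesis
      unfolding integral_mult_right_zero[symmetric]
      by (simp only: Bochner_Integration.integral_diff[OF integrable_mult_right[OF iJ] integrable_mult_right[OF iJ]])
  qed
  \<comment> \<open>The derivative of the Gaussian returns the weight \<open>\<bar>u\<bar>\<close>,
    that of the other factor the two neighbours; the right-hand side is the jump of
    \<open>sgn\<close> times the value at the origin.\<close>
  have B: "- (1 / 2) * ?I a - \<i> / ?s * (?Q a + ?P a) = - 2" for a
  proof -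
    let ?G' = "\<lambda>u. - (1 / 2) * (of_real u * (?m 0 0 u * ?m a a u)) - \<i> / ?s * (of_real (sqrt (real a)) * (?m 0 0 u * ?m (a - 1) a u)
        + of_real (sqrt (real (Suc a))) * (?m 0 0 u * ?m a (Suc a) u))"
    have "(LBINT u. of_real (sgn u) * ?G' u) = - 2 * (?m 0 0 0 * ?m a a 0)"
    proof (rule integral_sgn_derivative[where F = "\<lambda>u. ?m 0 0 u * ?m a a u"])
      fix u
      have d0: "(?m 0 0 has_vector_derivative - (1 / 2) * of_real u * ?m 0 0 u) (at u)"
      proof -
        have "((\<lambda>u. exp (- ((u\<^sup>2 + 0\<^sup>2) / 4))) has_real_derivative - (1 / 2) * u * exp (- ((u\<^sup>2 + 0\<^sup>2) / 4))) (at u)"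
          by (auto intro!: derivative_eq_intros)
        then have "((\<lambda>u. complex_of_real (exp (- ((u\<^sup>2 + 0\<^sup>2) / 4)))) has_vector_derivative
            of_real (- (1 / 2) * u * exp (- ((u\<^sup>2 + 0\<^sup>2) / 4)))) (at u)"
          by (rule has_vector_derivative_of_real)
        then show ?thesis unfolding weyl_matrix_0_0 by simp
      qed
      show "((\<lambda>u. ?m 0 0 u * ?m a a u) has_vector_derivative ?G' u) (at u)"
        by (rule has_vector_derivative_eq_rhs[OF has_vector_derivative_mult[OF d0 weyl_matrix_axis_derivative]])
           (simp add: weyl_matrix_commute[of "Suc a" a] algebra_simps)
    next
      have "rapid (\<lambda>u. of_real u * (?m 0 0 u * ?m a a u))"
        by (rule rapid_dominated[OF rapid_abs_mult[OF r[of a a]]]) (simp add: norm_mult)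
      then show "rapid ?G'" by (intro rapid_diff rapid_add rapid_cmult r)
      show "continuous_on UNIV ?G'" by (intro continuous_intros)
    qed (rule r)
    also have "(LBINT u. of_real (sgn u) * ?G' u) =
      (LBINT u. - (1 / 2) * (of_real \<bar>u\<bar> * (?m 0 0 u * ?m a a u)) -
        (\<i> / ?s * of_real (sqrt (real a)) * (of_real (sgn u) * (?m 0 0 u * ?m (a - 1) a u))
        + \<i> / ?s * of_real (sqrt (real (Suc a))) * (of_real (sgn u) * (?m 0 0 u * ?m a (Suc a) u))))"
    proof (intro Bochner_Integration.integral_cong refl)
      fix u
      have "complex_of_real \<bar>u\<bar> = of_real (sgn u) * of_real u" by (auto simp: sgn_real_def)
      then show "of_real (sgn u) * ?G' u = - (1 / 2) * (of_real \<bar>u\<bar> * (?m 0 0 u * ?m a a u)) -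
        (\<i> / ?s * of_real (sqrt (real a)) * (of_real (sgn u) * (?m 0 0 u * ?m (a - 1) a u))
        + \<i> / ?s * of_real (sqrt (real (Suc a))) * (of_real (sgn u) * (?m 0 0 u * ?m a (Suc a) u)))"
        by (simp only: right_diff_distrib distrib_left mult_ac)
    qed
    also have "\<dots> = - (1 / 2) * ?I a - (\<i> / ?s * of_real (sqrt (real a)) * ?J (a - 1) a + \<i> / ?s * of_real (sqrt (real (Suc a))) * ?J a (Suc a))"
      by (simp only: Bochner_Integration.integral_diff[OF integrable_mult_right[OF iI] Bochner_Integration.integrable_add[OF integrable_mult_right[OF iJ] integrable_mult_right[OF iJ]]]
        Bochner_Integration.integral_add[OF integrable_mult_right[OF iJ] integrable_mult_right[OF iJ]] integral_mult_right_zero)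
    finally show ?thesis by (simp add: weyl_matrix_0 algebra_simps)
  qed
  have I: "?I a = \<i> * ?s * (?P a - ?Q a)" for a
    unfolding A[symmetric] using snz by simp
  \<comment> \<open>The unknown \<open>Q\<close> drops out because \<open>\<i> / sqrt 2\<close>
    equals \<open>\<i> * sqrt 2 / 2\<close>.\<close>
  have alg: "P = - \<i> * ?s" if "- (1 / 2) * (\<i> * ?s * (P - Q)) - \<i> / ?s * (Q + P) = - 2" for P Q
  proof -
    have "\<i> / ?s = \<i> * ?s / 2" using s snz by (simp add: field_simps)
    with that have e: "\<i> * ?s * P = 2" by (simp add: field_simps)
    have "P = - \<i> * ?s * (\<i> * ?s * P) / 2" using s by (simp add: algebra_simps)
    then show ?thesis unfolding e by simp
  qed
  have P: "?P a = - \<i> * ?s" for a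
  proof -
    have "- (1 / 2) * (\<i> * ?s * (?P a - ?Q a)) - \<i> / ?s * (?Q a + ?P a) = - 2"
      using B[of a] unfolding I .
    then show ?thesis by (rule alg)
  qed
  have Q: "?Q a = (if a = 0 then 0 else - \<i> * ?s)" for a
    using P[of "a - 1"] by (cases a) auto
  show ?thesis
    unfolding I P Q using s by (auto simp: algebra_simps)
qed

lemma integrable_weyl_matrix_radial:
  "integrable lborel (\<lambda>u. of_real \<bar>u\<bar> * (weyl_matrix k j u 0 * cnj (weyl_matrix a b u 0)))"
proof (rule rapid_integrable)
  have "rapid (\<lambda>u. cnj (weyl_matrix a b u 0))" by (rule rapid_dominated[OF rapid_weyl_matrix_axis[of a b]]) simp
  then show "rapid (\<lambda>u. of_real \<bar>u\<bar> * (weyl_matrix k j u 0 * cnj (weyl_matrix a b u 0)))"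
    by (intro rapid_abs_mult rapid_mult rapid_weyl_matrix_axis)
qed (intro borel_measurable_continuous_onI continuous_intros)

lemma weyl_matrix_radial_orthogonal:
  assumes "k + b = j + a"
  shows "(LBINT u. of_real \<bar>u\<bar> * (weyl_matrix k j u 0 * cnj (weyl_matrix a b u 0))) = (if k = a \<and> j = b then 2 else 0)"
proof -
  define S where "S = (\<lambda>k j a b. LBINT u. of_real \<bar>u\<bar> * (weyl_matrix k j u 0 * cnj (weyl_matrix a b u 0)))"
  \<comment> \<open>Off the diagonal \<open>k + b = j + a\<close> the weighted integral can be
    nonzero. All four terms of a ladder relation satisfy this condition or all violate it, up to
    terms with coefficient 0, so setting the other values to 0 preserves the relations.\<close>
  define T where "T = (\<lambda>k j a b. if k + b = j + a then S k j a b else 0)"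
  note L = weyl_matrix_ladder_integral[where U = "\<lambda>u. u" and V = "\<lambda>_. 0", OF integrable_weyl_matrix_radial]
  have "T k j a b = (if k = a \<and> j = b then 2 else 0)"
  proof (rule ladder_orthogonality)
    show "of_real (sqrt (real (Suc j))) * T k (Suc j) a b - of_real (sqrt (real k)) * T (k - 1) j a b =
      of_real (sqrt (real b)) * T k j a (b - 1) - of_real (sqrt (real (Suc a))) * T k j (Suc a) b" for k j a b
      using L(1)[of j k a b] by (cases k; cases b) (auto simp: T_def S_def simp del: of_nat_Suc)
    show "of_real (sqrt (real (Suc k))) * T (Suc k) j a b - of_real (sqrt (real j)) * T k (j - 1) a b =
      of_real (sqrt (real a)) * T k j (a - 1) b - of_real (sqrt (real (Suc b))) * T k j a (Suc b)" for k j a b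
      using L(2)[of k j a b] by (cases j; cases a) (auto simp: T_def S_def simp del: of_nat_Suc)
    have "cnj (weyl_matrix a a u 0) = weyl_matrix a a u 0" for a u
      unfolding cnj_weyl_matrix weyl_matrix_minus by simp
    then show "T 0 0 a b = (if a = 0 \<and> b = 0 then 2 else 0)" for a b
      using weyl_matrix_radial_base[of a] by (auto simp: T_def S_def)
  qed
  then show ?thesis using assms by (simp add: T_def S_def)
qed

subsection \<open>Irregular solutions and pattern functions\<close>

text \<open>The multiplier \<open>- \<i> * sgn r\<close> is that of the Hilbert transform, so this
  is \<open>pi\<close> times the Hilbert transform of the product of two Hermite functions. The
  factor 1 in the exponent matches \<open>fourier_has_vector_derivative\<close> with
  \<open>c = 1\<close>.\<close>

definition weyl_hilbert :: "nat \<Rightarrow> nat \<Rightarrow> real \<Rightarrow> complex" where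
  "weyl_hilbert k j x = (LBINT r. - \<i> / 2 * of_real (sgn r) * weyl_matrix k j r 0 * exp (\<i> * of_real (1 * x * r)))"

text \<open>The ramp filter of tomography applied to the same product. It is the derivative of
  \<open>weyl_hilbert\<close>, because \<open>\<i> * r\<close> times
  \<open>- \<i> / 2 * sgn r\<close> is \<open>\<bar>r\<bar> / 2\<close>.\<close>

definition weyl_ramp :: "nat \<Rightarrow> nat \<Rightarrow> real \<Rightarrow> complex" where
  "weyl_ramp k j x = (LBINT r. 1 / 2 * of_real \<bar>r\<bar> * weyl_matrix k j r 0 * exp (\<i> * of_real (x * r)))"

lemma integrable_weyl_ramp:
  "integrable lborel (\<lambda>r. 1 / 2 * of_real \<bar>r\<bar> * weyl_matrix k j r 0 * exp (\<i> * of_real (x * r)))"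
proof -
  have "rapid (\<lambda>r. of_real \<bar>r\<bar> * weyl_matrix k j r 0)" by (intro rapid_abs_mult rapid_weyl_matrix_axis)
  then have "rapid (\<lambda>r. 1 / 2 * of_real \<bar>r\<bar> * weyl_matrix k j r 0 * exp (\<i> * of_real (x * r)))"
    by (rule rapid_dominated) (simp add: norm_mult)
  then show ?thesis by (rule rapid_integrable) simp
qed

lemma integrable_weyl_hilbert:
  "integrable lborel (\<lambda>r. - \<i> / 2 * of_real (sgn r) * weyl_matrix k j r 0 * exp (\<i> * of_real (1 * x * r)))"
proof -
  have "rapid (\<lambda>r. of_real (sgn r) * weyl_matrix k j r 0)" by (intro rapid_sgn_mult rapid_weyl_matrix_axis)
  then have "rapid (\<lambda>r. - \<i> / 2 * of_real (sgn r) * weyl_matrix k j r 0 * exp (\<i> * of_real (1 * x * r)))"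
    by (rule rapid_dominated) (simp add: norm_mult)
  then show ?thesis by (rule rapid_integrable) simp
qed

lemma weyl_hilbert_derivative:
  "(weyl_hilbert k j has_vector_derivative weyl_ramp k j x) (at x)"
proof -
  let ?a = "\<lambda>r. - \<i> / 2 * of_real (sgn r) * weyl_matrix k j r 0"
  have r: "rapid ?a"
    by (rule rapid_dominated[OF rapid_sgn_mult[OF rapid_weyl_matrix_axis[of k j]]]) (simp add: norm_mult)
  have "((\<lambda>t. LBINT r. ?a r * exp (\<i> * of_real (1 * t * r))) has_vector_derivative
    (LBINT r. \<i> * of_real 1 * of_real r * ?a r * exp (\<i> * of_real (1 * x * r)))) (at x)"
  proof (rule fourier_has_vector_derivative)
    show "integrable lborel ?a" using r by (rule rapid_integrable) simp
    have "rapid (\<lambda>r. of_real r * ?a r)"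
      by (rule rapid_dominated[OF rapid_abs_mult[OF r]]) (simp add: norm_mult)
    then show "integrable lborel (\<lambda>r. of_real r * ?a r)" by (rule rapid_integrable) simp
  qed
  also have "(LBINT r. \<i> * of_real 1 * of_real r * ?a r * exp (\<i> * of_real (1 * x * r))) = weyl_ramp k j x"
    unfolding weyl_ramp_def
  proof (intro Bochner_Integration.integral_cong refl)
    fix r
    have "complex_of_real \<bar>r\<bar> = of_real (sgn r) * of_real r" by (auto simp: sgn_real_def)
    then show "\<i> * of_real 1 * of_real r * ?a r * exp (\<i> * of_real (1 * x * r)) =
        1 / 2 * of_real \<bar>r\<bar> * weyl_matrix k j r 0 * exp (\<i> * of_real (x * r))"
      by (simp add: algebra_simps)
  qed
  finally show ?thesis unfolding weyl_hilbert_def[abs_def] .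
qed

text \<open>On the axis \<open>weyl_arg r 0\<close> is a multiple of \<open>r\<close>, and
  \<open>sgn r * r = \<bar>r\<bar>\<close>. The ladder relation under the integral therefore
  produces the derivative of the Hilbert transform, the form in which products of Hermite and
  irregular functions satisfy it too.\<close>

lemma weyl_hilbert_raise:
  "of_real (sqrt (real (Suc j))) * weyl_hilbert k (Suc j) x =
   of_real (sqrt (real k)) * weyl_hilbert (k - 1) j x - weyl_ramp k j x / of_real (sqrt 2)"
proof -
  let ?h = "\<lambda>k j r. - \<i> / 2 * of_real (sgn r) * weyl_matrix k j r 0 * exp (\<i> * of_real (1 * x * r))"
  let ?f = "\<lambda>r. 1 / 2 * of_real \<bar>r\<bar> * weyl_matrix k j r 0 * exp (\<i> * of_real (x * r))"
  have "of_real (sqrt (real (Suc j))) * ?h k (Suc j) r = of_real (sqrt (real k)) * ?h (k - 1) j r - ?f r / of_real (sqrt 2)" for r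
  proof -
    have "of_real (sqrt (real (Suc j))) * ?h k (Suc j) r =
       - \<i> / 2 * of_real (sgn r) * (of_real (sqrt (real (Suc j))) * weyl_matrix k (Suc j) r 0) * exp (\<i> * of_real (1 * x * r))"
      by (simp only: mult_ac)
    also have "\<dots> = of_real (sqrt (real k)) * ?h (k - 1) j r +
        (- \<i> / 2 * of_real (sgn r) * weyl_arg r 0) * weyl_matrix k j r 0 * exp (\<i> * of_real (1 * x * r))"
      unfolding weyl_matrix_raise by (simp only: distrib_left distrib_right mult_ac) (simp add: mult_ac)
    also have "- \<i> / 2 * of_real (sgn r) * weyl_arg r 0 = - (1 / 2 * of_real \<bar>r\<bar>) / of_real (sqrt 2)"
      by (auto simp: weyl_arg_def sgn_real_def)
    finally show ?thesis by simp
  qed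
  then show ?thesis
    unfolding weyl_hilbert_def weyl_ramp_def integral_mult_right_zero[symmetric] integral_divide_zero[symmetric]
    by (simp only: Bochner_Integration.integral_diff[OF integrable_mult_right[OF integrable_weyl_hilbert] integrable_divide[OF integrable_weyl_ramp]])
qed

lemma weyl_ramp_commute: "weyl_ramp k j x = weyl_ramp j k x"
  unfolding weyl_ramp_def weyl_matrix_commute[of k j] ..

text \<open>The differential equation of Dawson's function. The derivative of the Gaussian supplies
  the ramp, that of the exponential the factor \<open>x\<close>, and the jump of \<open>sgn\<close>
  at the origin the inhomogeneous term 2.\<close>

lemma weyl_hilbert_0_0_ramp: "weyl_ramp 0 0 x = 2 - 2 * of_real x * weyl_hilbert 0 0 x"
proof -
  let ?e = "\<lambda>r. exp (\<i> * of_real (1 * x * r))"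
  let ?m = "\<lambda>r. weyl_matrix 0 0 r 0"
  let ?G' = "\<lambda>r. - (1 / 2) * (of_real r * (?m r * ?e r)) + \<i> * of_real x * (?m r * ?e r)"
  have rm: "rapid (\<lambda>r. ?m r * ?e r)"
    by (rule rapid_dominated[OF rapid_weyl_matrix_axis[of 0 0]]) (simp add: norm_mult)
  have rr: "rapid (\<lambda>r. of_real r * (?m r * ?e r))"
    by (rule rapid_dominated[OF rapid_abs_mult[OF rm]]) (simp add: norm_mult)
  have "(LBINT r. of_real (sgn r) * ?G' r) = - 2 * (?m 0 * ?e 0)"
  proof (rule integral_sgn_derivative[where F = "\<lambda>r. ?m r * ?e r"])
    fix r
    have "((\<lambda>u. exp (- ((u\<^sup>2 + 0\<^sup>2) / 4))) has_real_derivative - (1 / 2) * r * exp (- ((r\<^sup>2 + 0\<^sup>2) / 4))) (at r)"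
      by (auto intro!: derivative_eq_intros)
    then have "((\<lambda>u. complex_of_real (exp (- ((u\<^sup>2 + 0\<^sup>2) / 4)))) has_vector_derivative
            of_real (- (1 / 2) * r * exp (- ((r\<^sup>2 + 0\<^sup>2) / 4)))) (at r)"
      by (rule has_vector_derivative_of_real)
    then have m: "(?m has_vector_derivative - (1 / 2) * of_real r * ?m r) (at r)"
      unfolding weyl_matrix_0_0 by simp
    have "((\<lambda>z. exp (\<i> * of_real x * z)) has_field_derivative \<i> * of_real x * exp (\<i> * of_real x * of_real r)) (at (of_real r))"
      by (auto intro!: derivative_eq_intros)
    from field_vector_diff_chain_at[OF has_vector_derivative_of_real[OF DERIV_ident] this]
    have e: "(?e has_vector_derivative \<i> * of_real x * ?e r) (at r)"
      by (simp add: o_def mult.assoc)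
    show "((\<lambda>r. ?m r * ?e r) has_vector_derivative ?G' r) (at r)"
      by (rule has_vector_derivative_eq_rhs[OF has_vector_derivative_mult[OF m e]]) (simp add: algebra_simps)
  next
    show "continuous_on UNIV ?G'" by (intro continuous_intros)
    show "rapid ?G'" by (intro rapid_add rapid_cmult rr rm)
  qed (rule rm)
  also have "(LBINT r. of_real (sgn r) * ?G' r) =
     (LBINT r. - (1 / 2 * of_real \<bar>r\<bar> * ?m r * exp (\<i> * of_real (x * r)))
        - 2 * of_real x * (- \<i> / 2 * of_real (sgn r) * ?m r * ?e r))"
  proof (intro Bochner_Integration.integral_cong refl)
    fix r
    have "complex_of_real \<bar>r\<bar> = of_real (sgn r) * of_real r" by (auto simp: sgn_real_def)
    then show "of_real (sgn r) * ?G' r = - (1 / 2 * of_real \<bar>r\<bar> * ?m r * exp (\<i> * of_real (x * r)))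
        - 2 * of_real x * (- \<i> / 2 * of_real (sgn r) * ?m r * ?e r)"
      by (simp add: algebra_simps)
  qed
  also have "\<dots> = - weyl_ramp 0 0 x - 2 * of_real x * weyl_hilbert 0 0 x"
    unfolding weyl_ramp_def weyl_hilbert_def
    by (simp only: Bochner_Integration.integral_diff[OF integrable_minus[OF integrable_weyl_ramp] integrable_mult_right[OF integrable_weyl_hilbert]]
      Bochner_Integration.integral_minus integral_mult_right_zero)
  finally have "- weyl_ramp 0 0 x - 2 * of_real x * weyl_hilbert 0 0 x = - 2"
    by (simp add: weyl_matrix_0)
  then show ?thesis by (simp add: algebra_simps)
qed

lemma integral_reflect_real:
  fixes f :: "real \<Rightarrow> 'b::{banach, second_countable_topology}"
  shows "(LBINT x. f (- x)) = (LBINT x. f x)"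
  using lborel_integral_real_affine[of "-1" f 0] by simp

lemma cnj_weyl_hilbert: "cnj (weyl_hilbert k j x) = weyl_hilbert k j x"
proof -
  let ?h = "\<lambda>r. - \<i> / 2 * of_real (sgn r) * weyl_matrix k j r 0 * exp (\<i> * of_real (1 * x * r))"
  have "cnj (weyl_hilbert k j x) = (LBINT r. cnj (?h r))"
    unfolding weyl_hilbert_def by (rule cnj_integral)
  also have "\<dots> = (LBINT r. ?h (- r))"
    by (intro Bochner_Integration.integral_cong) (auto simp: cnj_weyl_matrix exp_cnj sgn_minus)
  also have "\<dots> = weyl_hilbert k j x"
    unfolding weyl_hilbert_def by (rule integral_reflect_real[of ?h])
  finally show ?thesis .
qed

lemma weyl_hilbert_0_0_minus: "weyl_hilbert 0 0 (- x) = - weyl_hilbert 0 0 x"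
proof -
  let ?h = "\<lambda>x r. - \<i> / 2 * of_real (sgn r) * weyl_matrix 0 0 r 0 * exp (\<i> * of_real (1 * x * r))"
  have "weyl_hilbert 0 0 (- x) = (LBINT r. ?h (- x) (- r))"
    unfolding weyl_hilbert_def by (rule integral_reflect_real[of "?h (- x)", symmetric])
  also have "\<dots> = (LBINT r. - ?h x r)"
    by (intro Bochner_Integration.integral_cong) (auto simp: weyl_matrix_minus sgn_minus)
  finally show ?thesis by (simp add: weyl_hilbert_def)
qed

text \<open>Dawson's function up to a factor, see \<open>dawson_derivative\<close>.\<close>

definition dawson :: "real \<Rightarrow> real" where
  "dawson x = Re (weyl_hilbert 0 0 x)"

lemma weyl_hilbert_0_0: "weyl_hilbert 0 0 x = of_real (dawson x)"
  using cnj_weyl_hilbert[of 0 0 x] by (auto simp: dawson_def complex_eq_iff)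

lemma dawson_derivative: "(dawson has_real_derivative 2 - 2 * x * dawson x) (at x)"
proof -
  have "(dawson has_real_derivative Re (weyl_ramp 0 0 x)) (at x)"
    unfolding has_real_derivative_iff_has_vector_derivative dawson_def[abs_def]
    using bounded_linear.has_vector_derivative[OF bounded_linear_Re weyl_hilbert_derivative] .
  then show ?thesis unfolding weyl_hilbert_0_0_ramp weyl_hilbert_0_0 by simp
qed

lemma dawson_minus: "dawson (- x) = - dawson x"
  by (simp add: dawson_def weyl_hilbert_0_0_minus)

text \<open>The recurrence of the Hermite functions, started from Dawson's function. Lowering index
  0 gives \<open>2 / hermite_fun 0 x\<close> rather than 0, by the Wronskian condition, which
  explains the additional term in the second equation.\<close>

fun irregular :: "nat \<Rightarrow> real \<Rightarrow> real" where
  "irregular 0 x = dawson x / hermite_fun 0 x"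
| "irregular (Suc 0) x = (2 * x * irregular 0 x - 2 / hermite_fun 0 x) / sqrt 2"
| "irregular (Suc (Suc j)) x =
     (2 * x * irregular (Suc j) x - sqrt 2 * sqrt (real (Suc j)) * irregular j x) / (sqrt 2 * sqrt (real (Suc (Suc j))))"

text \<open>The raising form is taken as the definition; that it agrees with the lowering form and
  is the derivative is proved below.\<close>

definition irregular' :: "nat \<Rightarrow> real \<Rightarrow> real" where
  "irregular' j x = x * irregular j x - sqrt 2 * sqrt (real (Suc j)) * irregular (Suc j) x"

lemma irregular'_0: "irregular' 0 x = 2 / hermite_fun 0 x - x * irregular 0 x"
  by (simp add: irregular'_def del: irregular.simps(1))

lemma irregular'_Suc: "irregular' (Suc j) x = sqrt 2 * sqrt (real (Suc j)) * irregular j x - x * irregular (Suc j) x"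
proof -
  have "sqrt 2 * sqrt (real (Suc (Suc j))) \<noteq> 0" by simp
  then have "sqrt 2 * sqrt (real (Suc (Suc j))) * irregular (Suc (Suc j)) x =
     2 * x * irregular (Suc j) x - sqrt 2 * sqrt (real (Suc j)) * irregular j x"
    unfolding irregular.simps(3) by (simp del: of_nat_Suc)
  then show ?thesis unfolding irregular'_def by simp
qed

lemma hermite_fun_0_pos: "hermite_fun 0 x > 0"
  by (simp add: hermite_fun_altdef hermite_norm2_pos)

lemma has_real_derivative_irregular:
  "(irregular j has_real_derivative irregular' j x) (at x)"
proof -
  have "(\<forall>x. (irregular j has_real_derivative irregular' j x) (at x)) \<and>
        (\<forall>x. (irregular (Suc j) has_real_derivative irregular' (Suc j) x) (at x))"
  proof (induction j)
    case 0
    have h0: "hermite_fun' 0 x = - x * hermite_fun 0 x" for x by (simp add: hermite_fun'_def)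
    have nz: "hermite_fun 0 x \<noteq> 0" for x using hermite_fun_0_pos[of x] by simp
    have 1: "(irregular 0 has_real_derivative irregular' 0 x) (at x)" for x
    proof -
      have "((\<lambda>x. dawson x / hermite_fun 0 x) has_real_derivative
        ((2 - 2 * x * dawson x) * hermite_fun 0 x - dawson x * hermite_fun' 0 x) / (hermite_fun 0 x * hermite_fun 0 x)) (at x)"
        by (intro DERIV_divide dawson_derivative has_real_derivative_hermite_fun nz)
      moreover have "((2 - 2 * x * dawson x) * hermite_fun 0 x - dawson x * hermite_fun' 0 x) / (hermite_fun 0 x * hermite_fun 0 x)
          = irregular' 0 x"
        unfolding irregular'_0 h0 using nz[of x] by (simp add: field_simps)
      ultimately show ?thesis by (simp add: irregular.simps(1)[abs_def])
    qed
    have 2: "(irregular (Suc 0) has_real_derivative irregular' (Suc 0) x) (at x)" for x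
    proof -
      have "((\<lambda>x. (2 * x * irregular 0 x - 2 / hermite_fun 0 x) / sqrt 2) has_real_derivative
        ((2 * irregular 0 x + irregular' 0 x * (2 * x)) - (0 * hermite_fun 0 x - 2 * hermite_fun' 0 x) / (hermite_fun 0 x * hermite_fun 0 x)) / sqrt 2) (at x)"
        by (intro DERIV_cdivide DERIV_diff DERIV_mult DERIV_divide 1 has_real_derivative_hermite_fun nz DERIV_const DERIV_cmult_Id)
      moreover have "((2 * irregular 0 x + irregular' 0 x * (2 * x)) - (0 * hermite_fun 0 x - 2 * hermite_fun' 0 x) / (hermite_fun 0 x * hermite_fun 0 x))
          = 2 * irregular 0 x - x * (2 * x * irregular 0 x - 2 / hermite_fun 0 x)"
        unfolding irregular'_0 h0 using nz[of x] by (simp add: field_simps del: irregular.simps)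
      moreover have "(2 * irregular 0 x - x * (2 * x * irregular 0 x - 2 / hermite_fun 0 x)) / sqrt 2 = irregular' (Suc 0) x"
      proof -
        have "(2 * y - x * z) / sqrt 2 = sqrt 2 * sqrt (real (Suc 0)) * y - x * (z / sqrt 2)" for y z :: real
        proof -
          have "2 * y / sqrt 2 = 2 / sqrt 2 * y" by simp
          also have "2 / sqrt 2 = sqrt (2::real)" by (rule real_div_sqrt) simp
          finally show ?thesis by (simp add: diff_divide_distrib)
        qed
        then show ?thesis unfolding irregular'_Suc irregular.simps(2) .
      qed
      ultimately show ?thesis by (simp only: irregular.simps(2)[abs_def])
    qed
    show ?case using 1 2 by blast
  next
    case (Suc j)
    have "(irregular (Suc (Suc j)) has_real_derivative irregular' (Suc (Suc j)) x) (at x)" for x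
    proof -
      let ?p = "sqrt 2 * sqrt (real (Suc j))" and ?q = "sqrt 2 * sqrt (real (Suc (Suc j)))"
      have q: "?q \<noteq> 0" by simp
      have pp: "?p * ?p = 2 * real (Suc j)" and qq: "?q * ?q = 2 * real (Suc (Suc j))"
        by (simp_all add: real_sqrt_mult[symmetric])
      have rec: "?q * irregular (Suc (Suc j)) x = 2 * x * irregular (Suc j) x - ?p * irregular j x"
        using q unfolding irregular.simps(3) by (simp del: of_nat_Suc)
      have "((\<lambda>x. (2 * x * irregular (Suc j) x - ?p * irregular j x) / ?q) has_real_derivative
         ((2 * irregular (Suc j) x + irregular' (Suc j) x * (2 * x)) - ?p * irregular' j x) / ?q) (at x)"
        using Suc.IH by (intro DERIV_cdivide DERIV_diff DERIV_mult DERIV_cmult DERIV_cmult_Id) auto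
      moreover have "((2 * irregular (Suc j) x + irregular' (Suc j) x * (2 * x)) - ?p * irregular' j x) / ?q = irregular' (Suc (Suc j)) x"
      proof -
        have "?p * irregular' j x = ?p * x * irregular j x - 2 * real (Suc j) * irregular (Suc j) x"
          unfolding irregular'_def pp[symmetric] by (simp only: right_diff_distrib mult_ac)
        then have "(2 * irregular (Suc j) x + irregular' (Suc j) x * (2 * x)) - ?p * irregular' j x =
           ?q * ?q * irregular (Suc j) x - x * (2 * x * irregular (Suc j) x - ?p * irregular j x)"
          unfolding qq irregular'_Suc by (simp add: algebra_simps)
        also have "\<dots> = ?q * (?q * irregular (Suc j) x - x * irregular (Suc (Suc j)) x)"
          unfolding rec[symmetric] by (simp only: right_diff_distrib mult_ac)
        finally show ?thesis unfolding irregular'_Suc using q by (simp del: of_nat_Suc irregular.simps)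
      qed
      ultimately show ?thesis by (simp only: irregular.simps(3)[abs_def])
    qed
    with Suc show ?case by blast
  qed
  then show ?thesis by blast
qed

lemma has_real_derivative_irregular':
  "(irregular' j has_real_derivative (x\<^sup>2 - (2 * real j + 1)) * irregular j x) (at x)"
proof -
  let ?p = "sqrt 2 * sqrt (real (Suc j))"
  have pp: "?p * ?p = 2 * real (Suc j)" by (simp add: real_sqrt_mult[symmetric])
  have "((\<lambda>x. x * irregular j x - ?p * irregular (Suc j) x) has_real_derivative
      (1 * irregular j x + irregular' j x * x) - ?p * irregular' (Suc j) x) (at x)"
    by (intro DERIV_diff DERIV_mult DERIV_cmult DERIV_ident has_real_derivative_irregular)
  moreover have "(1 * irregular j x + irregular' j x * x) - ?p * irregular' (Suc j) x = (x\<^sup>2 - (2 * real j + 1)) * irregular j x"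
  proof -
    have "x * irregular j x - irregular' j x = ?p * irregular (Suc j) x"
      unfolding irregular'_def by simp
    then have "?p * irregular' (Suc j) x = ?p * ?p * irregular j x - x * (x * irregular j x - irregular' j x)"
      unfolding irregular'_Suc by (simp only: right_diff_distrib mult_ac)
    then show ?thesis unfolding pp by (simp add: algebra_simps power2_eq_square)
  qed
  ultimately show ?thesis by (simp only: irregular'_def[abs_def])
qed

text \<open>Inserting the lowering forms at \<open>Suc j\<close> or the raising forms at
  \<open>j\<close> yields the same multiple of the discrete Wronskian of neighbouring indices, so
  the Wronskian does not depend on \<open>j\<close>.\<close>

lemma irregular_wronskian: "hermite_fun j x * irregular' j x - hermite_fun' j x * irregular j x = 2"
proof (induction j)
  case 0
  show ?case using hermite_fun_0_pos[of x] by (simp add: irregular'_0 hermite_fun'_def field_simps del: irregular.simps)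
next
  case (Suc j)
  have "hermite_fun (Suc j) x * irregular' (Suc j) x - hermite_fun' (Suc j) x * irregular (Suc j) x =
     sqrt 2 * sqrt (real (Suc j)) * (hermite_fun (Suc j) x * irregular j x - hermite_fun j x * irregular (Suc j) x)"
    unfolding irregular'_Suc hermite_fun'_def by (simp add: algebra_simps)
  also have "\<dots> = hermite_fun j x * irregular' j x - hermite_fun' j x * irregular j x"
    unfolding irregular'_def hermite_fun'_altdef by (simp add: algebra_simps)
  finally show ?case unfolding Suc.IH .
qed

lemma irregular_minus: "irregular j (- x) = (- 1) ^ Suc j * irregular j x"
proof -
  have "irregular j (- x) = (- 1) ^ Suc j * irregular j x \<and> irregular (Suc j) (- x) = (- 1) ^ Suc (Suc j) * irregular (Suc j) x"
  proof (induction j)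
    case 0
    have "irregular 0 (- x) = - irregular 0 x" by (simp add: dawson_minus hermite_fun_minus)
    then show ?case by (simp add: hermite_fun_minus del: irregular.simps(1))
  next
    case (Suc j)
    then show ?case by (simp add: algebra_simps minus_divide_left[symmetric] add_divide_distrib diff_divide_distrib del: of_nat_Suc)
  qed
  then show ?thesis by blast
qed

text \<open>If the function were bounded, the decay of the Hermite function and its derivative would
  force its own derivative to be at least 1 in modulus far out, by the Wronskian identity. The mean
  value theorem then contradicts boundedness.\<close>

lemma irregular_unbounded: "\<not> bounded (range (irregular j))"
proof
  assume "bounded (range (irregular j))"
  then obtain B where B: "\<And>x. \<bar>irregular j x\<bar> \<le> B" by (auto simp: bounded_iff)
  have "rapid (hermite_fun' j)"
    unfolding hermite_fun'_def[abs_def] by (intro rapid_diff rapid_cmult rapid_ident_mult hermite_fun_rapid)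
  then have "(hermite_fun' j \<longlongrightarrow> 0) at_top"
    using rapid_tendsto_0 tendsto_mono[OF at_top_le_at_infinity] by blast
  moreover have "(hermite_fun j \<longlongrightarrow> 0) at_top"
    using rapid_tendsto_0[OF hermite_fun_rapid] tendsto_mono[OF at_top_le_at_infinity] by blast
  ultimately have "\<forall>\<^sub>F x in at_top. \<bar>hermite_fun' j x\<bar> < 1 / (\<bar>B\<bar> + 1) \<and> \<bar>hermite_fun j x\<bar> < 1"
    by (intro eventually_conj) (auto simp: tendsto_iff dist_real_def)
  then obtain x0 where x0: "\<And>x. x \<ge> x0 \<Longrightarrow> \<bar>hermite_fun' j x\<bar> < 1 / (\<bar>B\<bar> + 1)" "\<And>x. x \<ge> x0 \<Longrightarrow> \<bar>hermite_fun j x\<bar> < 1"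
    unfolding eventually_at_top_linorder by blast
  have d: "\<bar>irregular' j x\<bar> \<ge> 1" if "x \<ge> x0" for x
  proof -
    have "\<bar>hermite_fun' j x * irregular j x\<bar> \<le> 1 / (\<bar>B\<bar> + 1) * (\<bar>B\<bar> + 1)"
      unfolding abs_mult using x0(1)[OF that] B[of x] by (intro mult_mono) auto
    also have "1 / (\<bar>B\<bar> + 1) * (\<bar>B\<bar> + 1) = 1" using abs_ge_zero[of B] by (simp del: abs_ge_zero)
    finally have "\<bar>hermite_fun' j x * irregular j x\<bar> \<le> 1" .
    then have "1 \<le> \<bar>hermite_fun j x * irregular' j x\<bar>" using irregular_wronskian[of j x] by linarith
    also have "\<dots> \<le> 1 * \<bar>irregular' j x\<bar>"
      unfolding abs_mult using x0(2)[OF that] by (intro mult_right_mono) auto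
    finally show ?thesis by simp
  qed
  \<comment> \<open>A length just above the maximal oscillation
    \<open>2 * \<bar>B\<bar>\<close>.\<close>
  define y where "y = x0 + (2 * \<bar>B\<bar> + 1)"
  have "x0 < y" by (simp add: y_def)
  then obtain z where z: "z > x0" "z < y" "irregular j y - irregular j x0 = (y - x0) * irregular' j z"
    using MVT2[of x0 y "irregular j" "irregular' j"] has_real_derivative_irregular by blast
  have "2 * \<bar>B\<bar> + 1 \<le> (2 * \<bar>B\<bar> + 1) * \<bar>irregular' j z\<bar>"
    using d[of z] z(1) mult_left_mono[of 1 "\<bar>irregular' j z\<bar>" "2 * \<bar>B\<bar> + 1"] by simp
  also have "\<dots> = \<bar>irregular j y - irregular j x0\<bar>"
    unfolding z(3) abs_mult by (simp add: y_def)
  also have "\<dots> \<le> \<bar>irregular j y\<bar> + \<bar>irregular j x0\<bar>" by (rule abs_triangle_ineq4)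
  also have "\<dots> \<le> \<bar>B\<bar> + \<bar>B\<bar>" by (intro add_mono order_trans[OF B abs_ge_self])
  finally show False by simp
qed

text \<open>Gronwall's argument for the energy \<open>h^2 + h'^2\<close>: its growth rate is at most
  \<open>1 + Q\<close>, so with the exponential damping it is nonincreasing, and it starts at
  0.\<close>

lemma second_order_ode_zero:
  fixes h h' q :: "real \<Rightarrow> real"
  assumes h: "\<And>x. (h has_real_derivative h' x) (at x)" "\<And>x. (h' has_real_derivative q x * h x) (at x)"
    and q: "\<And>x. 0 \<le> x \<Longrightarrow> x \<le> X \<Longrightarrow> \<bar>q x\<bar> \<le> Q" and i: "h 0 = 0" "h' 0 = 0" and X: "X \<ge> 0"
  shows "h X = 0"
proof -
  let ?E = "\<lambda>x. ((h x)\<^sup>2 + (h' x)\<^sup>2) * exp (- (1 + Q) * x)"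
  have "?E X \<le> ?E 0"
  proof (rule DERIV_nonpos_imp_nonincreasing[OF X])
    fix x assume x: "0 \<le> x" "x \<le> X"
    let ?D = "(2 * h x * h' x + 2 * h' x * (q x * h x) - (1 + Q) * ((h x)\<^sup>2 + (h' x)\<^sup>2)) * exp (- (1 + Q) * x)"
    have "(?E has_real_derivative ?D) (at x)"
      by (auto intro!: derivative_eq_intros h simp: algebra_simps)
    moreover have "?D \<le> 0"
    proof -
      have "2 * h x * h' x + 2 * h' x * (q x * h x) = (1 + q x) * (2 * (h x * h' x))" by (simp add: algebra_simps)
      also have "\<dots> \<le> \<bar>1 + q x\<bar> * \<bar>2 * (h x * h' x)\<bar>" by (metis abs_ge_self abs_mult)
      also have "\<dots> \<le> (1 + Q) * ((h x)\<^sup>2 + (h' x)\<^sup>2)"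
      proof (intro mult_mono)
        show "\<bar>1 + q x\<bar> \<le> 1 + Q" using q[OF x] by linarith
        show "\<bar>2 * (h x * h' x)\<bar> \<le> (h x)\<^sup>2 + (h' x)\<^sup>2"
          using sum_squares_bound[of "\<bar>h x\<bar>" "\<bar>h' x\<bar>"] by (simp add: abs_mult)
        show "0 \<le> 1 + Q" using q[OF x] by linarith
      qed auto
      finally show ?thesis by (intro mult_nonpos_nonneg) auto
    qed
    ultimately show "\<exists>y. DERIV ?E x :> y \<and> y \<le> 0" by blast
  qed
  then have "((h X)\<^sup>2 + (h' X)\<^sup>2) * exp (- (1 + Q) * X) \<le> 0" using i by simp
  then have "(h X)\<^sup>2 + (h' X)\<^sup>2 \<le> 0" by (simp add: mult_le_0_iff not_le[symmetric])
  then show ?thesis by (metis sum_power2_le_zero_iff)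
qed

lemma deriv_hermite_fun: "deriv (hermite_fun j) x = hermite_fun' j x"
  by (rule DERIV_imp_deriv[OF has_real_derivative_hermite_fun])

lemma irregular_solution_irregular: "irregular_solution j (irregular j)"
  unfolding irregular_solution_def
proof (intro conjI exI allI)
  fix x
  show "(irregular j has_real_derivative irregular' j x) (at x)" by (rule has_real_derivative_irregular)
  show "(irregular' j has_real_derivative (x\<^sup>2 - (2 * real j + 1)) * irregular j x) (at x)"
    by (rule has_real_derivative_irregular')
  show "- (1 / 2) * ((x\<^sup>2 - (2 * real j + 1)) * irregular j x) + 1 / 2 * x\<^sup>2 * irregular j x = (real j + 1 / 2) * irregular j x"
    by (simp add: field_simps)
  show "hermite_fun j x * irregular' j x - deriv (hermite_fun j) x * irregular j x = 2"
    unfolding deriv_hermite_fun by (rule irregular_wronskian)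
qed (rule irregular_minus irregular_unbounded)+

text \<open>The difference of two solutions solves the same equation and has the same parity,
  opposite to that of the Hermite function. Parity annihilates one of its initial values at 0, and
  the equality of the Wronskians at 0 the other.\<close>

lemma irregular_solution_unique:
  assumes "irregular_solution j g" shows "g = irregular j"
proof -
  obtain g' g'' where g: "\<And>x. (g has_real_derivative g' x) (at x)" "\<And>x. (g' has_real_derivative g'' x) (at x)"
    "\<And>x. - (1 / 2) * g'' x + 1 / 2 * x\<^sup>2 * g x = (real j + 1 / 2) * g x"
    "\<And>x. hermite_fun j x * g' x - hermite_fun' j x * g x = 2" and par: "\<And>x. g (- x) = (- 1) ^ Suc j * g x"
    using assms unfolding irregular_solution_def deriv_hermite_fun by blast
  define h where "h = (\<lambda>x. g x - irregular j x)"
  define h' where "h' = (\<lambda>x. g' x - irregular' j x)"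
  have g'': "g'' x = (x\<^sup>2 - (2 * real j + 1)) * g x" for x
    using g(3)[of x] by (simp add: field_simps)
  have dh: "(h has_real_derivative h' x) (at x)" for x
    unfolding h_def h'_def by (intro DERIV_diff g has_real_derivative_irregular)
  have dh': "(h' has_real_derivative (x\<^sup>2 - (2 * real j + 1)) * h x) (at x)" for x
    unfolding h_def h'_def right_diff_distrib g''[symmetric]
    by (intro DERIV_diff g has_real_derivative_irregular')
  have hp: "h (- x) = (- 1) ^ Suc j * h x" for x
    unfolding h_def par irregular_minus by (simp add: algebra_simps)
  have w: "hermite_fun j 0 * h' 0 = hermite_fun' j 0 * h 0"
    using g(4)[of 0] irregular_wronskian[of j 0] by (simp add: h_def h'_def algebra_simps)
  have w0: "hermite_fun j 0 * irregular' j 0 - hermite_fun' j 0 * irregular j 0 = 2" by (rule irregular_wronskian)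
  have "h 0 = 0 \<and> h' 0 = 0"
  proof (cases "even j")
    case True
    have h0: "h 0 = 0" using hp[of 0] True by simp
    have "hermite_fun' j 0 = 0"
    proof (cases j)
      case (Suc i)
      then have "hermite_fun i 0 = 0" using hermite_fun_minus[of i 0] True by simp
      then show ?thesis by (simp add: hermite_fun'_def Suc)
    qed (simp add: hermite_fun'_def)
    then have "hermite_fun j 0 \<noteq> 0" using w0 by auto
    then show ?thesis using w h0 by simp
  next
    case False
    have "hermite_fun j 0 = 0" using hermite_fun_minus[of j 0] False by simp
    then have "hermite_fun' j 0 \<noteq> 0" "hermite_fun' j 0 * h 0 = 0" using w0 w by auto
    then have h0: "h 0 = 0" by simp
    have "((\<lambda>x. h (- x)) has_real_derivative h' (- 0) * (- 1)) (at 0)"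
      by (rule DERIV_chain2[OF dh]) (auto intro!: derivative_eq_intros)
    moreover have "(\<lambda>x. h (- x)) = h"
      unfolding fun_eq_iff hp using False by simp
    ultimately have "(h has_real_derivative h' (- 0) * (- 1)) (at 0)" by (simp only:)
    from DERIV_unique[OF dh[of 0] this] have "h' 0 = - h' 0" by simp
    then show ?thesis using h0 by simp
  qed
  then have h0: "h 0 = 0" "h' 0 = 0" by auto
  have hpos: "h X = 0" if "X \<ge> 0" for X
  proof (rule second_order_ode_zero[OF dh dh' _ h0 that])
    fix x assume "0 \<le> x" "x \<le> X"
    then have "x\<^sup>2 \<le> X\<^sup>2" by (intro power_mono)
    then show "\<bar>x\<^sup>2 - (2 * real j + 1)\<bar> \<le> X\<^sup>2 + (2 * real j + 1)"
      using zero_le_power2[of x] by linarith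
  qed
  have "h x = 0" for x
    using hpos[of x] hpos[of "- x"] hp[of "- x"] by (cases "x \<ge> 0") auto
  then show ?thesis by (auto simp: h_def)
qed

lemma irregular_fun_eq: "irregular_fun j = irregular j"
  unfolding irregular_fun_def
  by (intro the_equality irregular_solution_irregular irregular_solution_unique)

section \<open>Pattern functions as Fourier integrals\<close>

lemma hermite_irregular_derivative:
  "((\<lambda>x. hermite_fun k x * irregular j x) has_real_derivative
    hermite_fun' k x * irregular j x + irregular' j x * hermite_fun k x) (at x)"
  by (intro DERIV_mult has_real_derivative_hermite_fun has_real_derivative_irregular)

lemma weyl_ramp_eqI:
  assumes "\<And>x. weyl_hilbert k j x = of_real (hermite_fun k x * irregular j x)"
  shows "weyl_ramp k j x = of_real (hermite_fun' k x * irregular j x + irregular' j x * hermite_fun k x)"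
proof -
  have "weyl_hilbert k j = (\<lambda>x. of_real (hermite_fun k x * irregular j x))" using assms by auto
  then have "((\<lambda>x. of_real (hermite_fun k x * irregular j x)) has_vector_derivative weyl_ramp k j x) (at x)"
    using weyl_hilbert_derivative[of k j x] by simp
  then show ?thesis
    by (rule vector_derivative_unique_at[OF _ has_vector_derivative_of_real[OF hermite_irregular_derivative]])
qed

text \<open>Both sides obey the raising relation in \<open>j\<close> and agree at index 0. The
  Hilbert transform is symmetric in its indices and the product is not, so the restriction to
  \<open>k \<le> j\<close> has to be maintained along the induction.\<close>

lemma weyl_hilbert_eq:
  assumes "k \<le> j" shows "weyl_hilbert k j x = of_real (hermite_fun k x * irregular j x)"
  using assms
proof (induction j arbitrary: k x)
  case 0
  then show ?case using hermite_fun_0_pos[of x] by (simp add: weyl_hilbert_0_0)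
next
  case (Suc j)
  let ?c = "sqrt (real (Suc j))"
  let ?s = "sqrt 2 :: real"
  have c: "complex_of_real ?c \<noteq> 0" by (simp del: of_nat_Suc)
  have ss: "?s * ?s = 2" by simp
  \<comment> \<open>Entries up to the old diagonal come from raising \<open>j\<close>
    directly.\<close>
  have *: "weyl_hilbert i (Suc j) y = of_real (hermite_fun i y * irregular (Suc j) y)" if i: "i \<le> j" for i y
  proof -
    have "of_real ?c * weyl_hilbert i (Suc j) y =
       of_real (sqrt (real i)) * weyl_hilbert (i - 1) j y - weyl_ramp i j y / of_real ?s"
      by (rule weyl_hilbert_raise)
    also have "\<dots> = of_real (sqrt (real i) * (hermite_fun (i - 1) y * irregular j y) -
        (hermite_fun' i y * irregular j y + irregular' j y * hermite_fun i y) / ?s)"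
      using Suc.IH[of "i - 1"] weyl_ramp_eqI[OF Suc.IH[OF i]] i by simp
    also have "sqrt (real i) * (hermite_fun (i - 1) y * irregular j y) -
        (hermite_fun' i y * irregular j y + irregular' j y * hermite_fun i y) / ?s = ?c * (hermite_fun i y * irregular (Suc j) y)"
    proof -
      have "hermite_fun' i y * irregular j y + irregular' j y * hermite_fun i y =
         ?s * (sqrt (real i) * (hermite_fun (i - 1) y * irregular j y) - ?c * (hermite_fun i y * irregular (Suc j) y))"
        unfolding hermite_fun'_def irregular'_def by (simp add: algebra_simps)
      then show ?thesis by (simp del: of_nat_Suc)
    qed
    finally show ?thesis using c by (simp del: of_nat_Suc)
  qed
  show ?case
  proof (cases "k \<le> j")
    case False
    with Suc.prems have k: "k = Suc j" by simp
    \<comment> \<open>The new diagonal entry has no predecessor with the smaller index first. By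
      symmetry the raising relation is applied with the indices exchanged, and its derivative term
      is the entry \<open>j\<close>, \<open>Suc j\<close> just obtained.\<close>
    have "of_real ?c * weyl_hilbert (Suc j) (Suc j) x =
       of_real ?c * weyl_hilbert j j x - weyl_ramp j (Suc j) x / of_real ?s"
      using weyl_hilbert_raise[of j "Suc j" x] by (simp add: weyl_ramp_commute)
    also have "\<dots> = of_real (?c * (hermite_fun j x * irregular j x) -
        (hermite_fun' j x * irregular (Suc j) x + irregular' (Suc j) x * hermite_fun j x) / ?s)"
      using Suc.IH[of j] weyl_ramp_eqI[OF *[of j]] by (simp del: of_nat_Suc irregular.simps)
    also have "?c * (hermite_fun j x * irregular j x) -
        (hermite_fun' j x * irregular (Suc j) x + irregular' (Suc j) x * hermite_fun j x) / ?s
        = ?c * (hermite_fun (Suc j) x * irregular (Suc j) x)"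
    proof -
      have "hermite_fun' j x * irregular (Suc j) x + irregular' (Suc j) x * hermite_fun j x =
         ?s * (?c * (hermite_fun j x * irregular j x) - ?c * (hermite_fun (Suc j) x * irregular (Suc j) x))"
        unfolding hermite_fun'_altdef irregular'_Suc by (simp add: algebra_simps)
      then show ?thesis by (simp del: of_nat_Suc)
    qed
    finally show ?thesis using c unfolding k by (simp del: of_nat_Suc)
  qed (rule *)
qed

lemma pattern_fun_eq: "of_real (pattern_fun k j x) = weyl_ramp k j x"
proof -
  let ?k = "min k j" and ?j = "max k j"
  have "pattern_fun k j x = hermite_fun' ?k x * irregular ?j x + irregular' ?j x * hermite_fun ?k x"
    unfolding pattern_fun_def irregular_fun_eq by (rule DERIV_imp_deriv[OF hermite_irregular_derivative])
  then have "of_real (pattern_fun k j x) = weyl_ramp ?k ?j x"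
    using weyl_ramp_eqI[OF weyl_hilbert_eq[of ?k ?j]] by simp
  then show ?thesis by (auto simp: min_def max_def weyl_ramp_commute split: if_splits)
qed

lemma borel_measurable_weyl_ramp [measurable]: "weyl_ramp k j \<in> borel_measurable borel"
proof -
  have "(\<lambda>x. LBINT r. 1 / 2 * of_real \<bar>r\<bar> * weyl_matrix k j r 0 * exp (\<i> * of_real (x * r))) \<in> borel_measurable borel"
    by (intro lborel.borel_measurable_lebesgue_integral) measurable
  then show ?thesis unfolding weyl_ramp_def[abs_def] .
qed

lemma borel_measurable_pattern_fun [measurable]: "pattern_fun k j \<in> borel_measurable borel"
proof -
  have "pattern_fun k j = (\<lambda>x. Re (weyl_ramp k j x))" by (simp add: pattern_fun_eq[symmetric])
  then show ?thesis by simp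
qed

text \<open>The Fourier representation gives a bound although the irregular factor is unbounded; it
  is what allows passing to the limit in the series for the density.\<close>

lemma pattern_fun_bounded: "\<exists>B. \<forall>x. \<bar>pattern_fun k j x\<bar> \<le> B"
proof (intro exI allI)
  fix x
  have "\<bar>pattern_fun k j x\<bar> = cmod (weyl_ramp k j x)" by (simp add: pattern_fun_eq[symmetric])
  also have "\<dots> \<le> (LBINT r. cmod (1 / 2 * of_real \<bar>r\<bar> * weyl_matrix k j r 0 * exp (\<i> * of_real (x * r))))"
    unfolding weyl_ramp_def by (rule integral_norm_bound)
  also have "\<dots> = (LBINT r. \<bar>r\<bar> / 2 * cmod (weyl_matrix k j r 0))"
    by (simp add: norm_mult)
  finally show "\<bar>pattern_fun k j x\<bar> \<le> (LBINT r. \<bar>r\<bar> / 2 * cmod (weyl_matrix k j r 0))" .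
qed

text \<open>Parseval's identity for this pair, obtained by Fubini from the ramp integral. It turns
  biorthogonality in \<open>x\<close> into orthogonality in \<open>r\<close> with weight
  \<open>\<bar>r\<bar>\<close>.\<close>

lemma pattern_fun_inner:
  "complex_of_real (LBINT x. pattern_fun k j x * (hermite_fun b x * hermite_fun a x)) =
    1 / 2 * (LBINT r. of_real \<bar>r\<bar> * (weyl_matrix k j r 0 * cnj (weyl_matrix a b r 0)))"
proof -
  let ?p = "\<lambda>x. complex_of_real (hermite_fun b x * hermite_fun a x)"
  let ?q = "\<lambda>r. of_real \<bar>r\<bar> * weyl_matrix k j r 0"
  let ?f = "\<lambda>x r. ?p x * (1 / 2 * ?q r * exp (\<i> * of_real (x * r)))"
  have int: "integrable (lborel \<Otimes>\<^sub>M lborel) (\<lambda>(x, r). ?f x r)"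
  proof (rule Bochner_Integration.integrable_bound)
    have "integrable lborel ?p"
      by (intro rapid_integrable rapid_of_real rapid_mult hermite_fun_rapid) simp
    moreover have "integrable lborel ?q"
      by (intro rapid_integrable rapid_abs_mult rapid_weyl_matrix_axis) simp
    ultimately show "integrable (lborel \<Otimes>\<^sub>M lborel) (\<lambda>(x, r). ?p x * ?q r)"
      by (intro integrable_prod_mult lborel.sigma_finite_measure_axioms)
    show "(\<lambda>(x, r). ?f x r) \<in> borel_measurable (lborel \<Otimes>\<^sub>M lborel)" by measurable
  qed (auto simp: norm_mult intro!: mult_left_mono)
  have "complex_of_real (LBINT x. pattern_fun k j x * (hermite_fun b x * hermite_fun a x)) =
     (LBINT x. ?p x * weyl_ramp k j x)"
    unfolding integral_complex_of_real[symmetric] by (simp add: pattern_fun_eq[symmetric] mult_ac)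
  also have "\<dots> = (LBINT x. LBINT r. ?f x r)"
    unfolding weyl_ramp_def by (intro Bochner_Integration.integral_cong refl, subst integral_mult_right_zero[symmetric]) (simp only: mult_ac)
  also have "\<dots> = (LBINT r. LBINT x. ?f x r)"
    by (rule lborel_pair.Fubini_integral[OF int, symmetric])
  also have "\<dots> = (LBINT r. 1 / 2 * (of_real \<bar>r\<bar> * (weyl_matrix k j r 0 * cnj (weyl_matrix a b r 0))))"
  proof (intro Bochner_Integration.integral_cong refl)
    fix r
    have "(LBINT x. ?f x r) = 1 / 2 * ?q r * (LBINT x. ?p x * exp (\<i> * of_real (x * r)))"
      unfolding integral_mult_right_zero[symmetric] by (simp only: mult_ac)
    also have "(LBINT x. ?p x * exp (\<i> * of_real (x * r))) = cnj (weyl_matrix a b r 0)"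
      unfolding weyl_matrix_def cnj_integral
      by (intro Bochner_Integration.integral_cong) (auto simp: weyl_integrand_def exp_cnj mult_ac)
    finally show "(LBINT x. ?f x r) = 1 / 2 * (of_real \<bar>r\<bar> * (weyl_matrix k j r 0 * cnj (weyl_matrix a b r 0)))"
      by (simp only: mult_ac)
  qed
  finally show ?thesis unfolding integral_mult_right_zero .
qed

lemma pattern_fun_biorthogonal:
  assumes "k + b = j + a"
  shows "(LBINT x. pattern_fun k j x * (hermite_fun b x * hermite_fun a x)) = (if k = a \<and> j = b then 1 else 0)"
proof -
  have "complex_of_real (LBINT x. pattern_fun k j x * (hermite_fun b x * hermite_fun a x)) = of_real (if k = a \<and> j = b then 1 else 0)"
    unfolding pattern_fun_inner weyl_matrix_radial_orthogonal[OF assms] by simp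
  then show ?thesis by (simp only: of_real_eq_iff)
qed

text \<open>The integrand in \<open>r\<close> is odd. This covers the terms whose phase has odd
  frequency and does not integrate to 0 over the half circle.\<close>

lemma pattern_fun_odd:
  assumes "odd (k + j + a + b)"
  shows "(LBINT x. pattern_fun k j x * (hermite_fun b x * hermite_fun a x)) = 0"
proof -
  let ?g = "\<lambda>r. of_real \<bar>r\<bar> * (weyl_matrix k j r 0 * cnj (weyl_matrix a b r 0))"
  have "(LBINT r. ?g r) = (LBINT r. ?g (- r))"
    by (rule integral_reflect_real[of ?g, symmetric])
  also have "\<dots> = (LBINT r. - ?g r)"
  proof (intro Bochner_Integration.integral_cong refl)
    fix r
    have "?g (- r) = ((- 1) ^ (k + j) * (- 1) ^ (a + b)) * ?g r"
      by (simp add: weyl_matrix_minus)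
    also have "(- 1) ^ (k + j) * (- 1) ^ (a + b) = (- 1 :: complex)"
      unfolding power_add[symmetric] using assms by (simp add: add.assoc)
    finally show "?g (- r) = - ?g r" by simp
  qed
  finally have "(LBINT r. ?g r) = 0" by simp
  then have "complex_of_real (LBINT x. pattern_fun k j x * (hermite_fun b x * hermite_fun a x)) = of_real 0"
    unfolding pattern_fun_inner by simp
  then show ?thesis by (simp only: of_real_eq_iff)
qed

subsection \<open>Growth of the pattern functions\<close>

text \<open>On the positive half line the weight is \<open>r\<close> without modulus and the factor
  \<open>1 / 2\<close> disappears; the negative half is the complex conjugate. The set
  \<open>S\<close> is the frequency window.\<close>

definition weyl_half_ramp :: "real set \<Rightarrow> nat \<Rightarrow> nat \<Rightarrow> real \<Rightarrow> complex" where
  "weyl_half_ramp S k j x = (LBINT r. indicator S r *\<^sub>R (of_real r * weyl_matrix k j r 0 * exp (\<i> * of_real (x * r))))"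

lemma integrable_weyl_half_ramp:
  assumes "S \<in> sets borel"
  shows "integrable lborel (\<lambda>r. indicator S r *\<^sub>R (of_real r * weyl_matrix k j r 0 * exp (\<i> * of_real (x * r))))"
proof (rule integrable_mult_indicator)
  have "rapid (\<lambda>r. of_real \<bar>r\<bar> * weyl_matrix k j r 0)" by (intro rapid_abs_mult rapid_weyl_matrix_axis)
  then have "rapid (\<lambda>r. of_real r * weyl_matrix k j r 0 * exp (\<i> * of_real (x * r)))"
    by (rule rapid_dominated) (simp add: norm_mult)
  then show "integrable lborel (\<lambda>r. of_real r * weyl_matrix k j r 0 * exp (\<i> * of_real (x * r)))"
    by (rule rapid_integrable) simp
qed (use assms in simp)

lemma pattern_fun_half: "pattern_fun k j x = Re (weyl_half_ramp {0<..} k j x)"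
proof -
  let ?g = "\<lambda>r. indicator {0<..} r *\<^sub>R (of_real r * weyl_matrix k j r 0 * exp (\<i> * of_real (x * r)))"
  have "cnj (weyl_half_ramp {0<..} k j x) = (LBINT r. cnj (?g r))"
    unfolding weyl_half_ramp_def by (rule cnj_integral)
  also have "\<dots> = (LBINT r. cnj (?g (- r)))"
    by (rule integral_reflect_real[of "\<lambda>r. cnj (?g r)", symmetric])
  finally have c: "cnj (weyl_half_ramp {0<..} k j x) = (LBINT r. cnj (?g (- r)))" .
  have i: "integrable lborel ?g" by (rule integrable_weyl_half_ramp) simp
  have "integrable lborel (\<lambda>r. ?g (0 + - 1 * r))"
    by (rule lborel_integrable_real_affine[OF i]) simp
  then have "integrable lborel (\<lambda>r. ?g (- r))"
    by (simp only: add_0 mult_minus1)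
  then have ic: "integrable lborel (\<lambda>r. cnj (?g (- r)))"
    by (simp only: complex_integrable_cnj)
  have "weyl_half_ramp {0<..} k j x + cnj (weyl_half_ramp {0<..} k j x) = (LBINT r. ?g r + cnj (?g (- r)))"
    unfolding c unfolding weyl_half_ramp_def by (rule Bochner_Integration.integral_add[OF i ic, symmetric])
  also have "\<dots> = (LBINT r. 2 * (1 / 2 * of_real \<bar>r\<bar> * weyl_matrix k j r 0 * exp (\<i> * of_real (x * r))))"
    by (intro Bochner_Integration.integral_cong) (auto simp: indicator_def cnj_weyl_matrix exp_cnj)
  also have "\<dots> = 2 * of_real (pattern_fun k j x)"
    unfolding integral_mult_right_zero pattern_fun_eq weyl_ramp_def ..
  finally have "complex_of_real (2 * Re (weyl_half_ramp {0<..} k j x)) = of_real (2 * pattern_fun k j x)"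
    unfolding complex_add_cnj by simp
  then show ?thesis by (simp only: of_real_eq_iff)
qed

text \<open>The transform of the truncated ramp, that is, the function by which the low part acts as
  a multiplication operator.\<close>

definition ramp_kernel :: "real \<Rightarrow> real \<Rightarrow> complex" where
  "ramp_kernel R s = (LBINT r. indicator {0..R} r *\<^sub>R (of_real r * exp (\<i> * of_real (s * r))))"

lemma integrable_ramp_kernel:
  "integrable lborel (\<lambda>r. indicator {0..R} r *\<^sub>R (of_real r * exp (\<i> * of_real (s * r))) :: complex)"
  by (rule borel_integrable_compact) (auto intro!: continuous_intros)

lemma borel_measurable_ramp_kernel [measurable]: "ramp_kernel R \<in> borel_measurable borel"
  unfolding ramp_kernel_def[abs_def] by (intro lborel.borel_measurable_lebesgue_integral) measurable

text \<open>For \<open>\<bar>R * s\<bar> \<le> 1\<close> the modulus is at most \<open>R^2\<close>;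
  otherwise integration by parts gives \<open>3 * R / \<bar>s\<bar>\<close>. The constant 18 merges
  both into one majorant whose integral is of order \<open>R^3\<close>.\<close>

lemma ramp_kernel_bound:
  assumes R: "R > 0"
  shows "(cmod (ramp_kernel R s))\<^sup>2 \<le> 18 * R ^ 4 * (1 / (1 + (R * s)\<^sup>2))"
proof -
  have den: "1 + (R * s)\<^sup>2 > 0" by (simp add: add_pos_nonneg)
  show ?thesis
  proof (cases "(R * s)\<^sup>2 \<le> 1")
    case True
    have "cmod (ramp_kernel R s) \<le> (LBINT r. cmod (indicator {0..R} r *\<^sub>R (of_real r * exp (\<i> * of_real (s * r)))))"
      unfolding ramp_kernel_def by (rule integral_norm_bound)
    also have "\<dots> \<le> (LBINT r. R * indicator {0..R} r)"
    proof (rule integral_mono)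
      show "integrable lborel (\<lambda>r. cmod (indicator {0..R} r *\<^sub>R (of_real r * exp (\<i> * of_real (s * r)))))"
        by (rule integrable_norm[OF integrable_ramp_kernel])
      show "integrable lborel (\<lambda>r. R * indicator {0..R} r)"
        by (intro integrable_mult_right integrable_real_indicator) (auto simp: emeasure_lborel_Icc_eq)
    qed (auto simp: indicator_def norm_mult)
    also have "\<dots> = R\<^sup>2" using R by (simp add: power2_eq_square)
    finally have "(cmod (ramp_kernel R s))\<^sup>2 \<le> (R\<^sup>2)\<^sup>2" by (intro power_mono) auto
    also have "\<dots> \<le> 18 * R ^ 4 * (1 / 2)" by simp
    also have "\<dots> \<le> 18 * R ^ 4 * (1 / (1 + (R * s)\<^sup>2))"
      using True den by (intro mult_left_mono) (auto simp: field_simps)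
    finally show ?thesis .
  next
    case False
    then have s: "s \<noteq> 0" by auto
    let ?G = "\<lambda>r. of_real r * exp (\<i> * of_real (s * r)) / (\<i> * of_real s) + exp (\<i> * of_real (s * r)) / (of_real s)\<^sup>2"
    have "ramp_kernel R s = ?G R - ?G 0"
      unfolding ramp_kernel_def
    proof (rule integral_FTC_atLeastAtMost)
      fix r
      have "((\<lambda>z. z * exp (\<i> * (of_real s * z)) / (\<i> * of_real s) + exp (\<i> * (of_real s * z)) / (of_real s)\<^sup>2) has_field_derivative
          of_real r * exp (\<i> * (of_real s * of_real r))) (at (of_real r))"
        using s by (auto intro!: derivative_eq_intros simp: field_simps power2_eq_square)
      from field_vector_diff_chain_at[OF has_vector_derivative_of_real[OF DERIV_ident] this]
      have "(?G has_vector_derivative of_real r * exp (\<i> * of_real (s * r))) (at r)"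
        by (simp add: o_def)
      then show "(?G has_vector_derivative of_real r * exp (\<i> * of_real (s * r))) (at r within {0..R})"
        by (rule has_vector_derivative_at_within)
    qed (use R in \<open>auto intro!: continuous_intros\<close>)
    also have "cmod \<dots> \<le> cmod (?G R) + cmod (?G 0)" by (rule norm_triangle_ineq4)
    also have "\<dots> \<le> (R / \<bar>s\<bar> + 1 / s\<^sup>2) + 1 / s\<^sup>2"
      using R by (intro add_mono order_trans[OF norm_triangle_ineq]) (auto simp: norm_mult norm_divide norm_power)
    also have "\<dots> \<le> 3 * R / \<bar>s\<bar>"
    proof -
      have "1 \<le> \<bar>R * s\<bar>" using False abs_square_le_1[of "R * s"] by linarith
      then have "1 \<le> R * \<bar>s\<bar>" using R by (simp add: abs_mult)
      then have "1 / \<bar>s\<bar> \<le> R" using s by (simp add: field_simps)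
      then have "1 / \<bar>s\<bar> * (1 / \<bar>s\<bar>) \<le> R * (1 / \<bar>s\<bar>)" by (rule mult_right_mono) simp
      then have "1 / s\<^sup>2 \<le> R / \<bar>s\<bar>" by (simp add: power2_eq_square)
      then show ?thesis by simp
    qed
    finally have "(cmod (ramp_kernel R s))\<^sup>2 \<le> (3 * R / \<bar>s\<bar>)\<^sup>2" by (intro power_mono) auto
    also have "\<dots> = 9 * R\<^sup>2 / s\<^sup>2" by (simp add: power_divide power_mult_distrib)
    also have "\<dots> \<le> 18 * R ^ 4 * (1 / (1 + (R * s)\<^sup>2))"
    proof -
      have "R\<^sup>2 * 1 \<le> R\<^sup>2 * (R * s)\<^sup>2" using False by (intro mult_left_mono) auto
      then have "9 * R\<^sup>2 * (1 + (R * s)\<^sup>2) \<le> 18 * R ^ 4 * s\<^sup>2"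
        by (simp add: power_mult_distrib algebra_simps power2_eq_square power4_eq_xxxx)
      then show ?thesis using den s by (simp add: field_simps)
    qed
    finally show ?thesis .
  qed
qed

lemma ramp_kernel_dominator:
  assumes R: "R > 0"
  shows "integrable lborel (\<lambda>y. 18 * R ^ 4 * (1 / (1 + (R * (x - y))\<^sup>2)))"
    and "(LBINT y. 18 * R ^ 4 * (1 / (1 + (R * (x - y))\<^sup>2))) = 18 * pi * R ^ 3"
proof -
  have e: "x - y = x + - 1 * y" for y by simp
  have i: "integrable lborel (\<lambda>y. 1 / (1 + (R * y)\<^sup>2))"
    using lborel_integrable_real_affine[OF integrable_inverse_one_plus_square, of R 0] R by simp
  have I: "(LBINT y. 1 / (1 + (R * y)\<^sup>2)) = pi / R"
  proof -
    have div: "I = pi / R" if "pi = R * I" for I using that R by (simp add: field_simps)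
    have "pi = R * (LBINT y. 1 / (1 + (R * y)\<^sup>2))"
      using lborel_integral_real_affine[of R "\<lambda>y. 1 / (1 + y\<^sup>2)" 0] R integral_inverse_one_plus_square by simp
    then show ?thesis by (rule div)
  qed
  show "integrable lborel (\<lambda>y. 18 * R ^ 4 * (1 / (1 + (R * (x - y))\<^sup>2)))"
    using lborel_integrable_real_affine[OF i, of "- 1" x] by (intro integrable_mult_right) simp
  have "(LBINT y. 1 / (1 + (R * (x - y))\<^sup>2)) = pi / R"
    using lborel_integral_real_affine[of "- 1" "\<lambda>y. 1 / (1 + (R * y)\<^sup>2)" x] I by simp
  then show "(LBINT y. 18 * R ^ 4 * (1 / (1 + (R * (x - y))\<^sup>2))) = 18 * pi * R ^ 3"
    unfolding integral_mult_right_zero using R by (simp add: power4_eq_xxxx power3_eq_cube)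
qed

text \<open>For fixed \<open>x\<close> the low parts are the matrix entries, in the Hermite basis,
  of multiplication by \<open>y \<mapsto> ramp_kernel R (x - y)\<close>; Fubini exchanges the
  integrals over position and frequency.\<close>

lemma weyl_half_ramp_convolution:
  "weyl_half_ramp {0..R} k j x = (LBINT y. of_real (hermite_fun j y) * (of_real (hermite_fun k y) * ramp_kernel R (x - y)))"
proof -
  let ?p = "\<lambda>y. complex_of_real (hermite_fun j y * hermite_fun k y)"
  let ?q = "\<lambda>r. indicator {0..R} r *\<^sub>R complex_of_real r"
  let ?f = "\<lambda>y r. ?p y * (?q r * exp (\<i> * of_real ((x - y) * r)))"
  have int: "integrable (lborel \<Otimes>\<^sub>M lborel) (\<lambda>(y, r). ?f y r)"
  proof (rule Bochner_Integration.integrable_bound)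
    have "integrable lborel ?p"
      by (intro rapid_integrable rapid_of_real rapid_mult hermite_fun_rapid) simp
    moreover have "integrable lborel ?q"
      by (rule borel_integrable_compact) (auto intro!: continuous_intros)
    ultimately show "integrable (lborel \<Otimes>\<^sub>M lborel) (\<lambda>(y, r). ?p y * ?q r)"
      by (intro integrable_prod_mult lborel.sigma_finite_measure_axioms)
    show "(\<lambda>(y, r). ?f y r) \<in> borel_measurable (lborel \<Otimes>\<^sub>M lborel)" by measurable
  qed (auto simp: norm_mult)
  have "(LBINT y. of_real (hermite_fun j y) * (of_real (hermite_fun k y) * ramp_kernel R (x - y))) =
     (LBINT y. LBINT r. ?f y r)"
    unfolding ramp_kernel_def
    by (intro Bochner_Integration.integral_cong refl) (simp add: mult.assoc integral_mult_right_zero[symmetric] del: integral_mult_right_zero integral_mult_right)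
  also have "\<dots> = (LBINT r. LBINT y. ?f y r)"
    by (rule lborel_pair.Fubini_integral[OF int, symmetric])
  also have "\<dots> = weyl_half_ramp {0..R} k j x"
    unfolding weyl_half_ramp_def
  proof (intro Bochner_Integration.integral_cong refl)
    fix r
    have "?f y r = ?q r * exp (\<i> * of_real (x * r)) * weyl_integrand k j r 0 y" for y
    proof -
      have "exp (\<i> * of_real ((x - y) * r)) = exp (\<i> * of_real (x * r)) * exp (- \<i> * of_real (r * y))"
        unfolding exp_add[symmetric] by (simp add: algebra_simps)
      then show ?thesis by (simp add: weyl_integrand_def mult_ac)
    qed
    then have "(LBINT y. ?f y r) = ?q r * exp (\<i> * of_real (x * r)) * weyl_matrix k j r 0"
      unfolding weyl_matrix_def by (simp only: integral_mult_right_zero)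
    then show "(LBINT y. ?f y r) = indicator {0..R} r *\<^sub>R (of_real r * weyl_matrix k j r 0 * exp (\<i> * of_real (x * r)))"
      by (simp add: mult_ac)
  qed
  finally show ?thesis ..
qed

text \<open>Bessel's inequality removes the sum over \<open>j\<close> for each \<open>k\<close>. The
  sum over \<open>k\<close> is then taken under the integral, where it costs
  \<open>sqrt (2 * n)\<close> instead of the factor \<open>n\<close> that the individual norms would
  give.\<close>

lemma sum_weyl_half_ramp_low:
  assumes R: "R > 0"
  shows "(\<Sum>k<n. \<Sum>j<n. (cmod (weyl_half_ramp {0..R} k j x))\<^sup>2) \<le> sqrt (2 * real n) * (18 * pi * R ^ 3)"
proof -
  let ?q = "\<lambda>k y. of_real (hermite_fun k y) * ramp_kernel R (x - y)"
  let ?d = "\<lambda>y. 18 * R ^ 4 * (1 / (1 + (R * (x - y))\<^sup>2))"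
  have kb: "cmod (ramp_kernel R y) \<le> sqrt (18 * R ^ 4)" for y
  proof -
    have "(cmod (ramp_kernel R y))\<^sup>2 \<le> 18 * R ^ 4 * (1 / (1 + (R * y)\<^sup>2))" by (rule ramp_kernel_bound[OF R])
    also have "\<dots> \<le> 18 * R ^ 4 * 1" by (intro mult_left_mono) (auto simp: add_pos_nonneg)
    finally show ?thesis by (intro real_le_rsqrt) simp
  qed
  have rq: "rapid (?q k)" for k
    by (rule rapid_bound[OF hermite_fun_rapid[of k], where C = "sqrt (18 * R ^ 4)" and c = 0])
       (use kb in \<open>auto simp: norm_mult mult.commute intro!: mult_left_mono\<close>)
  have mq: "?q k \<in> borel_measurable borel" for k by measurable
  have rs: "rapid (\<lambda>y. (cmod (?q k y))\<^sup>2)" for k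
    unfolding power2_eq_square by (intro rapid_mult rapid_dominated[OF rq[of k]]) auto
  have iq: "integrable lborel (\<lambda>y. (cmod (?q k y))\<^sup>2)" for k by (intro rapid_integrable rs) simp
  have "(\<Sum>k<n. \<Sum>j<n. (cmod (weyl_half_ramp {0..R} k j x))\<^sup>2) \<le> (\<Sum>k<n. LBINT y. (cmod (?q k y))\<^sup>2)"
    unfolding weyl_half_ramp_convolution by (intro sum_mono hermite_bessel rapid_L2 mq rq)
  also have "\<dots> = (LBINT y. (\<Sum>k<n. (cmod (?q k y))\<^sup>2))" by (simp add: iq)
  also have "\<dots> \<le> (LBINT y. sqrt (2 * real n) * ?d y)"
  proof (rule integral_mono)
    show "integrable lborel (\<lambda>y. \<Sum>k<n. (cmod (?q k y))\<^sup>2)" by (intro Bochner_Integration.integrable_sum iq)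
    show "integrable lborel (\<lambda>y. sqrt (2 * real n) * ?d y)" by (intro integrable_mult_right[OF ramp_kernel_dominator(1)[OF R]])
    fix y
    have "(\<Sum>k<n. (cmod (?q k y))\<^sup>2) = (\<Sum>k<n. (hermite_fun k y)\<^sup>2) * (cmod (ramp_kernel R (x - y)))\<^sup>2"
      by (simp add: norm_mult power_mult_distrib sum_distrib_right)
    also have "\<dots> \<le> sqrt (2 * real n) * ?d y"
      by (intro mult_mono sum_hermite_fun_square_le ramp_kernel_bound R) auto
    finally show "(\<Sum>k<n. (cmod (?q k y))\<^sup>2) \<le> sqrt (2 * real n) * ?d y" .
  qed
  also have "\<dots> = sqrt (2 * real n) * (18 * pi * R ^ 3)"
    unfolding integral_mult_right_zero[of _ "sqrt (2 * real n)"] ramp_kernel_dominator(2)[OF R] ..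
  finally show ?thesis .
qed

lemma weyl_half_ramp_high:
  assumes R: "R \<ge> 1" and kj: "k < n" "j < n"
  shows "cmod (weyl_half_ramp {R<..} k j x) \<le> 2 * pi * (8 * (real n + 16)) ^ 8 / R ^ 13"
proof -
  let ?B = "(8 * (real n + 16)) ^ 8"
  have "cmod (weyl_half_ramp {R<..} k j x) \<le> (LBINT r. cmod (indicator {R<..} r *\<^sub>R (of_real r * weyl_matrix k j r 0 * exp (\<i> * of_real (x * r)))))"
    unfolding weyl_half_ramp_def by (rule integral_norm_bound)
  also have "\<dots> \<le> (LBINT r. 2 * ?B / R ^ 13 * (1 / (1 + r\<^sup>2)))"
  proof (rule integral_mono)
    show "integrable lborel (\<lambda>r. cmod (indicator {R<..} r *\<^sub>R (of_real r * weyl_matrix k j r 0 * exp (\<i> * of_real (x * r)))))"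
      by (intro integrable_norm integrable_weyl_half_ramp) simp
    show "integrable lborel (\<lambda>r. 2 * ?B / R ^ 13 * (1 / (1 + r\<^sup>2)))"
      by (rule integrable_mult_right[OF integrable_inverse_one_plus_square])
    fix r
    show "cmod (indicator {R<..} r *\<^sub>R (of_real r * weyl_matrix k j r 0 * exp (\<i> * of_real (x * r)))) \<le> 2 * ?B / R ^ 13 * (1 / (1 + r\<^sup>2))"
    proof (cases "r > R")
      case True
      then have r: "r > 1" "r > 0" using R by auto
      have den: "1 + r\<^sup>2 > 0" by (simp add: add_pos_nonneg)
      let ?m = "cmod (weyl_matrix k j r 0)"
      \<comment> \<open>Of the sixteen powers three control \<open>r * (1 + r^2)\<close>, which
        leaves an integrable factor, and thirteen become \<open>R ^ 13\<close>.\<close>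
      have "\<bar>r\<bar> ^ 16 * ?m \<le> sqrt (8 * (real n + real 16)) ^ 16" by (rule weyl_matrix_decay[OF kj])
      also have "sqrt (8 * (real n + real 16)) ^ 16 = (sqrt (8 * (real n + 16)) ^ 2) ^ 8"
        unfolding power_mult[symmetric] by simp
      also have "sqrt (8 * (real n + 16)) ^ 2 = 8 * (real n + 16)" by simp
      finally have dec: "r ^ 16 * ?m \<le> ?B" using r by simp
      have "r * (1 + r\<^sup>2) * ?m \<le> r * (r\<^sup>2 + r\<^sup>2) * ?m"
        using r one_le_power[of r 2] by (intro mult_right_mono mult_left_mono add_right_mono) auto
      also have "\<dots> = 2 * (r ^ 16 * ?m) / r ^ 13" using r by (simp add: field_simps power2_eq_square eval_nat_numeral)
      also have "\<dots> \<le> 2 * ?B / r ^ 13" using r dec by (intro divide_right_mono) auto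
      also have "\<dots> \<le> 2 * ?B / R ^ 13" using r R True by (intro divide_left_mono power_mono mult_pos_pos) auto
      finally have "r * ?m * (1 + r\<^sup>2) \<le> 2 * ?B / R ^ 13" by (simp only: mult_ac)
      then have "r * ?m \<le> 2 * ?B / R ^ 13 * (1 / (1 + r\<^sup>2))"
        by (simp only: times_divide_eq_right mult_1_right pos_le_divide_eq[OF den])
      then show ?thesis using True r by (simp add: norm_mult)
    qed (use R in \<open>auto intro!: mult_nonneg_nonneg\<close>)
  qed
  also have "\<dots> = 2 * pi * ?B / R ^ 13"
    unfolding integral_mult_right_zero integral_inverse_one_plus_square by simp
  finally show ?thesis .
qed

lemma weyl_half_ramp_split:
  assumes "R > 0"
  shows "weyl_half_ramp {0<..} k j x = weyl_half_ramp {0..R} k j x + weyl_half_ramp {R<..} k j x"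
proof -
  let ?g = "\<lambda>S r. indicator S r *\<^sub>R (of_real r * weyl_matrix k j r 0 * exp (\<i> * of_real (x * r)))"
  have "(LBINT r. ?g {0..R} r) + (LBINT r. ?g {R<..} r) = (LBINT r. ?g {0..R} r + ?g {R<..} r)"
    by (rule Bochner_Integration.integral_add[symmetric]; rule integrable_weyl_half_ramp; simp)
  also have "\<dots> = (LBINT r. ?g {0<..} r)"
    using assms by (intro Bochner_Integration.integral_cong) (auto simp: indicator_def)
  finally show ?thesis unfolding weyl_half_ramp_def ..
qed

lemma sum_pattern_fun_square_bound:
  "\<exists>C. \<forall>n\<ge>1. \<forall>x. (\<Sum>k<n. \<Sum>j<n. (pattern_fun k j x)\<^sup>2) \<le> C * real n powr (7 / 3)"
proof -
  \<comment> \<open>Here \<open>136 = 8 * 17\<close>, since \<open>n + 16 \<le> 17 * n\<close> for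
    \<open>n \<ge> 1\<close>.\<close>
  define C where "C = 2 * (sqrt 2 * (18 * pi)) + 2 * (2 * pi * 136 ^ 8)\<^sup>2"
  have "(\<Sum>k<n. \<Sum>j<n. (pattern_fun k j x)\<^sup>2) \<le> C * real n powr (7 / 3)" if n: "n \<ge> 1" for n x
  proof -
    define R where "R = real n powr (11 / 18)"
    have n1: "real n \<ge> 1" "real n > 0" using n by auto
    have R: "R \<ge> 1" "R > 0" unfolding R_def using n1 by (auto intro: ge_one_powr_ge_zero)
    let ?L = "weyl_half_ramp {0..R}" and ?H = "weyl_half_ramp {R<..}"
    have sq: "(pattern_fun k j x)\<^sup>2 \<le> 2 * (cmod (?L k j x))\<^sup>2 + 2 * (cmod (?H k j x))\<^sup>2" for k j
    proof -
      have "\<bar>pattern_fun k j x\<bar> \<le> cmod (weyl_half_ramp {0<..} k j x)"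
        unfolding pattern_fun_half by (rule abs_Re_le_cmod)
      also have "\<dots> \<le> cmod (?L k j x) + cmod (?H k j x)"
        unfolding weyl_half_ramp_split[OF R(2)] by (rule norm_triangle_ineq)
      finally have "(pattern_fun k j x)\<^sup>2 \<le> (cmod (?L k j x) + cmod (?H k j x))\<^sup>2"
        by (metis abs_ge_zero power2_abs power_mono)
      also have "\<dots> \<le> 2 * (cmod (?L k j x))\<^sup>2 + 2 * (cmod (?H k j x))\<^sup>2"
        using sum_squares_bound[of "cmod (?L k j x)" "cmod (?H k j x)"] by (simp add: power2_sum)
      finally show ?thesis .
    qed
    \<comment> \<open>The power of \<open>n\<close> is \<open>8 - 13 * 11/18 = 1/18\<close>, squared
      \<open>1/9\<close>. The \<open>n^2\<close> entries together give \<open>19/9\<close>, below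
      \<open>7/3\<close>.\<close>
    have high: "(cmod (?H k j x))\<^sup>2 \<le> (2 * pi * 136 ^ 8)\<^sup>2 * real n powr (1 / 9)" if "k < n" "j < n" for k j
    proof -
      have "cmod (?H k j x) \<le> 2 * pi * (8 * (real n + 16)) ^ 8 / R ^ 13"
        by (rule weyl_half_ramp_high[OF R(1) that])
      also have "\<dots> \<le> 2 * pi * (136 * real n) ^ 8 / R ^ 13"
        using n1 R by (intro divide_right_mono mult_left_mono power_mono) auto
      also have "\<dots> = 2 * pi * 136 ^ 8 * (real n powr 8 / real n powr (143 / 18))"
        using n1 by (simp add: R_def power_mult_distrib powr_power powr_numeral)
      also have "real n powr 8 / real n powr (143 / 18) = real n powr (1 / 18)"
        unfolding powr_diff[symmetric] by simp
      finally have "(cmod (?H k j x))\<^sup>2 \<le> (2 * pi * 136 ^ 8 * real n powr (1 / 18))\<^sup>2" by (intro power_mono) auto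
      also have "\<dots> = (2 * pi * 136 ^ 8)\<^sup>2 * real n powr (1 / 9)"
        using n1 by (simp add: power_mult_distrib powr_power)
      finally show ?thesis .
    qed
    have "(\<Sum>k<n. \<Sum>j<n. (pattern_fun k j x)\<^sup>2) \<le> (\<Sum>k<n. \<Sum>j<n. 2 * (cmod (?L k j x))\<^sup>2 + 2 * (cmod (?H k j x))\<^sup>2)"
      by (intro sum_mono sq)
    also have "\<dots> = 2 * (\<Sum>k<n. \<Sum>j<n. (cmod (?L k j x))\<^sup>2) + 2 * (\<Sum>k<n. \<Sum>j<n. (cmod (?H k j x))\<^sup>2)"
      by (simp add: sum.distrib sum_distrib_left)
    also have "\<dots> \<le> 2 * (sqrt (2 * real n) * (18 * pi * R ^ 3)) + 2 * (\<Sum>k<n. \<Sum>j<n. (2 * pi * 136 ^ 8)\<^sup>2 * real n powr (1 / 9))"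
      by (intro add_mono mult_left_mono sum_weyl_half_ramp_low R sum_mono high) auto
    also have "sqrt (2 * real n) * (18 * pi * R ^ 3) = sqrt 2 * (18 * pi) * (real n powr (1 / 2) * real n powr (11 / 6))"
      using n1 by (simp add: R_def powr_power powr_half_sqrt real_sqrt_mult)
    also have "real n powr (1 / 2) * real n powr (11 / 6) = real n powr (7 / 3)"
      using n1 by (simp add: powr_add[symmetric])
    also have "(\<Sum>k<n. \<Sum>j<n. (2 * pi * 136 ^ 8)\<^sup>2 * real n powr (1 / 9)) = (2 * pi * 136 ^ 8)\<^sup>2 * (real n powr 2 * real n powr (1 / 9))"
      using n1 by (simp add: powr_numeral power2_eq_square)
    also have "\<dots> \<le> (2 * pi * 136 ^ 8)\<^sup>2 * real n powr (7 / 3)"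
    proof (rule mult_left_mono)
      have "real n powr 2 * real n powr (1 / 9) = real n powr (19 / 9)"
        unfolding powr_add[symmetric] by simp
      also have "\<dots> \<le> real n powr (7 / 3)" using n1 by (intro powr_mono) auto
      finally show "real n powr 2 * real n powr (1 / 9) \<le> real n powr (7 / 3)" .
    qed simp
    finally show ?thesis by (simp add: C_def algebra_simps)
  qed
  then show ?thesis by blast
qed

subsection \<open>Unbiasedness of the pattern functions\<close>

lemma sigma_finite_phase_space: "sigma_finite_measure (restrict_space lborel {0..pi})"
proof -
  have "finite_measure (restrict_space lborel {0..pi})"
    by (rule finite_measureI) (simp add: emeasure_restrict_space space_restrict_space emeasure_lborel_Icc_eq)
  then show ?thesis by (simp add: finite_measure_def)
qed

lemma measurable_fst_quadrature [measurable]: "fst \<in> quadrature_space \<rightarrow>\<^sub>M borel"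
  unfolding quadrature_space_def
  using measurable_fst[of lborel "restrict_space lborel {0..pi}"] by simp

lemma measurable_snd_quadrature [measurable]: "snd \<in> quadrature_space \<rightarrow>\<^sub>M borel"
proof -
  have "(\<lambda>x. x) \<in> restrict_space lborel {0..pi} \<rightarrow>\<^sub>M borel"
    by (rule measurable_restrict_space1) simp
  then show ?thesis
    unfolding quadrature_space_def by (rule measurable_compose[OF measurable_snd])
qed

lemma integral_prod_mult:
  fixes f g :: "_ \<Rightarrow> 'c::{real_normed_field, banach, second_countable_topology}"
  assumes "sigma_finite_measure M" "sigma_finite_measure N"
    and f: "integrable M f" and g: "integrable N g"
  shows "(\<integral>z. f (fst z) * g (snd z) \<partial>(M \<Otimes>\<^sub>M N)) = (\<integral>x. f x \<partial>M) * (\<integral>y. g y \<partial>N)"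
proof -
  interpret M: sigma_finite_measure M by fact
  interpret N: sigma_finite_measure N by fact
  interpret pair_sigma_finite M N ..
  have "integrable (M \<Otimes>\<^sub>M N) (\<lambda>z. f (fst z) * g (snd z))"
    using integrable_prod_mult[OF assms] by (simp add: case_prod_unfold)
  from integral_fst'[OF this] show ?thesis by simp
qed

text \<open>Evenness of \<open>d\<close> makes the primitive take the same value at 0 and at
  \<open>pi\<close>; over the half circle this fails for odd \<open>d\<close>.\<close>

lemma integral_phase:
  fixes d :: int
  assumes "even d"
  shows "(\<integral>\<phi>. exp (- \<i> * of_int d * complex_of_real \<phi>) \<partial>(restrict_space lborel {0..pi})) = (if d = 0 then of_real pi else 0)"
proof -
  have 1: "(\<integral>\<phi>. exp (- \<i> * of_int d * complex_of_real \<phi>) \<partial>(restrict_space lborel {0..pi})) =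
     (LBINT \<phi>. indicator {0..pi} \<phi> *\<^sub>R exp (- \<i> * of_int d * complex_of_real \<phi>))"
    by (rule integral_restrict_space) simp
  show ?thesis
  proof (cases "d = 0")
    case True
    then show ?thesis unfolding 1 by (simp add: scaleR_conv_of_real integral_complex_of_real)
  next
    case False
    have "(LBINT \<phi>. indicator {0..pi} \<phi> *\<^sub>R exp (- \<i> * of_int d * complex_of_real \<phi>)) =
      exp (- \<i> * of_int d * complex_of_real pi) / (- \<i> * of_int d) - exp (- \<i> * of_int d * complex_of_real 0) / (- \<i> * of_int d)"
    proof (rule integral_FTC_atLeastAtMost)
      fix x
      have "((\<lambda>z. exp (- \<i> * of_int d * z) / (- \<i> * of_int d)) has_field_derivative exp (- \<i> * of_int d * of_real x)) (at (of_real x))"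
        using False by (auto intro!: derivative_eq_intros)
      from field_vector_diff_chain_at[OF has_vector_derivative_of_real[OF DERIV_ident] this]
      have "((\<lambda>x. exp (- \<i> * of_int d * complex_of_real x) / (- \<i> * of_int d)) has_vector_derivative exp (- \<i> * of_int d * complex_of_real x)) (at x)"
        by (simp add: o_def)
      then show "((\<lambda>x. exp (- \<i> * of_int d * complex_of_real x) / (- \<i> * of_int d)) has_vector_derivative exp (- \<i> * of_int d * complex_of_real x)) (at x within {0..pi})"
        by (rule has_vector_derivative_at_within)
    qed (auto intro!: continuous_intros)
    also have "exp (- \<i> * of_int d * complex_of_real pi) = 1"
    proof -
      obtain e where "d = 2 * e" using assms by blast
      then have eq: "- \<i> * of_int d * complex_of_real pi = 2 * of_int (- e) * of_real pi * \<i>" by simp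
      show ?thesis unfolding eq exp_eq_1 by (auto intro!: exI[of _ "- e"])
    qed
    finally show ?thesis unfolding 1 using False by simp
  qed
qed

lemma integrable_phase: "integrable (restrict_space lborel {0..pi}) (\<lambda>\<phi>. exp (- \<i> * of_int d * complex_of_real \<phi>))"
proof -
  interpret finite_measure "restrict_space lborel {0..pi}"
    by (rule finite_measureI) (simp add: emeasure_restrict_space space_restrict_space emeasure_lborel_Icc_eq)
  show ?thesis
    by (rule integrable_const_bound[where B = 1]) (auto intro!: measurable_restrict_space1)
qed

text \<open>The contribution to the density of the coefficient with indices
  \<open>a b\<close>.\<close>

definition quadrature_term :: "nat \<Rightarrow> nat \<Rightarrow> real \<times> real \<Rightarrow> complex" where
  "quadrature_term a b z = 1 / of_real pi * (of_real (hermite_fun b (fst z) * hermite_fun a (fst z)) *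
     exp (- \<i> * (of_nat a - of_nat b) * of_real (snd z)))"

lemma borel_measurable_pattern_kernel [measurable]: "pattern_kernel k j \<in> borel_measurable quadrature_space"
  unfolding pattern_kernel_def case_prod_beta by measurable

lemma borel_measurable_quadrature_term [measurable]: "quadrature_term k j \<in> borel_measurable quadrature_space"
  unfolding quadrature_term_def[abs_def] by measurable

lemma quadrature_product:
  fixes f :: "real \<Rightarrow> real" and d :: int
  assumes "integrable lborel f"
  shows "integrable quadrature_space (\<lambda>z. of_real (f (fst z)) * (1 / of_real pi * exp (- \<i> * of_int d * of_real (snd z))))" (is ?I)
    and "even d \<Longrightarrow> (\<integral>z. of_real (f (fst z)) * (1 / of_real pi * exp (- \<i> * of_int d * of_real (snd z))) \<partial>quadrature_space) =
      (if d = 0 then of_real (LBINT x. f x) else 0)"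
    and "(LBINT x. f x) = 0 \<Longrightarrow> (\<integral>z. of_real (f (fst z)) * (1 / of_real pi * exp (- \<i> * of_int d * of_real (snd z))) \<partial>quadrature_space) = 0"
proof -
  let ?g = "\<lambda>\<phi>. 1 / of_real pi * exp (- \<i> * of_int d * complex_of_real \<phi>)"
  have f: "integrable lborel (\<lambda>x. complex_of_real (f x))" using assms by simp
  have g: "integrable (restrict_space lborel {0..pi}) ?g" by (rule integrable_mult_right[OF integrable_phase])
  note s = lborel.sigma_finite_measure_axioms sigma_finite_phase_space
  show ?I
    using integrable_prod_mult[OF s f g] unfolding quadrature_space_def by (simp add: case_prod_unfold)
  have "(\<integral>z. of_real (f (fst z)) * ?g (snd z) \<partial>quadrature_space) = of_real (LBINT x. f x) *
     (1 / of_real pi * (\<integral>\<phi>. exp (- \<i> * of_int d * complex_of_real \<phi>) \<partial>(restrict_space lborel {0..pi})))"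
    unfolding quadrature_space_def integral_prod_mult[OF s f g] integral_complex_of_real integral_mult_right_zero ..
  note eq = this
  show "(\<integral>z. of_real (f (fst z)) * ?g (snd z) \<partial>quadrature_space) = (if d = 0 then of_real (LBINT x. f x) else 0)"
    if "even d" unfolding eq integral_phase[OF that] by simp
  show "(\<integral>z. of_real (f (fst z)) * ?g (snd z) \<partial>quadrature_space) = 0"
    if "(LBINT x. f x) = 0" unfolding eq that by simp
qed

lemma quadrature_term_altdef:
  "quadrature_term a b z = of_real (hermite_fun b (fst z) * hermite_fun a (fst z)) *
     (1 / of_real pi * exp (- \<i> * of_int (int a - int b) * of_real (snd z)))"
  unfolding quadrature_term_def by simp

lemma integrable_quadrature_term: "integrable quadrature_space (quadrature_term a b)"
  unfolding quadrature_term_altdef[abs_def] by (rule quadrature_product(1)[OF hermite_fun_integrable])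

lemma integral_quadrature_term: "(\<integral>z. quadrature_term a b z \<partial>quadrature_space) = (if a = b then 1 else 0)"
proof (cases "a = b")
  case True
  then show ?thesis
    unfolding quadrature_term_altdef using quadrature_product(2)[OF hermite_fun_integrable, of 0 b a] by (simp add: hermite_fun_orthonormal)
next
  case False
  then show ?thesis
    unfolding quadrature_term_altdef by (subst quadrature_product(3)[OF hermite_fun_integrable]) (auto simp: hermite_fun_orthonormal)
qed

text \<open>The total frequency \<open>?d\<close> of the phases decides. At 0 the integral in
  \<open>x\<close> is evaluated by \<open>pattern_fun_biorthogonal\<close>, at nonzero even values
  the phase integral vanishes, and at odd values the integral in \<open>x\<close> vanishes by
  parity.\<close>

lemma pattern_kernel_biorthogonal:
  "(\<integral>z. pattern_kernel k j z * quadrature_term a b z \<partial>quadrature_space) = (if k = a \<and> j = b then 1 else 0)"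
proof -
  let ?d = "int j - int k + (int a - int b)"
  let ?f = "\<lambda>x. pattern_fun k j x * (hermite_fun b x * hermite_fun a x)"
  obtain B where B: "\<And>x. \<bar>pattern_fun k j x\<bar> \<le> B" using pattern_fun_bounded by blast
  have i: "integrable lborel ?f"
    by (rule Bochner_Integration.integrable_bound[OF integrable_mult_right[OF hermite_fun_integrable[of b a], of B]])
       (use order_trans[OF B abs_ge_self] in \<open>auto simp: abs_mult intro!: mult_right_mono\<close>)
  have "pattern_kernel k j z * quadrature_term a b z =
     of_real (?f (fst z)) * (1 / of_real pi * exp (- \<i> * of_int ?d * of_real (snd z)))" for z
  proof -
    have "exp (- \<i> * of_int ?d * of_real (snd z)) = exp (- \<i> * (of_nat j - of_nat k) * complex_of_real (snd z)) *
       exp (- \<i> * of_int (int a - int b) * complex_of_real (snd z))"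
      unfolding exp_add[symmetric] by (simp add: algebra_simps)
    then show ?thesis unfolding quadrature_term_altdef pattern_kernel_def case_prod_beta by simp
  qed
  then have eq: "(\<integral>z. pattern_kernel k j z * quadrature_term a b z \<partial>quadrature_space) =
     (\<integral>z. of_real (?f (fst z)) * (1 / of_real pi * exp (- \<i> * of_int ?d * of_real (snd z))) \<partial>quadrature_space)"
    by (simp only:)
  show ?thesis
  proof (cases "even ?d")
    case True
    show ?thesis
    proof (cases "?d = 0")
      case d0: True
      then have "k + b = j + a" by linarith
      from pattern_fun_biorthogonal[OF this] show ?thesis
        unfolding eq quadrature_product(2)[OF i True] using d0 by simp
    next
      case False
      then show ?thesis unfolding eq quadrature_product(2)[OF i True] by auto
    qed
  next
    case False
    then have odd: "odd (k + j + a + b)" by presburger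
    then have "\<not> (k = a \<and> j = b)" by auto
    then show ?thesis unfolding eq quadrature_product(3)[OF i pattern_fun_odd[OF odd]] by simp
  qed
qed

text \<open>Convergence in \<open>L\<^sub>1\<close> can be tested against every bounded measurable
  function. The pattern kernels then recover the coefficients, and the constant 1 gives the total
  mass.\<close>

lemma quadrature_density_moment:
  assumes p: "quadrature_density \<rho> p"
    and F[measurable]: "F \<in> borel_measurable quadrature_space" and B: "\<And>z. cmod (F z) \<le> B"
  shows "(\<lambda>m. \<Sum>a<m. \<Sum>b<m. \<rho> a b * (\<integral>z. F z * quadrature_term a b z \<partial>quadrature_space))
    \<longlonglongrightarrow> (\<integral>z. F z * of_real (p z) \<partial>quadrature_space)"
proof -
  let ?P = "\<lambda>m z. \<Sum>a<m. \<Sum>b<m. \<rho> a b * quadrature_term a b z"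
  have ip: "integrable quadrature_space p" using p by (simp add: quadrature_density_def)
  then have [measurable]: "p \<in> borel_measurable quadrature_space" by simp
  have iF: "integrable quadrature_space (\<lambda>z. F z * g z)" if "integrable quadrature_space g" for g :: "_ \<Rightarrow> complex"
  proof (rule Bochner_Integration.integrable_bound[OF integrable_mult_right[OF integrable_norm[OF that], of B]])
    show "(\<lambda>z. F z * g z) \<in> borel_measurable quadrature_space" using that by measurable
  qed (use order_trans[OF B abs_ge_self] in \<open>auto simp: norm_mult abs_mult intro!: mult_right_mono\<close>)
  have ipc: "integrable quadrature_space (\<lambda>z. complex_of_real (p z))" using ip by simp
  have iP: "integrable quadrature_space (?P m)" for m
    by (intro Bochner_Integration.integrable_sum integrable_mult_right integrable_quadrature_term)
  have lim: "(\<lambda>m. \<integral>z. cmod (of_real (p z) - ?P m z) \<partial>quadrature_space) \<longlonglongrightarrow> 0"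
  proof -
    have "1 / of_real pi * (\<Sum>j<m. \<Sum>k<m. \<rho> j k * of_real (hermite_fun k x * hermite_fun j x) *
           exp (- \<i> * (of_nat j - of_nat k) * of_real \<phi>)) = ?P m (x, \<phi>)" for m x \<phi>
      by (simp only: quadrature_term_def fst_conv snd_conv sum_distrib_left mult_ac)
    then show ?thesis
      using p unfolding quadrature_density_def by (simp only: case_prod_unfold prod.collapse)
  qed
  have bnd: "norm ((\<Sum>a<m. \<Sum>b<m. \<rho> a b * (\<integral>z. F z * quadrature_term a b z \<partial>quadrature_space)) - (\<integral>z. F z * of_real (p z) \<partial>quadrature_space))
      \<le> \<bar>B\<bar> * (\<integral>z. cmod (of_real (p z) - ?P m z) \<partial>quadrature_space)" for m
  proof -
    have "(\<Sum>a<m. \<Sum>b<m. \<rho> a b * (\<integral>z. F z * quadrature_term a b z \<partial>quadrature_space)) =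
       (\<integral>z. (\<Sum>a<m. \<Sum>b<m. \<rho> a b * (F z * quadrature_term a b z)) \<partial>quadrature_space)"
      by (simp add: iF[OF integrable_quadrature_term])
    also have "\<dots> = (\<integral>z. F z * ?P m z \<partial>quadrature_space)"
      by (simp only: sum_distrib_left mult_ac)
    finally have "(\<Sum>a<m. \<Sum>b<m. \<rho> a b * (\<integral>z. F z * quadrature_term a b z \<partial>quadrature_space)) - (\<integral>z. F z * of_real (p z) \<partial>quadrature_space)
       = (\<integral>z. F z * (?P m z - of_real (p z)) \<partial>quadrature_space)"
      unfolding right_diff_distrib by (simp only: Bochner_Integration.integral_diff[OF iF[OF iP] iF[OF ipc]])
    also have "norm \<dots> \<le> (\<integral>z. norm (F z * (?P m z - of_real (p z))) \<partial>quadrature_space)"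
      by (rule integral_norm_bound)
    also have "\<dots> \<le> (\<integral>z. \<bar>B\<bar> * cmod (of_real (p z) - ?P m z) \<partial>quadrature_space)"
    proof (rule integral_mono)
      show "integrable quadrature_space (\<lambda>z. norm (F z * (?P m z - of_real (p z))))"
        by (intro integrable_norm iF Bochner_Integration.integrable_diff iP ipc)
      show "integrable quadrature_space (\<lambda>z. \<bar>B\<bar> * cmod (of_real (p z) - ?P m z))"
        by (intro integrable_mult_right integrable_norm Bochner_Integration.integrable_diff iP ipc)
      show "norm (F z * (?P m z - of_real (p z))) \<le> \<bar>B\<bar> * cmod (of_real (p z) - ?P m z)" for z
        unfolding norm_mult norm_minus_commute[of "?P m z"]
        by (intro mult_right_mono order_trans[OF B abs_ge_self]) auto
    qed
    also have "\<dots> = \<bar>B\<bar> * (\<integral>z. cmod (of_real (p z) - ?P m z) \<partial>quadrature_space)"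
      by (rule integral_mult_right_zero)
    finally show ?thesis .
  qed
  have lim0: "(\<lambda>m. \<bar>B\<bar> * (\<integral>z. cmod (of_real (p z) - ?P m z) \<partial>quadrature_space)) \<longlonglongrightarrow> 0"
    using tendsto_mult_left[OF lim, of "\<bar>B\<bar>"] by simp
  from Lim_null_comparison[OF always_eventually[OF allI[OF bnd]] lim0]
  show ?thesis by (rule LIM_zero_cancel)
qed

lemma pattern_kernel_bounded: "\<exists>B. \<forall>z. cmod (pattern_kernel k j z) \<le> B"
  using pattern_fun_bounded[of k j] by (simp add: pattern_kernel_def case_prod_beta norm_mult norm_exp_eq_Re)

lemma quadrature_density_pattern:
  assumes p: "quadrature_density \<rho> p"
  shows "(\<integral>z. pattern_kernel k j z * of_real (p z) \<partial>quadrature_space) = \<rho> k j"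
proof -
  obtain B where "\<And>z. cmod (pattern_kernel k j z) \<le> B" using pattern_kernel_bounded by blast
  from quadrature_density_moment[OF p borel_measurable_pattern_kernel this]
  have "(\<lambda>m. \<Sum>a<m. \<Sum>b<m. \<rho> a b * (if k = a \<and> j = b then 1 else 0))
    \<longlonglongrightarrow> (\<integral>z. pattern_kernel k j z * of_real (p z) \<partial>quadrature_space)"
    unfolding pattern_kernel_biorthogonal by simp
  moreover have "(\<lambda>m. \<Sum>a<m. \<Sum>b<m. \<rho> a b * (if k = a \<and> j = b then 1 else 0)) \<longlonglongrightarrow> \<rho> k j"
  \<comment> \<open>Once \<open>m\<close> exceeds both indices the square partial sum contains the
    only nonzero term and is constant.\<close>
  proof (rule tendsto_eventually, rule eventually_sequentiallyI)
    fix m assume m: "m \<ge> Suc (k + j)"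
    have "(\<Sum>a<m. \<Sum>b<m. \<rho> a b * (if k = a \<and> j = b then 1 else 0)) = (\<Sum>a<m. if k = a then \<rho> a j else 0)"
    proof (intro sum.cong refl)
      fix a
      have "(\<Sum>b<m. \<rho> a b * (if k = a \<and> j = b then 1 else 0)) = (\<Sum>b<m. if j = b then (if k = a then \<rho> a b else 0) else 0)"
        by (intro sum.cong) auto
      also have "\<dots> = (if k = a then \<rho> a j else 0)" using m by simp
      finally show "(\<Sum>b<m. \<rho> a b * (if k = a \<and> j = b then 1 else 0)) = (if k = a then \<rho> a j else 0)" .
    qed
    also have "\<dots> = \<rho> k j" using m by simp
    finally show "(\<Sum>a<m. \<Sum>b<m. \<rho> a b * (if k = a \<and> j = b then 1 else 0)) = \<rho> k j" .
  qed
  ultimately show ?thesis by (rule LIMSEQ_unique)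
qed

text \<open>Only diagonal terms have nonzero mass, so the total mass is the trace.\<close>

lemma quadrature_density_integral:
  assumes "density_matrix \<rho>" and p: "quadrature_density \<rho> p"
  shows "(\<integral>z. p z \<partial>quadrature_space) = 1"
proof -
  have "(\<lambda>m. \<Sum>a<m. \<Sum>b<m. \<rho> a b * (\<integral>z. 1 * quadrature_term a b z \<partial>quadrature_space))
    \<longlonglongrightarrow> (\<integral>z. 1 * of_real (p z) \<partial>quadrature_space)"
    by (rule quadrature_density_moment[OF p, where B = 1]) auto
  also have "(\<lambda>m. \<Sum>a<m. \<Sum>b<m. \<rho> a b * (\<integral>z. 1 * quadrature_term a b z \<partial>quadrature_space)) = (\<lambda>m. \<Sum>a<m. \<rho> a a)"
    by (simp add: integral_quadrature_term if_distrib[of "\<lambda>x. _ * x"] cong: if_cong)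
  finally have "(\<lambda>m. \<Sum>a<m. \<rho> a a) \<longlonglongrightarrow> of_real (\<integral>z. p z \<partial>quadrature_space)"
    by (simp add: integral_complex_of_real)
  moreover have "(\<lambda>m. \<Sum>a<m. \<rho> a a) \<longlonglongrightarrow> 1"
    using assms(1) unfolding density_matrix_def has_trace_def has_matrix_def sums_def by auto
  ultimately have "complex_of_real (\<integral>z. p z \<partial>quadrature_space) = 1" by (rule LIMSEQ_unique)
  then show ?thesis by simp
qed

lemma expectation_pattern_kernel:
  assumes "prob_space M" and \<rho>: "density_matrix \<rho>" and p: "quadrature_density \<rho> p"
    and X: "distributed M quadrature_space X (\<lambda>z. ennreal (p z))"
  shows "(\<integral>\<omega>. pattern_kernel k j (X \<omega>) \<partial>M) = \<rho> k j"
proof -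
  interpret prob_space M by fact
  \<comment> \<open>The law of an observation has density \<open>max 0 p\<close>, since
    \<open>ennreal\<close> truncates negative values. Both \<open>p\<close> and its positive part
    have integral 1, hence they agree almost everywhere.\<close>
  let ?q = "\<lambda>z. max 0 (p z)"
  have [measurable]: "X \<in> M \<rightarrow>\<^sub>M quadrature_space" using X by (rule distributed_measurable)
  have ip: "integrable quadrature_space p" using p by (simp add: quadrature_density_def)
  then have [measurable]: "p \<in> borel_measurable quadrature_space" by simp
  have iq: "integrable quadrature_space ?q" using ip by simp
  have d: "distr M quadrature_space X = density quadrature_space (\<lambda>z. ennreal (?q z))"
    using distributed_distr_eq_density[OF X] by (simp add: ennreal_max_0)
  have "(\<integral>z. ?q z \<partial>quadrature_space) = 1"
  proof -
    have "(\<integral>\<^sup>+z. ennreal (?q z) \<partial>quadrature_space) = emeasure (density quadrature_space (\<lambda>z. ennreal (?q z))) (space quadrature_space)"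
      by (subst emeasure_density) (auto intro!: nn_integral_cong)
    also have "\<dots> = 1"
    proof -
      have "X -` space quadrature_space \<inter> space M = space M"
        using measurable_space[of X M quadrature_space] by auto
      then show ?thesis unfolding d[symmetric] by (subst emeasure_distr) (auto simp: emeasure_space_1)
    qed
    finally have "ennreal (\<integral>z. ?q z \<partial>quadrature_space) = 1"
      by (subst nn_integral_eq_integral[symmetric]) (auto intro: iq)
    then show ?thesis by simp
  qed
  then have "(\<integral>z. ?q z - p z \<partial>quadrature_space) = 0"
    using quadrature_density_integral[OF \<rho> p] iq ip by (subst Bochner_Integration.integral_diff) auto
  then have "AE z in quadrature_space. ?q z - p z = 0"
    using iq ip by (subst (asm) integral_nonneg_eq_0_iff_AE) auto
  then have ae: "AE z in quadrature_space. ?q z = p z" by eventually_elim simp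
  have "(\<integral>\<omega>. pattern_kernel k j (X \<omega>) \<partial>M) = (\<integral>z. pattern_kernel k j z \<partial>(distr M quadrature_space X))"
    by (rule integral_distr[symmetric]) auto
  also have "\<dots> = (\<integral>z. ?q z *\<^sub>R pattern_kernel k j z \<partial>quadrature_space)"
    unfolding d by (rule integral_density) auto
  also have "\<dots> = (\<integral>z. pattern_kernel k j z * of_real (p z) \<partial>quadrature_space)"
    by (rule integral_cong_AE) (use ae in \<open>auto simp: scaleR_conv_of_real mult.commute\<close>)
  also have "\<dots> = \<rho> k j" by (rule quadrature_density_pattern[OF p])
  finally show ?thesis .
qed

subsection \<open>The Fourier transform in the plane\<close>

definition fourier :: "(real \<times> real \<Rightarrow> complex) \<Rightarrow> real \<times> real \<Rightarrow> complex" where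
  "fourier f w = (LBINT z. exp (- \<i> * of_real (w \<bullet> z)) * f z)"

lemma norm_fourier_kernel [simp]: "cmod (exp (- \<i> * of_real r)) = 1" "cmod (exp (- (\<i> * of_real r))) = 1"
  by (simp_all add: norm_exp_eq_Re)

lemma borel_measurable_fourier [measurable]:
  assumes [measurable]: "f \<in> borel_measurable borel" shows "fourier f \<in> borel_measurable borel"
  unfolding fourier_def[abs_def] by (intro lborel.borel_measurable_lebesgue_integral) measurable

lemma fourier_integrable:
  assumes "integrable lborel f" shows "integrable lborel (\<lambda>z. exp (- \<i> * of_real (w \<bullet> z)) * f z)"
proof (rule Bochner_Integration.integrable_bound[OF assms])
  have [measurable]: "f \<in> borel_measurable borel" using assms by auto
  show "(\<lambda>z. exp (- \<i> * of_real (w \<bullet> z)) * f z) \<in> borel_measurable lborel" by measurable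
qed (simp add: norm_mult)

lemma cmod_fourier_le: "cmod (fourier f w) \<le> (LBINT z. cmod (f z))"
  unfolding fourier_def
  using integral_norm_bound[of lborel "\<lambda>z. exp (- \<i> * of_real (w \<bullet> z)) * f z"] by (simp add: norm_mult)

text \<open>The multiplication formula. It moves the transform onto the other factor and is the
  basis of every extension beyond integrable functions here.\<close>

lemma integral_fourier_mult:
  assumes f: "integrable lborel f" and h: "integrable lborel h"
  shows "(LBINT w. fourier f w * h w) = (LBINT z. f z * fourier h z)"
proof -
  have [measurable]: "f \<in> borel_measurable borel" "h \<in> borel_measurable borel" using f h by auto
  let ?g = "\<lambda>w z. exp (- \<i> * of_real (w \<bullet> z)) * (h w * f z)"
  have int: "integrable (lborel \<Otimes>\<^sub>M lborel) (\<lambda>(w, z). ?g w z)"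
  proof (rule Bochner_Integration.integrable_bound)
    show "integrable (lborel \<Otimes>\<^sub>M lborel) (\<lambda>(w, z). h w * f z)"
      by (intro integrable_prod_mult lborel.sigma_finite_measure_axioms f h)
  qed (auto simp: norm_mult)
  have "(LBINT w. fourier f w * h w) = (LBINT w. LBINT z. ?g w z)"
    unfolding fourier_def
    by (intro Bochner_Integration.integral_cong refl, subst integral_mult_left_zero[symmetric]) (simp only: mult_ac)
  also have "\<dots> = (LBINT z. LBINT w. ?g w z)"
    by (rule lborel_pair.Fubini_integral[OF int, symmetric])
  also have "\<dots> = (LBINT z. f z * fourier h z)"
    unfolding fourier_def
    by (intro Bochner_Integration.integral_cong refl, subst integral_mult_right_zero[symmetric]) (simp only: mult_ac inner_commute)
  finally show ?thesis .
qed

lemma integrable_gauss2: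
  assumes "a > 0" shows "integrable lborel (\<lambda>z::real \<times> real. exp (- (a * (norm z)\<^sup>2)))"
  by (intro rapid_integrable2 rapid_gauss_norm assms) simp

lemma fourier_gauss2:
  assumes a: "a > 0"
  shows "fourier (\<lambda>z. of_real (exp (- (a * (norm z)\<^sup>2)))) w = of_real (pi / a * exp (- (norm w)\<^sup>2 / (4 * a)))"
proof -
  let ?g = "\<lambda>u x. exp (- \<i> * of_real (u * x)) * complex_of_real (exp (- (a * x\<^sup>2)))"
  have i: "integrable lborel (?g u)" for u
  proof (rule rapid_integrable)
    show "rapid (?g u)" by (rule rapid_dominated[OF rapid_gauss[OF a]]) (simp add: norm_mult)
  qed simp
  have "exp (- \<i> * of_real (w \<bullet> z)) * complex_of_real (exp (- (a * (norm z)\<^sup>2))) = ?g (fst w) (fst z) * ?g (snd w) (snd z)" for z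
  proof -
    have n: "(norm z)\<^sup>2 = (fst z)\<^sup>2 + (snd z)\<^sup>2" by (simp add: norm_prod_def)
    have "exp (- (a * (norm z)\<^sup>2)) = exp (- (a * (fst z)\<^sup>2)) * exp (- (a * (snd z)\<^sup>2))"
      unfolding exp_add[symmetric] n by (simp add: algebra_simps)
    moreover have "exp (- \<i> * of_real (w \<bullet> z)) = exp (- \<i> * of_real (fst w * fst z)) * exp (- \<i> * complex_of_real (snd w * snd z))"
      unfolding exp_add[symmetric] by (simp add: inner_prod_def algebra_simps)
    ultimately show ?thesis by (simp add: mult_ac)
  qed
  then have "fourier (\<lambda>z. of_real (exp (- (a * (norm z)\<^sup>2)))) w = (LBINT x. ?g (fst w) x) * (LBINT x. ?g (snd w) x)"
    unfolding fourier_def lborel_prod[symmetric]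
    by (simp only: integral_prod_mult[OF lborel.sigma_finite_measure_axioms lborel.sigma_finite_measure_axioms i i])
  also have "\<dots> = of_real ((sqrt (pi / a) * exp (- (fst w)\<^sup>2 / (4 * a))) * (sqrt (pi / a) * exp (- (snd w)\<^sup>2 / (4 * a))))"
    unfolding fourier_gauss[OF a] unfolding of_real_mult ..
  also have "(sqrt (pi / a) * exp (- (fst w)\<^sup>2 / (4 * a))) * (sqrt (pi / a) * exp (- (snd w)\<^sup>2 / (4 * a))) =
    (sqrt (pi / a) * sqrt (pi / a)) * (exp (- (fst w)\<^sup>2 / (4 * a)) * exp (- (snd w)\<^sup>2 / (4 * a)))" by (simp only: mult_ac)
  also have "sqrt (pi / a) * sqrt (pi / a) = pi / a" using a by simp
  also have "exp (- (fst w)\<^sup>2 / (4 * a)) * exp (- (snd w)\<^sup>2 / (4 * a)) = exp (- (norm w)\<^sup>2 / (4 * a))"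
    unfolding exp_add[symmetric] by (simp add: norm_prod_def add_divide_distrib diff_divide_distrib)
  finally show ?thesis .
qed

lemma nn_integral_lborel_reflect:
  fixes f :: "'a::euclidean_space \<Rightarrow> ennreal"
  assumes [measurable]: "f \<in> borel_measurable borel"
  shows "(\<integral>\<^sup>+x. f (t - x) \<partial>lborel) = (\<integral>\<^sup>+x. f x \<partial>lborel)"
proof -
  have "(\<integral>\<^sup>+x. f x \<partial>lborel) = (\<integral>\<^sup>+x. f x \<partial>(density (distr lborel borel (\<lambda>x. t + (- 1) *\<^sub>R x)) (\<lambda>_. ennreal (\<bar>- 1\<bar> ^ DIM('a)))))"
    by (subst lborel_affine[of "- 1" t]) auto
  also have "\<dots> = (\<integral>\<^sup>+x. f (t - x) \<partial>lborel)"
    by (simp add: nn_integral_density nn_integral_distr)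
  finally show ?thesis ..
qed

lemma nn_integral_lborel_translate:
  fixes f :: "'a::euclidean_space \<Rightarrow> ennreal"
  assumes [measurable]: "f \<in> borel_measurable borel"
  shows "(\<integral>\<^sup>+x. f (x - t) \<partial>lborel) = (\<integral>\<^sup>+x. f x \<partial>lborel)"
proof -
  have "(\<integral>\<^sup>+x. f x \<partial>lborel) = (\<integral>\<^sup>+x. f x \<partial>(distr lborel borel ((+) (- t))))"
    by (simp only: lborel_distr_plus)
  then show ?thesis by (simp add: nn_integral_distr)
qed

text \<open>The transforms of the Gaussian dampings all have the same mass; this is where
  Plancherel's constant \<open>4 * pi^2\<close> enters, uniformly in \<open>a\<close>.\<close>

lemma nn_integral_gauss2_fourier:
  assumes a: "a > 0"
  shows "(\<integral>\<^sup>+z. ennreal (pi / a * exp (- (norm (z::real \<times> real))\<^sup>2 / (4 * a))) \<partial>lborel) = ennreal (4 * pi\<^sup>2)"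
proof -
  let ?b = "1 / (4 * a)"
  have b: "?b > 0" using a by simp
  have e: "exp (- (norm z)\<^sup>2 / (4 * a)) = exp (- (?b * (norm z)\<^sup>2))" for z :: "real \<times> real" by simp
  have "complex_of_real (LBINT z. exp (- (?b * (norm (z::real \<times> real))\<^sup>2))) = of_real (pi / ?b)"
    using fourier_gauss2[OF b, of 0] unfolding fourier_def integral_complex_of_real[symmetric] by simp
  then have I: "(LBINT z. exp (- (?b * (norm (z::real \<times> real))\<^sup>2))) = pi / ?b" by (simp only: of_real_eq_iff)
  have "(LBINT z. pi / a * exp (- (norm (z::real \<times> real))\<^sup>2 / (4 * a))) = 4 * pi\<^sup>2"
    unfolding e integral_mult_right_zero I using a by (simp add: power2_eq_square)
  moreover have "integrable lborel (\<lambda>z::real \<times> real. pi / a * exp (- (norm z)\<^sup>2 / (4 * a)))"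
    unfolding e by (intro integrable_mult_right integrable_gauss2 b)
  ultimately show ?thesis using a by (subst nn_integral_eq_integral) auto
qed

text \<open>With Gaussian damping the left side becomes a double integral of \<open>f\<close> and
  its conjugate against a positive kernel in \<open>y - x\<close>. Bounding the product by half the
  sum of squares and integrating out one variable leaves the mass of the kernel, so the bound does
  not depend on \<open>a\<close>.\<close>

lemma fourier_gauss_weighted:
  assumes f: "integrable lborel f" and f2: "integrable lborel (\<lambda>z. (cmod (f z))\<^sup>2)" and a: "a > 0"
  shows "(\<integral>\<^sup>+w. ennreal ((cmod (fourier f w))\<^sup>2 * exp (- (a * (norm w)\<^sup>2))) \<partial>lborel)
    \<le> ennreal (4 * pi\<^sup>2 * (LBINT z. (cmod (f z))\<^sup>2))"
proof -
  have [measurable]: "f \<in> borel_measurable borel" using f by auto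
  let ?G = "\<lambda>w::real \<times> real. exp (- (a * (norm w)\<^sup>2))"
  let ?g = "\<lambda>z::real \<times> real. pi / a * exp (- (norm z)\<^sup>2 / (4 * a))"
  let ?H = "\<lambda>w. cnj (fourier f w) * of_real (?G w)"
  let ?A = "\<integral>z. cmod (f z) \<partial>lborel" and ?A2 = "\<integral>z. (cmod (f z))\<^sup>2 \<partial>lborel"
  have g0: "?g z \<ge> 0" for z using a by simp
  have en: "ennreal p * ennreal (q * s) \<le> ennreal (P * s) + ennreal (Q * s)"
    if "p * (q * s) \<le> (P + Q) * s" "0 \<le> p" "0 \<le> s" "0 \<le> P" "0 \<le> Q" for p q s P Q
  proof -
    have "ennreal p * ennreal (q * s) = ennreal (p * (q * s))" using that by (simp add: ennreal_mult')
    also have "\<dots> \<le> ennreal (P * s + Q * s)" using that by (intro ennreal_leI) (simp add: distrib_right)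
    also have "\<dots> = ennreal (P * s) + ennreal (Q * s)" using that by (intro ennreal_plus) auto
    finally show ?thesis .
  qed
  have iH: "integrable lborel ?H"
    by (rule Bochner_Integration.integrable_bound[OF integrable_mult_right[OF integrable_gauss2[OF a], of ?A]])
       (auto simp: norm_mult intro!: mult_right_mono cmod_fourier_le)
  \<comment> \<open>The damped conjugate transform is transformed back, which turns the damping into
    convolution with its Gaussian transform \<open>?g\<close>.\<close>
  have H: "fourier ?H x = cnj (LBINT y. f y * of_real (?g (y - x)))" for x
  proof -
    let ?K = "\<lambda>w. cnj (exp (- \<i> * of_real (x \<bullet> w))) * complex_of_real (?G w)"
    have iK: "integrable lborel ?K"
      by (rule Bochner_Integration.integrable_bound[OF integrable_gauss2[OF a]]) (auto simp: norm_mult)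
    have K: "fourier ?K y = of_real (?g (y - x))" for y
    proof -
      have pt: "exp (- \<i> * of_real (y \<bullet> w)) * ?K w = exp (- \<i> * of_real ((y - x) \<bullet> w)) * complex_of_real (?G w)" for w
        unfolding exp_cnj mult.assoc[symmetric] exp_add[symmetric] by (simp add: inner_diff_left algebra_simps)
      have "fourier ?K y = fourier (\<lambda>w. of_real (?G w)) (y - x)"
        unfolding fourier_def by (intro Bochner_Integration.integral_cong refl pt)
      then show ?thesis unfolding fourier_gauss2[OF a] .
    qed
    have "fourier ?H x = cnj (LBINT w. fourier f w * ?K w)"
      unfolding fourier_def[of ?H] cnj_integral by (intro Bochner_Integration.integral_cong) auto
    also have "(LBINT w. fourier f w * ?K w) = (LBINT y. f y * of_real (?g (y - x)))"
      unfolding integral_fourier_mult[OF f iK] K ..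
    finally show ?thesis .
  qed
  have iP: "integrable lborel (\<lambda>w. (cmod (fourier f w))\<^sup>2 * ?G w)"
    by (rule Bochner_Integration.integrable_bound[OF integrable_mult_right[OF integrable_gauss2[OF a], of "?A\<^sup>2"]])
       (auto simp: norm_mult intro!: mult_right_mono power_mono cmod_fourier_le)
  have "complex_of_real (LBINT w. (cmod (fourier f w))\<^sup>2 * ?G w) = (LBINT w. fourier f w * ?H w)"
    unfolding integral_complex_of_real[symmetric]
    by (intro Bochner_Integration.integral_cong refl) (simp only: of_real_mult complex_norm_square mult_ac)
  also have "\<dots> = (LBINT x. f x * fourier ?H x)" by (rule integral_fourier_mult[OF f iH])
  finally have eq: "complex_of_real (LBINT w. (cmod (fourier f w))\<^sup>2 * ?G w) = (LBINT x. f x * fourier ?H x)" .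
  have "(\<integral>\<^sup>+w. ennreal ((cmod (fourier f w))\<^sup>2 * ?G w) \<partial>lborel) = ennreal (LBINT w. (cmod (fourier f w))\<^sup>2 * ?G w)"
    by (rule nn_integral_eq_integral[OF iP]) simp
  also have "(LBINT w. (cmod (fourier f w))\<^sup>2 * ?G w) = cmod (LBINT x. f x * fourier ?H x)"
    unfolding eq[symmetric] by simp
  also have "ennreal \<dots> \<le> (\<integral>\<^sup>+x. ennreal (norm (f x * fourier ?H x)) \<partial>lborel)"
  proof (rule integral_norm_bound_ennreal)
    obtain B where B: "\<And>x. cmod (fourier ?H x) \<le> B" using cmod_fourier_le by blast
    show "integrable lborel (\<lambda>x. f x * fourier ?H x)"
    proof (rule Bochner_Integration.integrable_bound[OF integrable_mult_left[OF integrable_norm[OF f], of B]])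
      have "norm (f x * fourier ?H x) \<le> norm (cmod (f x) * B)" for x
        unfolding norm_mult[of "f x"] real_norm_def abs_mult abs_norm_cancel
        by (intro mult_left_mono order_trans[OF B abs_ge_self]) simp
      then show "AE x in lborel. norm (f x * fourier ?H x) \<le> norm (cmod (f x) * B)" by simp
    qed simp
  qed
  also have "\<dots> \<le> (\<integral>\<^sup>+x. \<integral>\<^sup>+y. ennreal (((cmod (f x))\<^sup>2 / 2) * ?g (y - x)) + ennreal (((cmod (f y))\<^sup>2 / 2) * ?g (y - x)) \<partial>lborel \<partial>lborel)"
  proof (rule nn_integral_mono)
    fix x
    have "ennreal (norm (f x * fourier ?H x)) = ennreal (cmod (f x)) * ennreal (cmod (LBINT y. f y * of_real (?g (y - x))))"
      unfolding H norm_mult complex_mod_cnj by (rule ennreal_mult') simp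
    also have "\<dots> \<le> ennreal (cmod (f x)) * (\<integral>\<^sup>+y. ennreal (norm (f y * of_real (?g (y - x)))) \<partial>lborel)"
    proof (intro mult_left_mono integral_norm_bound_ennreal)
      have gb: "?g z \<le> pi / a" for z
        using a mult_left_mono[of "exp (- (norm z)\<^sup>2 / (4 * a))" 1 "pi / a"] by simp
      show "integrable lborel (\<lambda>y. f y * of_real (?g (y - x)))"
      proof (rule Bochner_Integration.integrable_bound[OF integrable_mult_left[OF integrable_norm[OF f], of "pi / a"]])
        have "norm (f y * of_real (?g (y - x))) \<le> norm (cmod (f y) * (pi / a))" for y
          unfolding norm_mult[of "f y"] norm_of_real abs_of_nonneg[OF g0]
          unfolding real_norm_def abs_mult[of "cmod (f y)"] abs_norm_cancel
          by (intro mult_left_mono order_trans[OF gb abs_ge_self]) simp_all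
        then show "AE y in lborel. norm (f y * of_real (?g (y - x))) \<le> norm (cmod (f y) * (pi / a))" by simp
      qed simp
    qed simp
    also have "\<dots> = (\<integral>\<^sup>+y. ennreal (cmod (f x)) * ennreal (cmod (f y) * ?g (y - x)) \<partial>lborel)"
    proof -
      have n: "norm (f y * of_real (?g (y - x))) = cmod (f y) * ?g (y - x)" for y
        unfolding norm_mult[of "f y"] norm_of_real abs_of_nonneg[OF g0] ..
      show ?thesis unfolding n by (rule nn_integral_cmult[symmetric]) simp
    qed
    also have "\<dots> \<le> (\<integral>\<^sup>+y. ennreal (((cmod (f x))\<^sup>2 / 2) * ?g (y - x)) + ennreal (((cmod (f y))\<^sup>2 / 2) * ?g (y - x)) \<partial>lborel)"
    proof (rule nn_integral_mono)
      fix y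
      have "cmod (f x) * (cmod (f y) * ?g (y - x)) = (cmod (f x) * cmod (f y)) * ?g (y - x)" by (simp only: mult.assoc)
      also have "\<dots> \<le> ((cmod (f x))\<^sup>2 / 2 + (cmod (f y))\<^sup>2 / 2) * ?g (y - x)"
        using sum_squares_bound[of "cmod (f x)" "cmod (f y)"] by (intro mult_right_mono g0) simp
      finally show "ennreal (cmod (f x)) * ennreal (cmod (f y) * ?g (y - x)) \<le>
          ennreal (((cmod (f x))\<^sup>2 / 2) * ?g (y - x)) + ennreal (((cmod (f y))\<^sup>2 / 2) * ?g (y - x))"
        by (intro en g0) auto
    qed
    finally show "ennreal (norm (f x * fourier ?H x)) \<le>
      (\<integral>\<^sup>+y. ennreal (((cmod (f x))\<^sup>2 / 2) * ?g (y - x)) + ennreal (((cmod (f y))\<^sup>2 / 2) * ?g (y - x)) \<partial>lborel)" .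
  qed
  also have "\<dots> = (\<integral>\<^sup>+x. \<integral>\<^sup>+y. ennreal (((cmod (f x))\<^sup>2 / 2) * ?g (y - x)) \<partial>lborel \<partial>lborel) +
      (\<integral>\<^sup>+x. \<integral>\<^sup>+y. ennreal (((cmod (f y))\<^sup>2 / 2) * ?g (y - x)) \<partial>lborel \<partial>lborel)"
    by (subst nn_integral_add[symmetric]) (auto simp: nn_integral_add intro!: nn_integral_cong)
  also have "(\<integral>\<^sup>+x. \<integral>\<^sup>+y. ennreal (((cmod (f y))\<^sup>2 / 2) * ?g (y - x)) \<partial>lborel \<partial>lborel) =
      (\<integral>\<^sup>+y. \<integral>\<^sup>+x. ennreal (((cmod (f y))\<^sup>2 / 2) * ?g (y - x)) \<partial>lborel \<partial>lborel)"
    by (rule lborel_pair.Fubini'[symmetric]) measurable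
  also have "(\<integral>\<^sup>+x. \<integral>\<^sup>+y. ennreal (((cmod (f x))\<^sup>2 / 2) * ?g (y - x)) \<partial>lborel \<partial>lborel) =
     (\<integral>\<^sup>+x. ennreal ((cmod (f x))\<^sup>2 / 2) * ennreal (4 * pi\<^sup>2) \<partial>lborel)"
  proof (rule nn_integral_cong)
    fix x
    have "(\<integral>\<^sup>+y. ennreal (((cmod (f x))\<^sup>2 / 2) * ?g (y - x)) \<partial>lborel) = (\<integral>\<^sup>+y. ennreal ((cmod (f x))\<^sup>2 / 2) * ennreal (?g (y - x)) \<partial>lborel)"
      by (intro nn_integral_cong ennreal_mult') simp
    also have "\<dots> = ennreal ((cmod (f x))\<^sup>2 / 2) * (\<integral>\<^sup>+y. ennreal (?g (y - x)) \<partial>lborel)"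
      by (rule nn_integral_cmult) simp
    also have "(\<integral>\<^sup>+y. ennreal (?g (y - x)) \<partial>lborel) = ennreal (4 * pi\<^sup>2)"
      unfolding nn_integral_gauss2_fourier[OF a, symmetric] by (rule nn_integral_lborel_translate[of "\<lambda>y. ennreal (?g y)"]) simp
    finally show "(\<integral>\<^sup>+y. ennreal (((cmod (f x))\<^sup>2 / 2) * ?g (y - x)) \<partial>lborel) = ennreal ((cmod (f x))\<^sup>2 / 2) * ennreal (4 * pi\<^sup>2)" .
  qed
  also have "(\<integral>\<^sup>+y. \<integral>\<^sup>+x. ennreal (((cmod (f y))\<^sup>2 / 2) * ?g (y - x)) \<partial>lborel \<partial>lborel) =
     (\<integral>\<^sup>+y. ennreal ((cmod (f y))\<^sup>2 / 2) * ennreal (4 * pi\<^sup>2) \<partial>lborel)"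
  proof (rule nn_integral_cong)
    fix y
    have "(\<integral>\<^sup>+x. ennreal (((cmod (f y))\<^sup>2 / 2) * ?g (y - x)) \<partial>lborel) = (\<integral>\<^sup>+x. ennreal ((cmod (f y))\<^sup>2 / 2) * ennreal (?g (y - x)) \<partial>lborel)"
      by (intro nn_integral_cong ennreal_mult') simp
    also have "\<dots> = ennreal ((cmod (f y))\<^sup>2 / 2) * (\<integral>\<^sup>+x. ennreal (?g (y - x)) \<partial>lborel)"
      by (rule nn_integral_cmult) simp
    also have "(\<integral>\<^sup>+x. ennreal (?g (y - x)) \<partial>lborel) = ennreal (4 * pi\<^sup>2)"
      unfolding nn_integral_gauss2_fourier[OF a, symmetric] by (rule nn_integral_lborel_reflect[of "\<lambda>y. ennreal (?g y)"]) simp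
    finally show "(\<integral>\<^sup>+x. ennreal (((cmod (f y))\<^sup>2 / 2) * ?g (y - x)) \<partial>lborel) = ennreal ((cmod (f y))\<^sup>2 / 2) * ennreal (4 * pi\<^sup>2)" .
  qed
  also have "(\<integral>\<^sup>+x. ennreal ((cmod (f x))\<^sup>2 / 2) * ennreal (4 * pi\<^sup>2) \<partial>lborel) = ennreal (?A2 / 2) * ennreal (4 * pi\<^sup>2)"
    using f2 by (simp add: nn_integral_multc nn_integral_eq_integral)
  also have "ennreal (?A2 / 2) * ennreal (4 * pi\<^sup>2) + ennreal (?A2 / 2) * ennreal (4 * pi\<^sup>2) = ennreal (4 * pi\<^sup>2 * ?A2)"
    by (simp add: ennreal_mult'[symmetric] ennreal_plus[symmetric] del: ennreal_plus)
  finally show ?thesis .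
qed

text \<open>Fatou's lemma removes the damping along \<open>a = 1 / Suc n\<close>, since the damped
  bounds are uniform.\<close>

lemma fourier_L2:
  assumes f: "integrable lborel f" and f2: "integrable lborel (\<lambda>z. (cmod (f z))\<^sup>2)"
  shows "integrable lborel (\<lambda>w. (cmod (fourier f w))\<^sup>2)"
proof -
  have [measurable]: "f \<in> borel_measurable borel" using f by auto
  let ?u = "\<lambda>n w. ennreal ((cmod (fourier f w))\<^sup>2 * exp (- (1 / real (Suc n) * (norm w)\<^sup>2)))"
  let ?C = "ennreal (4 * pi\<^sup>2 * (LBINT z. (cmod (f z))\<^sup>2))"
  have lim: "liminf (\<lambda>n. ?u n w) = ennreal ((cmod (fourier f w))\<^sup>2)" for w
  proof (rule lim_imp_Liminf)
    have "(\<lambda>n. (cmod (fourier f w))\<^sup>2 * exp (- (1 / real (Suc n) * (norm w)\<^sup>2))) \<longlonglongrightarrow> (cmod (fourier f w))\<^sup>2 * exp (- (0 * (norm w)\<^sup>2))"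
      by (intro tendsto_intros LIMSEQ_Suc[OF lim_1_over_n])
    then show "(\<lambda>n. ?u n w) \<longlonglongrightarrow> ennreal ((cmod (fourier f w))\<^sup>2)"
      by (intro tendsto_ennrealI) simp
  qed simp
  have "(\<integral>\<^sup>+w. ennreal ((cmod (fourier f w))\<^sup>2) \<partial>lborel) \<le> liminf (\<lambda>n. \<integral>\<^sup>+w. ?u n w \<partial>lborel)"
    unfolding lim[symmetric] by (rule nn_integral_liminf) simp
  also have "\<dots> \<le> liminf (\<lambda>n::nat. ?C)"
    by (intro Liminf_mono always_eventually allI fourier_gauss_weighted f f2) simp
  also have "\<dots> = ?C" by (simp add: Liminf_const)
  also have "\<dots> < \<infinity>" by simp
  finally show ?thesis by (intro integrableI_bounded) auto
qed

text \<open>Since \<open>L2_norm\<close> is 0 on functions that are not square integrable, the convergence in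
  \<open>has_L2_fourier\<close> carries information only by \<open>fourier_L2\<close>.\<close>

lemma has_L2_fourier_dual:
  assumes W: "has_L2_fourier W g" and h: "integrable lborel h" and h2: "integrable lborel (\<lambda>z. (cmod (h z))\<^sup>2)"
  shows "integrable lborel (\<lambda>z. W z * fourier h z)"
    and "(LBINT z. W z * fourier h z) = (LBINT w. g w * h w)"
proof -
  have [measurable]: "W \<in> borel_measurable borel" "g \<in> borel_measurable borel" "h \<in> borel_measurable borel"
    and W2: "integrable lborel (\<lambda>z. (cmod (W z))\<^sup>2)" and g2: "integrable lborel (\<lambda>z. (cmod (g z))\<^sup>2)"
    using W h unfolding has_L2_fourier_def L2_def by auto
  show iWh: "integrable lborel (\<lambda>z. W z * fourier h z)"
    by (rule L2_product(1)[OF _ _ W2 fourier_L2[OF h h2]]) simp_all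
  \<comment> \<open>On a disc \<open>\<bar>W\<bar> \<le> 1 + \<bar>W\<bar>^2\<close> makes the
    truncation integrable, so that both the multiplication formula and \<open>fourier_L2\<close>
    apply to it.\<close>
  define V where "V = (\<lambda>R z. indicator (cball 0 R) z *\<^sub>R W z)"
  have [measurable]: "cball (0 :: real \<times> real) R \<in> sets borel" for R by simp
  have [measurable]: "V R \<in> borel_measurable borel" for R unfolding V_def by measurable
  have V2: "integrable lborel (\<lambda>z. (cmod (V R z))\<^sup>2)" for R
    by (rule Bochner_Integration.integrable_bound[OF W2]) (auto simp: V_def indicator_def)
  have V: "integrable lborel (V R)" for R
  proof (rule Bochner_Integration.integrable_bound)
    show "integrable lborel (\<lambda>z. indicator (cball 0 R) z + (cmod (W z))\<^sup>2)"
      by (intro Bochner_Integration.integrable_add W2 integrable_real_indicator emeasure_lborel_cball_finite) auto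
    have "cmod (W z) \<le> 1 + (cmod (W z))\<^sup>2" for z
    proof -
      have "2 * cmod (W z) \<le> 1 + (cmod (W z))\<^sup>2" using sum_squares_bound[of 1 "cmod (W z)"] by simp
      then show ?thesis using zero_le_power2[of "cmod (W z)"] by linarith
    qed
    then show "AE z in lborel. norm (V R z) \<le> norm (indicator (cball 0 R) z + (cmod (W z))\<^sup>2)"
      by (auto simp: V_def indicator_def)
  qed simp
  have FV: "(\<lambda>(u, v). (LINT (q, p) : cball 0 R | lborel. exp (- \<i> * of_real (u * q) - \<i> * of_real (v * p)) * W (q, p)) - g (u, v))
     = (\<lambda>w. fourier (V R) w - g w)" for R
  proof
    fix w :: "real \<times> real"
    obtain u v where w: "w = (u, v)" by (cases w)
    have "(LINT (q, p) : cball 0 R | lborel. exp (- \<i> * of_real (u * q) - \<i> * of_real (v * p)) * W (q, p)) = fourier (V R) w"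
      unfolding set_lebesgue_integral_def fourier_def w V_def
      by (intro Bochner_Integration.integral_cong refl) (auto simp: inner_prod_def algebra_simps)
    then show "(case w of (u, v) \<Rightarrow> (LINT (q, p) : cball 0 R | lborel. exp (- \<i> * of_real (u * q) - \<i> * of_real (v * p)) * W (q, p)) - g (u, v))
        = fourier (V R) w - g w" by (simp add: w)
  qed
  have lim: "(\<lambda>n. L2_norm lborel (\<lambda>w. fourier (V (real n)) w - g w)) \<longlonglongrightarrow> 0"
    using W unfolding has_L2_fourier_def FV by (auto intro: filterlim_compose[OF _ filterlim_real_sequentially])
  have igh: "integrable lborel (\<lambda>w. g w * h w)" by (rule L2_product(1)[OF _ _ g2 h2]) simp_all
  have iFh: "integrable lborel (\<lambda>w. fourier (V R) w * h w)" for R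
    by (rule L2_product(1)[OF _ _ fourier_L2[OF V V2] h2]) simp_all
  let ?c = "sqrt (LBINT z. (cmod (h z))\<^sup>2)"
  have bnd: "norm ((LBINT z. V (real n) z * fourier h z) - (LBINT w. g w * h w)) \<le> L2_norm lborel (\<lambda>w. fourier (V (real n)) w - g w) * ?c" for n
  proof -
    have "(LBINT z. V (real n) z * fourier h z) - (LBINT w. g w * h w) = (LBINT w. (fourier (V (real n)) w - g w) * h w)"
      unfolding integral_fourier_mult[OF V h, symmetric] left_diff_distrib
      by (rule Bochner_Integration.integral_diff[OF iFh igh, symmetric])
    then show ?thesis
      unfolding L2_norm_def
      using L2_product(2)[OF _ _ L2_diff[OF _ _ fourier_L2[OF V[of "real n"] V2[of "real n"]] g2] h2] by simp
  qed
  have "(\<lambda>n. L2_norm lborel (\<lambda>w. fourier (V (real n)) w - g w) * ?c) \<longlonglongrightarrow> 0"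
    using tendsto_mult_right[OF lim, of ?c] by simp
  from Lim_null_comparison[OF always_eventually[OF allI[OF bnd]] this]
  have "(\<lambda>n. LBINT z. V (real n) z * fourier h z) \<longlonglongrightarrow> (LBINT w. g w * h w)"
    by (rule LIM_zero_cancel)
  moreover have "(\<lambda>n. LBINT z. V (real n) z * fourier h z) \<longlonglongrightarrow> (LBINT z. W z * fourier h z)"
  proof (rule integral_dominated_convergence[OF _ _ integrable_norm[OF iWh]])
    show "AE z in lborel. (\<lambda>n. V (real n) z * fourier h z) \<longlonglongrightarrow> W z * fourier h z"
    proof (intro AE_I2 tendsto_eventually)
      fix z :: "real \<times> real"
      obtain m :: nat where "norm z \<le> real m" using real_arch_simple by blast
      then have "V (real n) z * fourier h z = W z * fourier h z" if "n \<ge> m" for n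
        using that by (auto simp: V_def indicator_def)
      then show "\<forall>\<^sub>F n in sequentially. V (real n) z * fourier h z = W z * fourier h z"
        unfolding eventually_sequentially by blast
    qed
    show "AE z in lborel. norm (V (real n) z * fourier h z) \<le> norm (W z * fourier h z)" for n
      by (auto simp: V_def norm_mult indicator_def)
  qed simp_all
  ultimately show "(LBINT z. W z * fourier h z) = (LBINT w. g w * h w)"
    by (rule LIMSEQ_unique[symmetric])
qed

section \<open>Uniqueness of the Fourier transform\<close>

lemma fourier_unique_real_1d:
  fixes f :: "real \<Rightarrow> real"
  assumes f: "integrable lborel f"
    and 0: "\<And>t. (LBINT x. exp (\<i> * of_real (t * x)) * of_real (f x)) = 0"
  shows "AE x in lborel. f x = 0"
proof -
  \<comment> \<open>The positive and negative parts have equal transforms, hence equal mass by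
    evaluation at 0. After normalization they are densities with the same characteristic function,
    so Levy's theorem applies.\<close>
  let ?p = "\<lambda>x. max 0 (f x)" and ?n = "\<lambda>x. max 0 (- f x)"
  have [measurable]: "f \<in> borel_measurable borel" using f by auto
  have p: "integrable lborel ?p" and n: "integrable lborel ?n" using f by auto
  have ie: "integrable lborel (\<lambda>x. g x *\<^sub>R exp (\<i> * of_real (t * x)))" if "integrable lborel g" for g :: "real \<Rightarrow> real" and t
  proof -
    have "g \<in> borel_measurable borel" using that by auto
    then show ?thesis
      by (intro Bochner_Integration.integrable_bound[OF that]) auto
  qed
  have eq: "(LBINT x. ?p x *\<^sub>R exp (\<i> * of_real (t * x))) = (LBINT x. ?n x *\<^sub>R exp (\<i> * of_real (t * x)))" for t
  proof -
    have "(LBINT x. ?p x *\<^sub>R exp (\<i> * of_real (t * x))) - (LBINT x. ?n x *\<^sub>R exp (\<i> * of_real (t * x)))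
       = (LBINT x. ?p x *\<^sub>R exp (\<i> * of_real (t * x)) - ?n x *\<^sub>R exp (\<i> * of_real (t * x)))"
      by (rule Bochner_Integration.integral_diff[OF ie[OF p] ie[OF n], symmetric])
    also have "\<dots> = (LBINT x. exp (\<i> * of_real (t * x)) * of_real (f x))"
      by (intro Bochner_Integration.integral_cong) (auto simp: max_def scaleR_conv_of_real)
    finally show ?thesis unfolding 0 by simp
  qed
  define c where "c = (LBINT x. ?p x)"
  have cn: "(LBINT x. ?n x) = c"
  proof -
    have "complex_of_real (LBINT x. ?p x) = of_real (LBINT x. ?n x)"
      using eq[of 0] by (simp add: scaleR_conv_of_real integral_complex_of_real)
    then show ?thesis by (simp only: of_real_eq_iff c_def)
  qed
  show ?thesis
  proof (cases "c = 0")
    case True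
    have "AE x in lborel. ?p x = 0" "AE x in lborel. ?n x = 0"
      using True cn p n unfolding c_def by (subst integral_nonneg_eq_0_iff_AE[symmetric]; auto)+
    then show ?thesis by eventually_elim auto
  next
    case False
    have "c \<ge> 0" unfolding c_def by (rule integral_nonneg_AE) auto
    with False have c: "c > 0" by simp
    have rd: "real_distribution (density lborel (\<lambda>x. ennreal (g x / c)))"
      if g: "integrable lborel g" "\<And>x. 0 \<le> g x" "(LBINT x. g x) = c" for g :: "real \<Rightarrow> real"
    proof -
      have [measurable]: "g \<in> borel_measurable borel" using g(1) by auto
      have "(\<integral>\<^sup>+x. ennreal (g x / c) \<partial>lborel) = ennreal (LBINT x. g x / c)"
        using g c by (intro nn_integral_eq_integral) auto
      also have "(LBINT x. g x / c) = 1" using g(3) c by simp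
      finally have "prob_space (density lborel (\<lambda>x. ennreal (g x / c)))"
        by (intro prob_spaceI) (simp add: emeasure_density)
      then show ?thesis by (intro real_distribution.intro real_distribution_axioms.intro) auto
    qed
    have ch: "char (density lborel (\<lambda>x. ennreal (g x / c))) t = (LBINT x. g x *\<^sub>R exp (\<i> * of_real (t * x))) /\<^sub>R c"
      if g: "integrable lborel g" "\<And>x. 0 \<le> g x" for g :: "real \<Rightarrow> real" and t
    proof -
      have [measurable]: "g \<in> borel_measurable borel" using g(1) by auto
      have "char (density lborel (\<lambda>x. ennreal (g x / c))) t = (LBINT x. (g x / c) *\<^sub>R exp (\<i> * of_real (t * x)))"
        unfolding char_def using g(2) c by (intro integral_density) auto
      also have "\<dots> = (LBINT x. (1 / c) *\<^sub>R (g x *\<^sub>R exp (\<i> * of_real (t * x))))" by simp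
      also have "\<dots> = (1 / c) *\<^sub>R (LBINT x. g x *\<^sub>R exp (\<i> * of_real (t * x)))" by (rule integral_scaleR_right)
      finally show ?thesis by (simp add: divide_inverse)
    qed
    have "density lborel (\<lambda>x. ennreal (?p x / c)) = density lborel (\<lambda>x. ennreal (?n x / c))"
    proof (rule Levy_uniqueness)
      show "char (density lborel (\<lambda>x. ennreal (?p x / c))) = char (density lborel (\<lambda>x. ennreal (?n x / c)))"
        by (rule ext) (simp only: ch[OF p] ch[OF n] eq max.cobounded1)
    qed (intro rd p n; simp add: c_def[symmetric] cn)+
    then have "AE x in lborel. ennreal (?p x / c) = ennreal (?n x / c)"
      by (intro sigma_finite_measure.density_unique[OF lborel.sigma_finite_measure_axioms]) auto
    then show ?thesis
    proof eventually_elim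
      case (elim x)
      then have "?p x / c = ?n x / c" using c by (subst (asm) ennreal_inj) auto
      then show ?case using c by (auto simp: max_def split: if_splits)
    qed
  qed
qed

text \<open>Vanishing for all frequencies passes to the conjugate function, hence to the real part;
  the imaginary part is the real part of \<open>- \<i> * f\<close>.\<close>

lemma fourier_unique_1d:
  fixes f :: "real \<Rightarrow> complex"
  assumes f: "integrable lborel f"
    and 0: "\<And>t. (LBINT x. exp (- \<i> * of_real (t * x)) * f x) = 0"
  shows "AE x in lborel. f x = 0"
proof -
  have Re0: "AE x in lborel. Re (g x) = 0"
    if g: "integrable lborel g" and 0: "\<And>t. (LBINT x. exp (- \<i> * of_real (t * x)) * g x) = 0" for g
  proof (rule fourier_unique_real_1d)
    show "integrable lborel (\<lambda>x. Re (g x))" using g by simp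
    have gc: "integrable lborel (\<lambda>x. cnj (g x))" using g by simp
    fix t
    have ie: "integrable lborel (\<lambda>x. exp (\<i> * of_real (t * x)) * h x)" if "integrable lborel h" for h :: "real \<Rightarrow> complex"
    proof -
      have "h \<in> borel_measurable borel" using that by auto
      then show ?thesis
        by (intro Bochner_Integration.integrable_bound[OF that]) (auto simp: norm_mult)
    qed
    have 1: "(LBINT x. exp (\<i> * of_real (t * x)) * g x) = 0"
      using 0[of "- t"] by simp
    have "(LBINT x. exp (\<i> * of_real (t * x)) * cnj (g x)) = cnj (LBINT x. exp (- \<i> * of_real (t * x)) * g x)"
      unfolding cnj_integral by (intro Bochner_Integration.integral_cong) (auto simp: exp_cnj)
    then have 2: "(LBINT x. exp (\<i> * of_real (t * x)) * cnj (g x)) = 0" unfolding 0 by simp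
    have "(LBINT x. exp (\<i> * of_real (t * x)) * of_real (Re (g x))) =
      (LBINT x. 1 / 2 * (exp (\<i> * of_real (t * x)) * g x) + 1 / 2 * (exp (\<i> * of_real (t * x)) * cnj (g x)))"
    proof (intro Bochner_Integration.integral_cong refl)
      fix x
      have "complex_of_real (Re (g x)) = 1 / 2 * g x + 1 / 2 * cnj (g x)" by (simp add: complex_eq_iff)
      then show "exp (\<i> * of_real (t * x)) * of_real (Re (g x)) =
          1 / 2 * (exp (\<i> * of_real (t * x)) * g x) + 1 / 2 * (exp (\<i> * of_real (t * x)) * cnj (g x))"
        by (simp only: distrib_left mult_ac)
    qed
    also have "\<dots> = 0"
      by (simp only: Bochner_Integration.integral_add[OF integrable_mult_right[OF ie[OF g]] integrable_mult_right[OF ie[OF gc]]]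
          integral_mult_right_zero 1 2) simp
    finally show "(LBINT x. exp (\<i> * of_real (t * x)) * of_real (Re (g x))) = 0" .
  qed
  have "(LBINT x. exp (- \<i> * of_real (t * x)) * (- \<i> * f x)) = - \<i> * (LBINT x. exp (- \<i> * of_real (t * x)) * f x)" for t
    unfolding integral_mult_right_zero[symmetric] by (simp only: mult_ac)
  then have "AE x in lborel. Re (- \<i> * f x) = 0"
    by (intro Re0 integrable_mult_right f) (simp only: 0 mult_zero_right)
  moreover have "AE x in lborel. Re (f x) = 0" by (rule Re0[OF f 0])
  ultimately show ?thesis by eventually_elim (simp add: complex_eq_iff)
qed

lemma fourier_unique:
  assumes D: "integrable lborel D" and 0: "\<And>t. fourier D t = 0"
  shows "AE z in lborel. D z = 0"
proof -
  have [measurable]: "D \<in> borel_measurable borel" using D by auto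
  have D': "integrable (lborel \<Otimes>\<^sub>M lborel) D" using D by (simp add: lborel_prod)
  let ?e = "\<lambda>b y. exp (- \<i> * of_real (b * y))"
  let ?k = "\<lambda>b x. \<integral>y. ?e b y * D (x, y) \<partial>lborel"
  have ii: "integrable (lborel \<Otimes>\<^sub>M lborel) (\<lambda>z. g z * D z)"
    if "g \<in> borel_measurable borel" "\<And>z. cmod (g z) = 1" for g :: "real \<times> real \<Rightarrow> complex"
    using that by (intro Bochner_Integration.integrable_bound[OF D']) (auto simp: norm_mult lborel_prod)
  have ib: "integrable (lborel \<Otimes>\<^sub>M lborel) (\<lambda>(x, y). ?e b y * D (x, y))" for b
  proof -
    have "(\<lambda>z::real \<times> real. ?e b (snd z)) \<in> borel_measurable borel"
      by (intro borel_measurable_continuous_onI continuous_intros)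
    from ii[OF this] show ?thesis by (simp add: case_prod_unfold)
  qed
  have k0: "AE x in lborel. ?k b x = 0" for b
  proof (rule fourier_unique_1d)
    show "integrable lborel (?k b)" by (rule lborel_pair.integrable_fst[OF ib])
    fix a
    have iab: "integrable (lborel \<Otimes>\<^sub>M lborel) (\<lambda>(x, y). exp (- \<i> * of_real (a * x)) * (?e b y * D (x, y)))"
    proof -
      have "(\<lambda>z::real \<times> real. exp (- \<i> * of_real (a * fst z)) * ?e b (snd z)) \<in> borel_measurable borel"
        by (intro borel_measurable_continuous_onI continuous_intros)
      from ii[OF this] show ?thesis by (simp add: mult.assoc norm_mult case_prod_unfold)
    qed
    have "(LBINT x. exp (- \<i> * of_real (a * x)) * ?k b x) = (LBINT x. LBINT y. exp (- \<i> * of_real (a * x)) * (?e b y * D (x, y)))"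
      unfolding integral_mult_right_zero ..
    also have "\<dots> = (\<integral>z. exp (- \<i> * of_real (a * fst z)) * (?e b (snd z) * D z) \<partial>(lborel \<Otimes>\<^sub>M lborel))"
      using lborel_pair.integral_fst[OF iab] by (simp add: case_prod_unfold)
    also have "\<dots> = fourier D (a, b)"
    proof -
      have "exp (- \<i> * of_real (a * fst z)) * ?e b (snd z) = exp (- \<i> * of_real ((a, b) \<bullet> z))" for z
        unfolding exp_add[symmetric] by (simp add: inner_prod_def algebra_simps)
      then show ?thesis unfolding fourier_def lborel_prod by (simp only: mult.assoc[symmetric])
    qed
    finally show "(LBINT x. exp (- \<i> * of_real (a * x)) * ?k b x) = 0" unfolding 0 .
  qed
  \<comment> \<open>The exceptional null set depends on \<open>b\<close>, so only countably many
    frequencies can be treated at once. Continuity of the partial transform in \<open>b\<close>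
    extends the vanishing from rational to all frequencies.\<close>
  have "AE x in lborel. \<forall>b\<in>\<rat>. ?k b x = 0"
    unfolding AE_ball_countable[OF countable_rat] by (intro ballI k0)
  moreover have "AE x in lborel. integrable lborel (\<lambda>y. D (x, y))"
    by (rule lborel_pair.AE_integrable_fst') (rule D')
  ultimately have "AE x in lborel. AE y in lborel. D (x, y) = 0"
  proof eventually_elim
    case (elim x)
    show ?case
    proof (rule fourier_unique_1d[OF elim(2)])
      fix b :: real
      have "b \<in> closure \<rat>" by (simp add: Rats_closure_real)
      then obtain r where r: "\<And>n. r n \<in> \<rat>" "r \<longlonglongrightarrow> b" unfolding closure_sequential by blast
      have "(\<lambda>n. ?k (r n) x) \<longlonglongrightarrow> ?k b x"
      proof (rule integral_dominated_convergence[OF _ _ integrable_norm[OF elim(2)]])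
        show "AE y in lborel. (\<lambda>n. ?e (r n) y * D (x, y)) \<longlonglongrightarrow> ?e b y * D (x, y)"
          by (intro AE_I2 tendsto_intros r)
      qed (auto simp: norm_mult)
      moreover have "(\<lambda>n. ?k (r n) x) = (\<lambda>n. 0)" using elim(1) r(1) by auto
      ultimately show "?k b x = 0" using LIMSEQ_unique[OF tendsto_const] by metis
    qed
  qed
  then have "AE z in lborel \<Otimes>\<^sub>M lborel. D z = 0"
  proof (rule lborel_pair.AE_pair_measure[rotated])
    have "{z. D z = 0} \<in> sets borel" by measurable
    then show "{z \<in> space (lborel \<Otimes>\<^sub>M lborel). D z = 0} \<in> sets (lborel \<Otimes>\<^sub>M lborel)"
      unfolding lborel_prod by simp
  qed
  then show ?thesis unfolding lborel_prod .
qed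

subsection \<open>Orthogonality of the Wigner functions of matrix units\<close>

text \<open>\<open>W\<close> is only square integrable and the candidate only bounded, so uniqueness
  cannot be applied to their difference. After multiplication by a Gaussian both are integrable,
  their transforms are computed by duality and agree, and the Gaussian is divided out. The double
  conjugation expresses the inverse transform through \<open>fourier\<close>.\<close>

lemma has_L2_fourier_inversion:
  assumes W: "has_L2_fourier W g" and g: "integrable lborel g"
  shows "AE z in lborel. W z = cnj (fourier (\<lambda>w. cnj (g w)) z) / (4 * of_real (pi\<^sup>2))"
proof -
  have [measurable]: "W \<in> borel_measurable borel" "g \<in> borel_measurable borel"
    and W2: "integrable lborel (\<lambda>z. (cmod (W z))\<^sup>2)"
    using W unfolding has_L2_fourier_def L2_def by auto
  let ?c = "4 * complex_of_real (pi\<^sup>2)"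
  let ?f = "fourier (\<lambda>w. cnj (g w))"
  let ?w = "\<lambda>z. cnj (?f z) / ?c"
  \<comment> \<open>This width makes the Gaussian its own transform up to the factor
    \<open>2 * pi\<close>.\<close>
  let ?\<gamma> = "\<lambda>z::real \<times> real. complex_of_real (exp (- (1 / 2 * (norm z)\<^sup>2)))"
  have gc: "integrable lborel (\<lambda>w. cnj (g w))" using g by simp
  have e2: "exp (- (norm w)\<^sup>2 / (4 * (1 / 2))) = exp (- (1 / 2 * (norm w)\<^sup>2))" for w :: "real \<times> real" by simp
  have F: "fourier ?\<gamma> w = of_real (2 * pi) * ?\<gamma> w" for w
    using fourier_gauss2[of "1 / 2" w] unfolding e2 by simp
  have i\<gamma>: "integrable lborel ?\<gamma>" using integrable_gauss2[of "1 / 2"] by simp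
  have i\<gamma>2: "integrable lborel (\<lambda>z. (cmod (?\<gamma> z))\<^sup>2)"
    using integrable_gauss2[of 1] by (simp add: exp_double[symmetric])
  have iW: "integrable lborel (\<lambda>z. W z * ?\<gamma> z)" by (rule L2_product(1)[OF _ _ W2 i\<gamma>2]) simp_all
  have iw: "integrable lborel (\<lambda>z. ?w z * ?\<gamma> z)"
  proof (rule Bochner_Integration.integrable_bound[OF integrable_mult_right[OF i\<gamma>, of "of_real ((LBINT z. cmod (g z)) / (4 * pi\<^sup>2))"]])
    have "norm (?w z * ?\<gamma> z) \<le> norm (of_real ((LBINT z. cmod (g z)) / (4 * pi\<^sup>2)) * ?\<gamma> z)" for z
    proof -
      have "norm (?w z) \<le> norm (complex_of_real ((LBINT z. cmod (g z)) / (4 * pi\<^sup>2)))"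
        using cmod_fourier_le[of "\<lambda>w. cnj (g w)" z] order_trans[OF _ abs_ge_self]
        by (simp add: norm_divide norm_power divide_right_mono)
      then show ?thesis unfolding norm_mult by (rule mult_right_mono) simp
    qed
    then show "AE z in lborel. norm (?w z * ?\<gamma> z) \<le> norm (of_real ((LBINT z. cmod (g z)) / (4 * pi\<^sup>2)) * ?\<gamma> z)" by simp
  qed measurable
  have "AE z in lborel. (W z - ?w z) * ?\<gamma> z = 0"
  proof (rule fourier_unique)
    show "integrable lborel (\<lambda>z. (W z - ?w z) * ?\<gamma> z)"
      unfolding left_diff_distrib by (rule Bochner_Integration.integrable_diff[OF iW iw])
    fix t :: "real \<times> real"
    \<comment> \<open>Modulating the Gaussian by the frequency \<open>t\<close> translates its
      transform by \<open>t\<close>. Both products therefore have, at \<open>t\<close> and up to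
      \<open>2 * pi\<close>, the transform \<open>g\<close> paired with this translate.\<close>
    let ?\<tau> = "\<lambda>w. ?\<gamma> (w - t)"
    let ?E = "\<lambda>z. exp (- \<i> * of_real (t \<bullet> z))"
    have i\<tau>: "integrable lborel ?\<tau>" and i\<tau>2: "integrable lborel (\<lambda>z. (cmod (?\<tau> z))\<^sup>2)"
    proof -
      have "rapid (\<lambda>w. ?\<gamma> (w - t))" by (intro rapid_of_real rapid_shift rapid_gauss_norm) simp
      then show "integrable lborel ?\<tau>" by (rule rapid_integrable2) simp
      have "rapid (\<lambda>w::real \<times> real. exp (- (1 * (norm (w - t))\<^sup>2)))" by (rule rapid_shift[OF rapid_gauss_norm]) simp
      then have "integrable lborel (\<lambda>w::real \<times> real. exp (- (1 * (norm (w - t))\<^sup>2)))" by (rule rapid_integrable2) simp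
      then show "integrable lborel (\<lambda>z. (cmod (?\<tau> z))\<^sup>2)" by (simp add: exp_double[symmetric])
    qed
    have iK: "integrable lborel (\<lambda>z. cnj (?E z) * ?\<gamma> z)"
      by (rule Bochner_Integration.integrable_bound[OF i\<gamma>]) (auto simp: norm_mult)
    have FK: "fourier (\<lambda>z. cnj (?E z) * ?\<gamma> z) w = of_real (2 * pi) * ?\<tau> w" for w
    proof -
      have pt: "exp (- \<i> * of_real (w \<bullet> z)) * (cnj (?E z) * ?\<gamma> z) = exp (- \<i> * of_real ((w - t) \<bullet> z)) * ?\<gamma> z" for z
        unfolding exp_cnj mult.assoc[symmetric] exp_add[symmetric] by (simp add: inner_diff_left algebra_simps)
      have "fourier (\<lambda>z. cnj (?E z) * ?\<gamma> z) w = fourier ?\<gamma> (w - t)"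
        unfolding fourier_def by (intro Bochner_Integration.integral_cong refl pt)
      then show ?thesis unfolding F .
    qed
    have F\<tau>: "of_real (2 * pi) * (?E z * ?\<gamma> z) = fourier ?\<tau> z" for z
    proof -
      have sh: "fourier ?\<tau> z = (LBINT w. exp (- \<i> * of_real (z \<bullet> (t + w))) * ?\<gamma> w)"
      proof -
        have "fourier ?\<tau> z = (\<integral>w. exp (- \<i> * of_real (z \<bullet> w)) * ?\<gamma> (w - t) \<partial>(distr lborel borel ((+) t)))"
          unfolding fourier_def by (simp only: lborel_distr_plus)
        also have "\<dots> = (LBINT w. exp (- \<i> * of_real (z \<bullet> (t + w))) * ?\<gamma> w)"
          by (subst integral_distr) auto
        finally show ?thesis .
      qed
      also have "\<dots> = (LBINT w. ?E z * (exp (- \<i> * of_real (z \<bullet> w)) * ?\<gamma> w))"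
      proof -
        have "exp (- \<i> * of_real (z \<bullet> (t + w))) = ?E z * exp (- \<i> * of_real (z \<bullet> w))" for w
          unfolding exp_add[symmetric] by (simp add: inner_add_right inner_commute[of t z] algebra_simps)
        then show ?thesis by (simp only: mult.assoc)
      qed
      also have "\<dots> = ?E z * fourier ?\<gamma> z" unfolding fourier_def by (rule integral_mult_right_zero)
      finally show ?thesis unfolding F by (simp only: mult_ac)
    qed
    have A: "of_real (2 * pi) * fourier (\<lambda>z. W z * ?\<gamma> z) t = (LBINT w. g w * ?\<tau> w)"
    proof -
      have "of_real (2 * pi) * fourier (\<lambda>z. W z * ?\<gamma> z) t = (LBINT z. W z * (of_real (2 * pi) * (?E z * ?\<gamma> z)))"
        unfolding fourier_def integral_mult_right_zero[symmetric] by (simp only: mult_ac)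
      then show ?thesis unfolding F\<tau> has_L2_fourier_dual(2)[OF W i\<tau> i\<tau>2] .
    qed
    have B: "of_real (2 * pi) * fourier (\<lambda>z. ?w z * ?\<gamma> z) t = (LBINT w. g w * ?\<tau> w)"
    proof -
      have "fourier (\<lambda>z. ?w z * ?\<gamma> z) t = (LBINT z. inverse ?c * cnj (?f z * (cnj (?E z) * ?\<gamma> z)))"
        unfolding fourier_def[of _ t] by (intro Bochner_Integration.integral_cong refl) (simp add: field_simps)
      also have "\<dots> = inverse ?c * cnj (LBINT z. ?f z * (cnj (?E z) * ?\<gamma> z))"
        unfolding integral_mult_right_zero cnj_integral ..
      also have "(LBINT z. ?f z * (cnj (?E z) * ?\<gamma> z)) = (LBINT w. cnj (g w) * (of_real (2 * pi) * ?\<tau> w))"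
        unfolding integral_fourier_mult[OF gc iK] FK ..
      also have "cnj \<dots> = (LBINT w. of_real (2 * pi) * (g w * ?\<tau> w))"
        unfolding cnj_integral by (intro Bochner_Integration.integral_cong) (auto simp: mult_ac)
      also have "\<dots> = of_real (2 * pi) * (LBINT w. g w * ?\<tau> w)" by (rule integral_mult_right_zero)
      finally have eq: "fourier (\<lambda>z. ?w z * ?\<gamma> z) t = inverse ?c * (of_real (2 * pi) * (LBINT w. g w * ?\<tau> w))" .
      have k: "of_real (2 * pi) * (inverse ?c * (of_real (2 * pi) * I)) = I" for I
        by (simp add: field_simps power2_eq_square)
      show ?thesis unfolding eq by (rule k)
    qed
    have "fourier (\<lambda>z. (W z - ?w z) * ?\<gamma> z) t = fourier (\<lambda>z. W z * ?\<gamma> z) t - fourier (\<lambda>z. ?w z * ?\<gamma> z) t"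
      unfolding fourier_def[of _ t] left_diff_distrib right_diff_distrib
      by (rule Bochner_Integration.integral_diff[OF fourier_integrable[OF iW] fourier_integrable[OF iw]])
    also have "\<dots> = 0"
    proof -
      have "of_real (2 * pi) * fourier (\<lambda>z. W z * ?\<gamma> z) t = of_real (2 * pi) * fourier (\<lambda>z. ?w z * ?\<gamma> z) t"
        unfolding A B ..
      then show ?thesis by simp
    qed
    finally show "fourier (\<lambda>z. (W z - ?w z) * ?\<gamma> z) t = 0" .
  qed
  then show ?thesis by eventually_elim simp
qed

text \<open>Plancherel's identity in polarized form: inversion is inserted for \<open>W\<close>, and
  duality returns the transform to \<open>V\<close>.\<close>

lemma has_L2_fourier_inner:
  assumes V: "has_L2_fourier V f" and W: "has_L2_fourier W g" and g: "integrable lborel g"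
  shows "(LBINT z. V z * cnj (W z)) = (LBINT w. f w * cnj (g w)) / (4 * of_real (pi\<^sup>2))"
proof -
  have [measurable]: "W \<in> borel_measurable borel" "g \<in> borel_measurable borel" "V \<in> borel_measurable borel"
    and g2: "integrable lborel (\<lambda>z. (cmod (g z))\<^sup>2)"
    using V W unfolding has_L2_fourier_def L2_def by auto
  have gc: "integrable lborel (\<lambda>w. cnj (g w))" "integrable lborel (\<lambda>w. (cmod (cnj (g w)))\<^sup>2)" using g g2 by simp_all
  have "(LBINT z. V z * cnj (W z)) = (LBINT z. V z * fourier (\<lambda>w. cnj (g w)) z / (4 * of_real (pi\<^sup>2)))"
  proof (rule integral_cong_AE)
    show "AE z in lborel. V z * cnj (W z) = V z * fourier (\<lambda>w. cnj (g w)) z / (4 * of_real (pi\<^sup>2))"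
      using has_L2_fourier_inversion[OF W g] by eventually_elim simp
  qed simp_all
  also have "\<dots> = (LBINT z. V z * fourier (\<lambda>w. cnj (g w)) z) / (4 * of_real (pi\<^sup>2))"
    by (rule integral_divide_zero)
  also have "(LBINT z. V z * fourier (\<lambda>w. cnj (g w)) z) = (LBINT w. f w * cnj (g w))"
    by (rule has_L2_fourier_dual(2)[OF V gc])
  finally show ?thesis .
qed

text \<open>Because \<open>\<bar>v\<bar> \<le> \<bar>x\<bar> + \<bar>x - v\<bar>\<close>, decay of
  \<open>f\<close> at twice the rate together with decay of \<open>g\<close> controls the
  pair.\<close>

lemma rapid_convolution_kernel:
  fixes f g :: "real \<Rightarrow> complex"
  assumes "rapid f" "rapid g"
  shows "rapid (\<lambda>z. f (snd z) * g (snd z - fst z))"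
  unfolding rapid_def
proof
  fix c :: real
  obtain K where K: "K \<ge> 0" "\<And>z. norm (f z) \<le> K * exp (- (2 * \<bar>c\<bar>) * norm z)"
    using rapidE[OF assms(1)] by blast
  obtain L where L: "L \<ge> 0" "\<And>z. norm (g z) \<le> L * exp (- \<bar>c\<bar> * norm z)"
    using rapidE[OF assms(2)] by blast
  have "norm (f (snd z) * g (snd z - fst z)) * exp (c * norm z) \<le> K * L" for z
  proof -
    obtain v x where z: "z = (v, x)" by (cases z)
    have "norm z \<le> \<bar>v\<bar> + \<bar>x\<bar>" unfolding z using norm_Pair_le[of v x] by simp
    also have "\<dots> \<le> 2 * \<bar>x\<bar> + \<bar>x - v\<bar>" by linarith
    finally have "\<bar>c\<bar> * norm z \<le> \<bar>c\<bar> * (2 * \<bar>x\<bar> + \<bar>x - v\<bar>)" by (rule mult_left_mono) simp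
    moreover have "c * norm z \<le> \<bar>c\<bar> * norm z" by (rule mult_right_mono) auto
    ultimately have e: "exp (c * norm z) \<le> exp (\<bar>c\<bar> * (2 * \<bar>x\<bar> + \<bar>x - v\<bar>))" by simp
    have "norm (f x * g (x - v)) * exp (c * norm z) \<le>
       ((K * exp (- (2 * \<bar>c\<bar>) * norm x)) * (L * exp (- \<bar>c\<bar> * norm (x - v)))) * exp (\<bar>c\<bar> * (2 * \<bar>x\<bar> + \<bar>x - v\<bar>))"
      unfolding norm_mult by (intro mult_mono K L e mult_nonneg_nonneg) (auto simp: K L)
    also have "\<dots> = K * L * (exp (- (2 * \<bar>c\<bar>) * norm x) * exp (- \<bar>c\<bar> * norm (x - v)) * exp (\<bar>c\<bar> * (2 * \<bar>x\<bar> + \<bar>x - v\<bar>)))"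
      by (simp only: mult_ac)
    also have "exp (- (2 * \<bar>c\<bar>) * norm x) * exp (- \<bar>c\<bar> * norm (x - v)) * exp (\<bar>c\<bar> * (2 * \<bar>x\<bar> + \<bar>x - v\<bar>)) = 1"
      unfolding exp_add[symmetric] by (simp add: algebra_simps)
    finally show ?thesis by (simp add: z)
  qed
  then show "\<exists>C. \<forall>z. norm (f (snd z) * g (snd z - fst z)) * exp (c * norm z) \<le> C" by blast
qed

lemma rapid_weyl_product:
  "rapid (\<lambda>z. weyl_matrix k j (fst z) (snd z) * cnj (weyl_matrix a b (fst z) (snd z)))"
proof -
  have "rapid (\<lambda>z. cnj (weyl_matrix a b (fst z) (snd z)))" by (rule rapid_dominated[OF rapid_weyl_matrix[of a b]]) simp
  then show ?thesis by (intro rapid_mult rapid_weyl_matrix)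
qed

text \<open>Integrating over \<open>u\<close> first turns the Gaussian into one in
  \<open>x - v / 2\<close>, and the factors recombine into the ground state at \<open>x\<close> and
  at \<open>x - v\<close>. Integrating over \<open>v\<close> and then \<open>x\<close> leaves inner
  products of the indices \<open>a\<close> and \<open>b\<close> with 0.\<close>

lemma weyl_matrix_gauss:
  "(LBINT z. weyl_matrix a b (fst z) (snd z) * weyl_matrix 0 0 (fst z) (snd z)) =
    (if a = 0 \<and> b = 0 then 2 * of_real pi else 0)"
proof -
  let ?h = "hermite_fun"
  let ?E = "\<lambda>u v. complex_of_real (exp (- ((u\<^sup>2 + v\<^sup>2) / 4)))"
  have iz: "integrable lborel (\<lambda>z. weyl_matrix a b (fst z) (snd z) * weyl_matrix 0 0 (fst z) (snd z))"
    by (intro rapid_integrable2 rapid_mult rapid_weyl_matrix borel_measurable_continuous_onI continuous_intros)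
  have inner: "(LBINT u. weyl_matrix a b u v * weyl_matrix 0 0 u v) =
     2 * of_real pi * (LBINT x. of_real ((?h b x * ?h 0 x) * (?h a (x - v) * ?h 0 (x - v))))" for v
  proof -
    let ?f = "\<lambda>u x. weyl_integrand a b u v x * ?E u v"
    have int: "integrable (lborel \<Otimes>\<^sub>M lborel) (\<lambda>(u, x). ?f u x)"
    proof (rule Bochner_Integration.integrable_bound)
      have "integrable lborel (\<lambda>u. ?E u v)"
      proof -
        have "rapid (\<lambda>u. of_real (exp (- ((1/4) * u\<^sup>2))) * ?E 0 v)"
          by (intro rapid_cmult2 rapid_of_real rapid_gauss) simp
        then have "rapid (\<lambda>u. ?E u v)"
          by (rule rapid_dominated) (simp add: norm_mult exp_add[symmetric] add_divide_distrib)
        then show ?thesis by (rule rapid_integrable) simp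
      qed
      moreover have "integrable lborel (\<lambda>x. complex_of_real (?h b x * ?h a (x - v)))"
        by (intro rapid_integrable rapid_of_real rapid_mult hermite_fun_rapid rapid_shift) simp
      ultimately show "integrable (lborel \<Otimes>\<^sub>M lborel) (\<lambda>(u, x). ?E u v * of_real (?h b x * ?h a (x - v)))"
        by (intro integrable_prod_mult lborel.sigma_finite_measure_axioms)
      show "(\<lambda>(u, x). ?f u x) \<in> borel_measurable (lborel \<Otimes>\<^sub>M lborel)"
        unfolding weyl_integrand_def by measurable
    qed (auto simp: norm_mult norm_weyl_integrand)
    have "(LBINT u. weyl_matrix a b u v * weyl_matrix 0 0 u v) = (LBINT u. LBINT x. ?f u x)"
      unfolding weyl_matrix_def[of a b] weyl_matrix_0_0 by (intro Bochner_Integration.integral_cong refl, subst integral_mult_left_zero[symmetric]) (rule refl)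
    also have "\<dots> = (LBINT x. LBINT u. ?f u x)"
      by (rule lborel_pair.Fubini_integral[OF int, symmetric])
    also have "\<dots> = (LBINT x. 2 * of_real pi * of_real ((?h b x * ?h 0 x) * (?h a (x - v) * ?h 0 (x - v))))"
    proof (intro Bochner_Integration.integral_cong refl)
      fix x
      let ?y = "x - v / 2"
      have pt: "?f u x = of_real (?h b x * ?h a (x - v) * exp (- (v\<^sup>2 / 4))) *
         (exp (- \<i> * of_real (?y * u)) * of_real (exp (- (1 / 4 * u\<^sup>2))))" for u
      proof -
        have e: "exp (- ((u\<^sup>2 + v\<^sup>2) / 4)) = exp (- (v\<^sup>2 / 4)) * exp (- (1 / 4 * u\<^sup>2))"
          unfolding exp_add[symmetric] by (simp add: field_simps)
        have p: "- \<i> * complex_of_real (u * x) + \<i> * complex_of_real (u * v) / 2 = - \<i> * complex_of_real (?y * u)"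
          by (simp add: algebra_simps)
        show ?thesis unfolding weyl_integrand_def p e by (simp only: of_real_mult mult_ac)
      qed
      have "(LBINT u. ?f u x) = of_real (?h b x * ?h a (x - v) * exp (- (v\<^sup>2 / 4))) * of_real (sqrt (pi / (1 / 4)) * exp (- ?y\<^sup>2 / (4 * (1 / 4))))"
        unfolding pt integral_mult_right_zero by (subst fourier_gauss) auto
      also have "\<dots> = of_real (?h b x * ?h a (x - v) * (exp (- (v\<^sup>2 / 4)) * exp (- ?y\<^sup>2)) * (2 * sqrt pi))"
        by (simp add: real_sqrt_mult real_sqrt_divide mult_ac)
      also have "exp (- (v\<^sup>2 / 4)) * exp (- ?y\<^sup>2) = sqrt pi * (?h 0 x * ?h 0 (x - v))"
      proof -
        have "?h 0 x * ?h 0 (x - v) = exp (- x\<^sup>2 / 2) * exp (- (x - v)\<^sup>2 / 2) / sqrt pi"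
          by (simp add: hermite_fun_altdef hermite_norm2_0)
        also have "exp (- x\<^sup>2 / 2) * exp (- (x - v)\<^sup>2 / 2) = exp (- (v\<^sup>2 / 4)) * exp (- ?y\<^sup>2)"
          unfolding exp_add[symmetric] by (rule arg_cong[of _ _ exp]) (simp add: power2_eq_square field_simps)
        finally show ?thesis by simp
      qed
      also have "?h b x * ?h a (x - v) * (sqrt pi * (?h 0 x * ?h 0 (x - v))) * (2 * sqrt pi) =
        (sqrt pi * sqrt pi) * (2 * ((?h b x * ?h 0 x) * (?h a (x - v) * ?h 0 (x - v))))"
        by (simp only: mult_ac)
      also have "sqrt pi * sqrt pi = pi" by simp
      finally show "(LBINT u. ?f u x) = 2 * of_real pi * of_real ((?h b x * ?h 0 x) * (?h a (x - v) * ?h 0 (x - v)))"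
        by simp
    qed
    finally show ?thesis unfolding integral_mult_right_zero .
  qed
  let ?p = "\<lambda>x. complex_of_real (?h b x * ?h 0 x)" and ?q = "\<lambda>x. complex_of_real (?h a x * ?h 0 x)"
  have rp: "rapid ?p" and rq: "rapid ?q" by (intro rapid_of_real rapid_mult hermite_fun_rapid)+
  have ik: "integrable (lborel \<Otimes>\<^sub>M lborel) (\<lambda>(v, x). ?p x * ?q (x - v))"
    unfolding lborel_prod case_prod_unfold
    by (rule rapid_integrable2[OF rapid_convolution_kernel[where f = ?p and g = ?q, OF rp rq]])
       (intro borel_measurable_continuous_onI continuous_intros)
  have qs: "(LBINT v. ?q (x - v)) = (if a = 0 then 1 else 0)" for x
  proof -
    have "(LBINT v. ?q (x - v)) = (LBINT v. ?q v)"
      using lborel_integral_real_affine[of "- 1" ?q x] by simp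
    then show ?thesis unfolding integral_complex_of_real hermite_fun_orthonormal by simp
  qed
  have "(LBINT z. weyl_matrix a b (fst z) (snd z) * weyl_matrix 0 0 (fst z) (snd z)) =
     (LBINT v. LBINT u. weyl_matrix a b u v * weyl_matrix 0 0 u v)"
    using lborel_pair.integral_snd[of "\<lambda>u v. weyl_matrix a b u v * weyl_matrix 0 0 u v"] iz
    by (simp add: lborel_prod case_prod_unfold)
  also have "\<dots> = 2 * of_real pi * (LBINT v. LBINT x. ?p x * ?q (x - v))"
    unfolding inner integral_mult_right_zero of_real_mult ..
  also have "(LBINT v. LBINT x. ?p x * ?q (x - v)) = (LBINT x. LBINT v. ?p x * ?q (x - v))"
    by (rule lborel_pair.Fubini_integral[OF ik, symmetric])
  also have "\<dots> = (LBINT x. ?p x * (if a = 0 then 1 else 0))"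
    unfolding integral_mult_right_zero qs ..
  also have "\<dots> = (if a = 0 \<and> b = 0 then 1 else 0)"
    unfolding integral_mult_left_zero integral_complex_of_real hermite_fun_orthonormal by auto
  finally show ?thesis by auto
qed

lemma weyl_matrix_orthogonal:
  "(LBINT z. weyl_matrix k j (fst z) (snd z) * cnj (weyl_matrix a b (fst z) (snd z))) =
    (if k = a \<and> j = b then 2 * of_real pi else 0)"
proof -
  define S where "S = (\<lambda>k j a b. \<integral>z. 1 * (weyl_matrix k j (fst z) (snd z) * cnj (weyl_matrix a b (fst z) (snd z))) \<partial>(lborel :: (real \<times> real) measure))"
  have i: "integrable lborel (\<lambda>z. 1 * (weyl_matrix k j (fst z) (snd z) * cnj (weyl_matrix a b (fst z) (snd z))))" for k j a b
    unfolding mult_1 by (intro rapid_integrable2 rapid_weyl_product borel_measurable_continuous_onI continuous_intros)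
  note L = weyl_matrix_ladder_integral[where U = fst and V = snd and w = "\<lambda>_. 1", OF i]
  have "S k j a b = (if k = a \<and> j = b then 2 * of_real pi else 0)"
  proof (rule ladder_orthogonality)
    show "of_real (sqrt (real (Suc j))) * S k (Suc j) a b - of_real (sqrt (real k)) * S (k - 1) j a b =
      of_real (sqrt (real b)) * S k j a (b - 1) - of_real (sqrt (real (Suc a))) * S k j (Suc a) b" for k j a b
      unfolding S_def by (rule L(1))
    show "of_real (sqrt (real (Suc k))) * S (Suc k) j a b - of_real (sqrt (real j)) * S k (j - 1) a b =
      of_real (sqrt (real a)) * S k j (a - 1) b - of_real (sqrt (real (Suc b))) * S k j a (Suc b)" for k j a b
      unfolding S_def by (rule L(2))
    fix a b
    have "S 0 0 a b = cnj (LBINT z. weyl_matrix a b (fst z) (snd z) * weyl_matrix 0 0 (fst z) (snd z))"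
      unfolding S_def cnj_integral by (intro Bochner_Integration.integral_cong) (auto simp: weyl_matrix_0_0 mult_ac)
    also have "\<dots> = (if a = 0 \<and> b = 0 then 2 * of_real pi else 0)"
      unfolding weyl_matrix_gauss by simp
    finally show "S 0 0 a b = (if a = 0 \<and> b = 0 then 2 * of_real pi else 0)" .
  qed
  then show ?thesis by (simp add: S_def)
qed

text \<open>A bounded operator is determined by its matrix on the closed span of the Hermite functions,
  and it is enough to know that this span contains the functions \<open>weyl u v (hermite_vec i)\<close>.\<close>

lemma unit_matrix_operator:
  assumes A: "bounded_operator A" and m: "has_matrix A (unit_matrix k j)"
  shows "L2_inner lborel (hermite_vec l) (A (weyl u v (hermite_vec i))) = (if l = k then weyl_matrix i j u v else 0)"
proof -
  have AL2: "A f \<in> L2 lborel" if "f \<in> L2 lborel" for f using A that by (simp add: bounded_operator_def)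
  have Alin: "AE x in lborel. A (\<lambda>y. a * f y + b * g y) x = a * A f x + b * A g x"
    if "f \<in> L2 lborel" "g \<in> L2 lborel" for f g a b
    using A that by (simp add: bounded_operator_def)
  obtain C where C: "\<And>f. f \<in> L2 lborel \<Longrightarrow> L2_norm lborel (A f) \<le> C * L2_norm lborel f"
    using A unfolding bounded_operator_def by blast
  define c :: complex where "c = (if l = k then 1 else 0)"
  \<comment> \<open>Those vectors on which \<open>A\<close>, tested against the Hermite function
    \<open>l\<close>, acts like the matrix unit. They form a subspace that is closed under the
    \<open>L\<^sub>2\<close> limits treated below.\<close>
  define good where "good f \<longleftrightarrow> f \<in> L2 lborel \<and>
    L2_inner lborel (hermite_vec l) (A f) = c * L2_inner lborel (hermite_vec j) f" for f
  have Ainner: "L2_inner lborel (hermite_vec l) (A (\<lambda>x. a * f x + b * g x)) =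
      a * L2_inner lborel (hermite_vec l) (A f) + b * L2_inner lborel (hermite_vec l) (A g)"
    if fg: "f \<in> L2 lborel" "g \<in> L2 lborel" for f g a b
  proof -
    have "L2_inner lborel (hermite_vec l) (A (\<lambda>x. a * f x + b * g x)) = L2_inner lborel (hermite_vec l) (\<lambda>x. a * A f x + b * A g x)"
      by (intro L2_inner_cong_AE hermite_vec_L2 AL2 L2_lincomb fg Alin)
    also have "\<dots> = a * L2_inner lborel (hermite_vec l) (A f) + b * L2_inner lborel (hermite_vec l) (A g)"
      by (intro L2_inner_lincomb hermite_vec_L2 AL2 fg)
    finally show ?thesis .
  qed
  have lin: "good (\<lambda>x. a * f x + b * g x)" if "good f" "good g" for f g a b
    using that unfolding good_def
    by (simp add: L2_lincomb Ainner L2_inner_lincomb[OF hermite_vec_L2] algebra_simps)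
  have sum: "good (\<lambda>x. \<Sum>i\<in>I. a i * f i x)" if "finite I" "\<And>i. good (f i)" for I :: "nat set" and a f
    using that(1)
  proof (induction I)
    case empty
    show ?case using lin[OF that(2)[of 0] that(2)[of 0], of 0 0] by simp
  next
    case (insert x F)
    then show ?case using lin[OF that(2)[of x] insert.IH, of "a x" 1] by simp
  qed
  have herm: "good (hermite_vec b)" for b
  proof -
    have "L2_inner lborel (hermite_vec l) (A (hermite_vec b)) = unit_matrix k j l b"
      using m by (simp add: has_matrix_def)
    moreover have "L2_inner lborel (hermite_vec j) (hermite_vec b) = of_real (LBINT x. hermite_fun j x * hermite_fun b x)"
      unfolding L2_inner_def integral_complex_of_real[symmetric] by simp
    ultimately show ?thesis
      by (auto simp: good_def c_def unit_matrix_def hermite_vec_L2 hermite_fun_orthonormal)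
  qed
  \<comment> \<open>Multiplication by \<open>x\<close> stays in the finite span of the Hermite
    functions by the three-term recurrence.\<close>
  have mono: "good (\<lambda>x. of_real (x ^ n) * hermite_vec b x)" for n b
  proof (induction n arbitrary: b)
    case (Suc n)
    have eq: "(\<lambda>x. complex_of_real (x ^ Suc n) * hermite_vec b x) = (\<lambda>x.
        of_real (sqrt (real b) / sqrt 2) * (of_real (x ^ n) * hermite_vec (b - 1) x) +
        of_real (sqrt (real (Suc b)) / sqrt 2) * (of_real (x ^ n) * hermite_vec (Suc b) x))"
    proof
      fix x
      have xh: "x * hermite_fun b x = sqrt (real b) / sqrt 2 * hermite_fun (b - 1) x + sqrt (real (Suc b)) / sqrt 2 * hermite_fun (Suc b) x"
        using x_hermite_fun[of x b] by (simp add: field_simps)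
      have "x ^ Suc n * hermite_fun b x = x ^ n * (x * hermite_fun b x)" by simp
      also have "\<dots> = sqrt (real b) / sqrt 2 * (x ^ n * hermite_fun (b - 1) x) + sqrt (real (Suc b)) / sqrt 2 * (x ^ n * hermite_fun (Suc b) x)"
        unfolding xh by (simp only: distrib_left mult_ac)
      finally show "complex_of_real (x ^ Suc n) * hermite_vec b x =
        of_real (sqrt (real b) / sqrt 2) * (of_real (x ^ n) * hermite_vec (b - 1) x) +
        of_real (sqrt (real (Suc b)) / sqrt 2) * (of_real (x ^ n) * hermite_vec (Suc b) x)"
        unfolding of_real_mult[symmetric] of_real_add[symmetric] by (rule arg_cong)
    qed
    show ?case unfolding eq by (rule lin[OF Suc.IH Suc.IH])
  qed (simp add: herm)
  \<comment> \<open>Boundedness of \<open>A\<close> and of the inner products makes the defect of a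
    limit arbitrarily small.\<close>
  have lim: "good f" if f: "f \<in> L2 lborel" and fm: "\<And>m. good (F m)"
    and conv: "(\<lambda>m. L2_norm lborel (\<lambda>x. f x - F m x)) \<longlonglongrightarrow> 0" for f and F :: "nat \<Rightarrow> real \<Rightarrow> complex"
  proof -
    have FL2: "F m \<in> L2 lborel" for m using fm by (simp add: good_def)
    let ?r = "\<lambda>m x. f x - F m x"
    have r: "?r m = (\<lambda>x. 1 * f x + (- 1) * F m x)" for m by auto
    have rL2: "?r m \<in> L2 lborel" for m unfolding r by (intro L2_lincomb f FL2)
    let ?D = "L2_inner lborel (hermite_vec l) (A f) - c * L2_inner lborel (hermite_vec j) f"
    have hn: "L2_norm lborel (hermite_vec a) = 1" for a
      using hermite_fun_orthonormal[of a a] by (simp add: L2_norm_def power2_eq_square)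
    have "cmod ?D \<le> \<bar>C\<bar> * L2_norm lborel (?r m) + L2_norm lborel (?r m)" for m
    proof -
      have "?D = L2_inner lborel (hermite_vec l) (A (?r m)) - c * L2_inner lborel (hermite_vec j) (?r m)"
        unfolding r Ainner[OF f FL2] L2_inner_lincomb[OF hermite_vec_L2 f FL2]
        using fm[of m] by (simp add: good_def algebra_simps)
      also have "cmod \<dots> \<le> cmod (L2_inner lborel (hermite_vec l) (A (?r m))) + cmod (c * L2_inner lborel (hermite_vec j) (?r m))"
        by (rule norm_triangle_ineq4)
      also have "\<dots> \<le> \<bar>C\<bar> * L2_norm lborel (?r m) + L2_norm lborel (?r m)"
      proof (rule add_mono)
        have "cmod (L2_inner lborel (hermite_vec l) (A (?r m))) \<le> L2_norm lborel (A (?r m))"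
          using L2_inner_bound[OF hermite_vec_L2 AL2[OF rL2]] by (simp add: hn)
        also have "\<dots> \<le> C * L2_norm lborel (?r m)" by (rule C[OF rL2])
        also have "\<dots> \<le> \<bar>C\<bar> * L2_norm lborel (?r m)" by (intro mult_right_mono) (auto simp: L2_norm_def)
        finally show "cmod (L2_inner lborel (hermite_vec l) (A (?r m))) \<le> \<bar>C\<bar> * L2_norm lborel (?r m)" .
        have "cmod (c * L2_inner lborel (hermite_vec j) (?r m)) \<le> cmod (L2_inner lborel (hermite_vec j) (?r m))"
          by (simp add: c_def)
        also have "\<dots> \<le> L2_norm lborel (?r m)"
          using L2_inner_bound[OF hermite_vec_L2 rL2] by (simp add: hn)
        finally show "cmod (c * L2_inner lborel (hermite_vec j) (?r m)) \<le> L2_norm lborel (?r m)" .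
      qed
      finally show ?thesis .
    qed
    moreover have "(\<lambda>m. \<bar>C\<bar> * L2_norm lborel (?r m) + L2_norm lborel (?r m)) \<longlonglongrightarrow> \<bar>C\<bar> * 0 + 0"
      by (intro tendsto_intros conv)
    ultimately have "cmod ?D \<le> 0" by (intro LIMSEQ_le_const[where X = "\<lambda>m. \<bar>C\<bar> * L2_norm lborel (?r m) + L2_norm lborel (?r m)"]) auto
    then show ?thesis using f by (simp add: good_def)
  qed
  have expo: "good (\<lambda>x. of_real (x ^ n) * exp (z * of_real x) * hermite_vec 0 x)" for n z
  proof (rule lim)
    let ?f = "\<lambda>x. of_real (x ^ n) * exp (z * of_real x) * hermite_vec 0 x"
    let ?F = "\<lambda>m x. \<Sum>i<m. (z ^ i / fact i) * (of_real (x ^ (n + i)) * hermite_vec 0 x)"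
    \<comment> \<open>The exponential and its partial sums are each at most
      \<open>exp (cmod z * \<bar>x\<bar>)\<close>, hence the factor 2 in the majorant.\<close>
    let ?d = "\<lambda>x. 2 * exp (cmod z * \<bar>x\<bar>) * (x ^ n * hermite_fun 0 x)"
    have rd: "rapid ?d"
      by (rule rapid_bound[OF rapid_power_mult[OF hermite_fun_rapid[of 0], of n], where C = 2 and c = "cmod z"])
         (simp add: abs_mult)
    have F: "?F m x = of_real (x ^ n) * hermite_vec 0 x * (\<Sum>i<m. (z * of_real x) ^ i /\<^sub>R fact i)" for m x
      by (simp add: sum_distrib_left power_add power_mult_distrib scaleR_conv_of_real divide_inverse mult_ac)
    have S: "cmod (\<Sum>i<m. (z * of_real x) ^ i /\<^sub>R fact i) \<le> exp (cmod z * \<bar>x\<bar>)" for m x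
    proof -
      have "cmod (\<Sum>i<m. (z * of_real x) ^ i /\<^sub>R fact i) \<le> (\<Sum>i<m. (cmod z * \<bar>x\<bar>) ^ i /\<^sub>R fact i)"
        by (rule order_trans[OF norm_sum]) (simp add: norm_power norm_mult)
      also have "\<dots> \<le> exp (cmod z * \<bar>x\<bar>)"
        unfolding exp_def by (intro sum_le_suminf summable_exp_generic) auto
      finally show ?thesis .
    qed
    have E: "cmod (exp (z * of_real x)) \<le> exp (cmod z * \<bar>x\<bar>)" for x
      using norm_exp[of "z * of_real x"] by (simp add: norm_mult)
    have fb: "cmod (?f x) \<le> \<bar>?d x\<bar>" for x
    proof -
      from E[of x] have "cmod (exp (z * of_real x)) \<le> 2 * exp (cmod z * \<bar>x\<bar>)"
        using exp_gt_zero[of "cmod z * \<bar>x\<bar>"] by linarith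
      from mult_right_mono[OF this, of "\<bar>x ^ n * hermite_fun 0 x\<bar>"] show ?thesis
        by (simp add: norm_mult abs_mult norm_power mult_ac power_abs)
    qed
    show fL2: "?f \<in> L2 lborel"
      by (rule rapid_L2[OF rapid_dominated[OF rd]]) (use fb in auto)
    show "good (?F m)" for m by (intro sum mono) simp
    have "(\<lambda>m. LBINT x. (cmod (?f x - ?F m x))\<^sup>2) \<longlonglongrightarrow> (\<integral>x. 0 \<partial>(lborel :: real measure))"
    proof (rule integral_dominated_convergence)
      show "integrable lborel (\<lambda>x. (?d x)\<^sup>2)"
        unfolding power2_eq_square by (intro rapid_integrable rapid_mult rd) simp
      show "AE x in lborel. (\<lambda>m. (cmod (?f x - ?F m x))\<^sup>2) \<longlonglongrightarrow> 0"
      proof (intro AE_I2)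
        fix x
        have "(\<lambda>m. \<Sum>i<m. (z * of_real x) ^ i /\<^sub>R fact i) \<longlonglongrightarrow> exp (z * of_real x)"
          using exp_converges[of "z * of_real x"] by (simp add: sums_def)
        then have "(\<lambda>m. (cmod (?f x - of_real (x ^ n) * hermite_vec 0 x * (\<Sum>i<m. (z * of_real x) ^ i /\<^sub>R fact i)))\<^sup>2)
           \<longlonglongrightarrow> (cmod (?f x - of_real (x ^ n) * hermite_vec 0 x * exp (z * of_real x)))\<^sup>2"
          by (intro tendsto_intros)
        then show "(\<lambda>m. (cmod (?f x - ?F m x))\<^sup>2) \<longlonglongrightarrow> 0" unfolding F by (simp add: mult_ac)
      qed
      show "AE x in lborel. norm ((cmod (?f x - ?F m x))\<^sup>2) \<le> (?d x)\<^sup>2" for m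
      proof (intro AE_I2)
        fix x
        have eq: "?f x - ?F m x = of_real (x ^ n) * hermite_vec 0 x * (exp (z * of_real x) - (\<Sum>i<m. (z * of_real x) ^ i /\<^sub>R fact i))"
          unfolding F by (simp add: algebra_simps)
        have bd: "cmod (exp (z * of_real x) - (\<Sum>i<m. (z * of_real x) ^ i /\<^sub>R fact i)) \<le> 2 * exp (cmod z * \<bar>x\<bar>)"
          using norm_triangle_ineq4[of "exp (z * of_real x)" "\<Sum>i<m. (z * of_real x) ^ i /\<^sub>R fact i"] S[of x m] E[of x]
          by linarith
        have "cmod (?f x - ?F m x) = \<bar>x ^ n * hermite_fun 0 x\<bar> * cmod (exp (z * of_real x) - (\<Sum>i<m. (z * of_real x) ^ i /\<^sub>R fact i))"
          unfolding eq norm_mult by (simp add: abs_mult norm_power power_abs)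
        also have "\<dots> \<le> \<bar>x ^ n * hermite_fun 0 x\<bar> * (2 * exp (cmod z * \<bar>x\<bar>))"
          by (rule mult_left_mono[OF bd]) simp
        finally have "cmod (?f x - ?F m x) \<le> \<bar>x ^ n * hermite_fun 0 x\<bar> * (2 * exp (cmod z * \<bar>x\<bar>))" .
        then have "cmod (?f x - ?F m x) \<le> \<bar>?d x\<bar>" by (simp add: abs_mult mult_ac)
        then have "(cmod (?f x - ?F m x))\<^sup>2 \<le> \<bar>?d x\<bar>\<^sup>2" by (rule power_mono) simp
        then show "norm ((cmod (?f x - ?F m x))\<^sup>2) \<le> (?d x)\<^sup>2" by simp
      qed
    qed simp_all
    then have "(\<lambda>m. LBINT x. (cmod (?f x - ?F m x))\<^sup>2) \<longlonglongrightarrow> 0" by simp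
    from tendsto_real_sqrt[OF this] show "(\<lambda>m. L2_norm lborel (\<lambda>x. ?f x - ?F m x)) \<longlonglongrightarrow> 0"
      unfolding L2_norm_def by simp
  qed
  have weyl: "good (weyl u v (hermite_vec i))"
  proof -
    let ?p = "pcompose (hermite i) [:- v, 1:]"
    \<comment> \<open>Expanding the shifted Gaussian gives a factor \<open>exp (v * x)\<close>; with
      the phase of the Weyl operator the exponent becomes \<open>?z * x\<close>. The translated
      Hermite function is thus a polynomial times this exponential times the ground state.\<close>
    let ?z = "of_real v - \<i> * of_real u :: complex"
    define K where "K = exp (\<i> * of_real (u * v) / 2) * of_real (exp (- v\<^sup>2 / 2) / sqrt (hermite_norm2 i) * sqrt (sqrt pi))"
    have "weyl u v (hermite_vec i) x = (\<Sum>a\<le>degree ?p. (K * of_real (coeff ?p a)) * (of_real (x ^ a) * exp (?z * of_real x) * hermite_vec 0 x))" for x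
    proof -
      have h0: "exp (- x\<^sup>2 / 2) = sqrt (sqrt pi) * hermite_fun 0 x"
        by (simp add: hermite_fun_altdef hermite_norm2_0)
      have ge: "exp (- (x - v)\<^sup>2 / 2) = exp (- v\<^sup>2 / 2) * exp (v * x) * exp (- x\<^sup>2 / 2)"
        unfolding exp_add[symmetric] by (rule arg_cong[of _ _ exp]) (simp add: power2_eq_square field_simps)
      have "hermite_fun i (x - v) = (exp (- v\<^sup>2 / 2) / sqrt (hermite_norm2 i) * sqrt (sqrt pi)) * (poly ?p x * exp (v * x) * hermite_fun 0 x)"
        unfolding hermite_fun_altdef[of i] ge h0 by (simp add: poly_pcompose mult_ac)
      moreover have "exp (- \<i> * of_real (u * x) + \<i> * of_real (u * v) / 2) * complex_of_real (exp (v * x)) =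
          exp (\<i> * of_real (u * v) / 2) * exp (?z * of_real x)"
        unfolding exp_of_real[symmetric] exp_add[symmetric] by (rule arg_cong[of _ _ exp]) (simp add: algebra_simps)
      ultimately have "weyl u v (hermite_vec i) x = K * of_real (poly ?p x) * (exp (?z * of_real x) * hermite_vec 0 x)"
        unfolding weyl_hermite_vec K_def by (simp add: mult_ac)
      also have "\<dots> = (\<Sum>a\<le>degree ?p. (K * of_real (coeff ?p a)) * (of_real (x ^ a) * exp (?z * of_real x) * hermite_vec 0 x))"
        unfolding poly_altdef[of ?p] by (simp add: sum_distrib_left sum_distrib_right mult_ac)
      finally show ?thesis .
    qed
    then have "weyl u v (hermite_vec i) = (\<lambda>x. \<Sum>a\<le>degree ?p. (K * of_real (coeff ?p a)) * (of_real (x ^ a) * exp (?z * of_real x) * hermite_vec 0 x))"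
      by (rule ext)
    moreover have "good (\<lambda>x. \<Sum>a\<le>degree ?p. (K * of_real (coeff ?p a)) * (of_real (x ^ a) * exp (?z * of_real x) * hermite_vec 0 x))"
      by (intro sum expo) simp
    ultimately show ?thesis by simp
  qed
  then show ?thesis by (simp add: good_def c_def L2_inner_weyl)
qed

text \<open>Only the summand \<open>l = k\<close> of the trace survives, so the transform is
  determined whatever operator witnesses \<open>wigner_function\<close>.\<close>

lemma wigner_function_unit_matrix:
  assumes "wigner_function (unit_matrix k j) W"
  shows "has_L2_fourier W (\<lambda>z. weyl_matrix k j (fst z) (snd z))"
proof -
  obtain A g where A: "bounded_operator A" "has_matrix A (unit_matrix k j)"
    and g: "\<And>u v. has_trace (\<lambda>f. A (weyl u v f)) (g (u, v))" and W: "has_L2_fourier W g"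
    using assms unfolding wigner_function_def by blast
  have "g (u, v) = weyl_matrix k j u v" for u v
  proof -
    have "(\<lambda>l. if l = k then weyl_matrix l j u v else 0) sums g (u, v)"
      using g[of u v] unfolding has_trace_def unit_matrix_operator[OF A] .
    moreover have "(\<lambda>l. if l = k then weyl_matrix l j u v else 0) sums weyl_matrix k j u v"
      by (rule sums_single)
    ultimately show ?thesis by (rule sums_unique2)
  qed
  then have "g = (\<lambda>z. weyl_matrix k j (fst z) (snd z))" by auto
  with W show ?thesis by simp
qed

text \<open>The norm \<open>2 * pi\<close> of the transforms is divided by Plancherel's constant
  \<open>4 * pi^2\<close>.\<close>

lemma wigner_unit_orthogonal:
  assumes "\<And>k j. wigner_function (unit_matrix k j) (W k j)"
  shows "(LBINT z. W k j z * cnj (W a b z)) = (if k = a \<and> j = b then of_real (1 / (2 * pi)) else 0)"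
proof -
  have i: "integrable lborel (\<lambda>z. weyl_matrix a b (fst z) (snd z))"
    by (intro rapid_integrable2 rapid_weyl_matrix borel_measurable_continuous_onI continuous_on_weyl_matrix)
  have "(LBINT z. W k j z * cnj (W a b z)) = (if k = a \<and> j = b then 2 * of_real pi else 0) / (4 * of_real (pi\<^sup>2))"
    unfolding has_L2_fourier_inner[OF wigner_function_unit_matrix[OF assms] wigner_function_unit_matrix[OF assms] i]
      weyl_matrix_orthogonal ..
  then show ?thesis by (auto simp: power2_eq_square)
qed

subsection \<open>The mean square error\<close>

context prob_space
begin

lemma indep_vars_product_mean:
  fixes Y Z :: "'b \<Rightarrow> complex"
  assumes X: "indep_vars (\<lambda>_. N) X I" and lm: "l \<in> I" "m \<in> I" "l \<noteq> m"
    and [measurable]: "Y \<in> borel_measurable N" "Z \<in> borel_measurable N"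
    and iY: "integrable M (\<lambda>\<omega>. Y (X l \<omega>))" and iZ: "integrable M (\<lambda>\<omega>. Z (X m \<omega>))"
  shows "(\<integral>\<omega>. Y (X l \<omega>) * Z (X m \<omega>) \<partial>M) = (\<integral>\<omega>. Y (X l \<omega>) \<partial>M) * (\<integral>\<omega>. Z (X m \<omega>) \<partial>M)"
proof -
  let ?U = "\<lambda>i \<omega>. (if i = l then Y else Z) (X i \<omega>)"
  have "indep_vars (\<lambda>_. N) X {l, m}" by (rule indep_vars_subset[OF X]) (use lm in auto)
  then have U: "indep_vars (\<lambda>_. borel) ?U {l, m}" by (rule indep_vars_compose2) auto
  have "(\<integral>\<omega>. (\<Prod>i\<in>{l, m}. ?U i \<omega>) \<partial>M) = (\<Prod>i\<in>{l, m}. \<integral>\<omega>. ?U i \<omega> \<partial>M)"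
    by (rule indep_vars_lebesgue_integral[OF _ U]) (use iY iZ lm in auto)
  then show ?thesis using lm by simp
qed

text \<open>Off-diagonal products of centred terms have mean 0 by independence. In the diagonal
  terms the variance is bounded by the second moment, which is the quantity that the growth estimate
  controls.\<close>

lemma expectation_square_mean:
  fixes F :: "'b \<Rightarrow> complex"
  assumes X: "indep_vars (\<lambda>_. N) X {1..}"
    and [measurable]: "F \<in> borel_measurable N" and B: "\<And>z. cmod (F z) \<le> B"
    and mean: "\<And>l. l \<ge> 1 \<Longrightarrow> (\<integral>\<omega>. F (X l \<omega>) \<partial>M) = \<mu>" and n: "n \<ge> (1 :: nat)"
  shows "integrable M (\<lambda>\<omega>. 1 / of_nat n * (\<Sum>l=1..n. F (X l \<omega>)) - \<mu>)"
    and "(\<integral>\<omega>. 1 / of_nat n * (\<Sum>l=1..n. F (X l \<omega>)) - \<mu> \<partial>M) = 0"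
    and "integrable M (\<lambda>\<omega>. (cmod (1 / of_nat n * (\<Sum>l=1..n. F (X l \<omega>)) - \<mu>))\<^sup>2)"
    and "(\<integral>\<omega>. (cmod (1 / of_nat n * (\<Sum>l=1..n. F (X l \<omega>)) - \<mu>))\<^sup>2 \<partial>M) \<le>
      1 / (real n)\<^sup>2 * (\<Sum>l=1..n. \<integral>\<omega>. (cmod (F (X l \<omega>)))\<^sup>2 \<partial>M)"
proof -
  have rv: "X l \<in> M \<rightarrow>\<^sub>M N" if "l \<ge> 1" for l using X that by (auto simp: indep_vars_def)
  have bi: "integrable M (\<lambda>\<omega>. G (X l \<omega>))" if "G \<in> borel_measurable N" "\<And>z. cmod (G z) \<le> C" "l \<ge> 1" for G :: "'b \<Rightarrow> complex" and C l
    using measurable_compose[OF rv[OF that(3)] that(1)] that(2) by (intro integrable_const_bound[where B = C]) auto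
  let ?G = "\<lambda>z. F z - \<mu>"
  let ?a = "\<lambda>\<omega>. 1 / of_nat n * (\<Sum>l=1..n. F (X l \<omega>)) - \<mu>"
  have GB: "cmod (?G z) \<le> B + cmod \<mu>" for z
    using norm_triangle_ineq4[of "F z" \<mu>] B[of z] by linarith
  have B0: "0 \<le> B + cmod \<mu>" using order_trans[OF norm_ge_zero GB] .
  have iF: "integrable M (\<lambda>\<omega>. F (X l \<omega>))" if "l \<ge> 1" for l by (rule bi[OF _ B that]) simp
  have iG: "integrable M (\<lambda>\<omega>. ?G (X l \<omega>))" if "l \<ge> 1" for l using iF[OF that] by simp
  have G0: "(\<integral>\<omega>. ?G (X l \<omega>) \<partial>M) = 0" if "l \<ge> 1" for l
    using iF[OF that] mean[OF that] by (simp add: prob_space)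
  have a: "?a \<omega> = 1 / of_nat n * (\<Sum>l=1..n. ?G (X l \<omega>))" for \<omega>
    using n by (simp add: sum_subtractf field_simps)
  show "integrable M ?a"
    unfolding a by (intro integrable_mult_right Bochner_Integration.integrable_sum iG) simp
  show "(\<integral>\<omega>. ?a \<omega> \<partial>M) = 0"
    unfolding a integral_mult_right_zero by (subst Bochner_Integration.integral_sum) (auto intro: iG simp: G0)
  have n2: "x * cnj x = of_real ((cmod x)\<^sup>2)" for x by (rule complex_norm_square[symmetric])
  have cG: "(\<lambda>z. cnj (?G z)) \<in> borel_measurable N" by measurable
  have icG: "integrable M (\<lambda>\<omega>. cnj (?G (X l \<omega>)))" if "l \<ge> 1" for l
    by (rule complex_integrable_cnj[THEN iffD2, OF iG[OF that]])
  have ip: "integrable M (\<lambda>\<omega>. ?G (X l \<omega>) * cnj (?G (X m \<omega>)))" if "l \<ge> 1" "m \<ge> 1" for l m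
  proof (rule integrable_const_bound[where B = "(B + cmod \<mu>) * (B + cmod \<mu>)"])
    show "AE \<omega> in M. norm (?G (X l \<omega>) * cnj (?G (X m \<omega>))) \<le> (B + cmod \<mu>) * (B + cmod \<mu>)"
      unfolding norm_mult complex_mod_cnj by (intro AE_I2 mult_mono GB B0) simp
    show "(\<lambda>\<omega>. ?G (X l \<omega>) * cnj (?G (X m \<omega>))) \<in> borel_measurable M"
      using rv[OF that(1)] rv[OF that(2)] by measurable
  qed
  have cross: "(\<integral>\<omega>. ?G (X l \<omega>) * cnj (?G (X m \<omega>)) \<partial>M) = 0" if "l \<ge> 1" "m \<ge> 1" "l \<noteq> m" for l m
    using indep_vars_product_mean[OF X _ _ that(3), of ?G "\<lambda>z. cnj (?G z)"] that iG icG G0 cG by simp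
  have sq: "?a \<omega> * cnj (?a \<omega>) = 1 / (of_nat n)\<^sup>2 * (\<Sum>l=1..n. \<Sum>m=1..n. ?G (X l \<omega>) * cnj (?G (X m \<omega>)))" for \<omega>
    unfolding a by (simp add: sum_product power2_eq_square)
  have isq: "integrable M (\<lambda>\<omega>. ?a \<omega> * cnj (?a \<omega>))"
    unfolding sq by (intro integrable_mult_right Bochner_Integration.integrable_sum ip) simp_all
  from integrable_Re[OF isq] show i2: "integrable M (\<lambda>\<omega>. (cmod (?a \<omega>))\<^sup>2)"
    unfolding n2 Re_complex_of_real .
  have "complex_of_real (\<integral>\<omega>. (cmod (?a \<omega>))\<^sup>2 \<partial>M) = (\<integral>\<omega>. ?a \<omega> * cnj (?a \<omega>) \<partial>M)"
    unfolding n2 integral_complex_of_real ..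
  also have "\<dots> = 1 / (of_nat n)\<^sup>2 * (\<Sum>l=1..n. \<Sum>m=1..n. \<integral>\<omega>. ?G (X l \<omega>) * cnj (?G (X m \<omega>)) \<partial>M)"
  proof -
    have "(\<integral>\<omega>. (\<Sum>l=1..n. \<Sum>m=1..n. ?G (X l \<omega>) * cnj (?G (X m \<omega>))) \<partial>M) =
        (\<Sum>l=1..n. \<integral>\<omega>. (\<Sum>m=1..n. ?G (X l \<omega>) * cnj (?G (X m \<omega>))) \<partial>M)"
      by (rule Bochner_Integration.integral_sum) (intro Bochner_Integration.integrable_sum ip; simp)
    also have "\<dots> = (\<Sum>l=1..n. \<Sum>m=1..n. \<integral>\<omega>. ?G (X l \<omega>) * cnj (?G (X m \<omega>)) \<partial>M)"
      by (intro sum.cong refl Bochner_Integration.integral_sum ip) simp_all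
    finally show ?thesis unfolding sq integral_mult_right_zero by (simp only:)
  qed
  also have "(\<Sum>l=1..n. \<Sum>m=1..n. \<integral>\<omega>. ?G (X l \<omega>) * cnj (?G (X m \<omega>)) \<partial>M) = (\<Sum>l=1..n. of_real (\<integral>\<omega>. (cmod (?G (X l \<omega>)))\<^sup>2 \<partial>M))"
  proof (intro sum.cong refl)
    fix l assume l: "l \<in> {1..n}"
    have "(\<Sum>m=1..n. \<integral>\<omega>. ?G (X l \<omega>) * cnj (?G (X m \<omega>)) \<partial>M) =
       (\<Sum>m=1..n. if l = m then (\<integral>\<omega>. ?G (X m \<omega>) * cnj (?G (X m \<omega>)) \<partial>M) else 0)"
    proof (intro sum.cong refl)
      fix m assume "m \<in> {1..n}"
      then show "(\<integral>\<omega>. ?G (X l \<omega>) * cnj (?G (X m \<omega>)) \<partial>M) =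
          (if l = m then (\<integral>\<omega>. ?G (X m \<omega>) * cnj (?G (X m \<omega>)) \<partial>M) else 0)"
        using l cross[of l m] by (cases "l = m") simp_all
    qed
    also have "\<dots> = (\<integral>\<omega>. ?G (X l \<omega>) * cnj (?G (X l \<omega>)) \<partial>M)" using l by simp
    finally show "(\<Sum>m=1..n. \<integral>\<omega>. ?G (X l \<omega>) * cnj (?G (X m \<omega>)) \<partial>M) = of_real (\<integral>\<omega>. (cmod (?G (X l \<omega>)))\<^sup>2 \<partial>M)"
      unfolding n2 integral_complex_of_real .
  qed
  finally have "complex_of_real (\<integral>\<omega>. (cmod (?a \<omega>))\<^sup>2 \<partial>M) =
     of_real (1 / (real n)\<^sup>2 * (\<Sum>l=1..n. \<integral>\<omega>. (cmod (?G (X l \<omega>)))\<^sup>2 \<partial>M))"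
    by simp
  then have eq: "(\<integral>\<omega>. (cmod (?a \<omega>))\<^sup>2 \<partial>M) = 1 / (real n)\<^sup>2 * (\<Sum>l=1..n. \<integral>\<omega>. (cmod (?G (X l \<omega>)))\<^sup>2 \<partial>M)"
    by (simp only: of_real_eq_iff)
  have le: "(\<integral>\<omega>. (cmod (?G (X l \<omega>)))\<^sup>2 \<partial>M) \<le> (\<integral>\<omega>. (cmod (F (X l \<omega>)))\<^sup>2 \<partial>M)" if l: "l \<ge> 1" for l
  proof -
    have [measurable]: "X l \<in> M \<rightarrow>\<^sub>M N" by (rule rv[OF l])
    have iF2: "integrable M (\<lambda>\<omega>. (cmod (F (X l \<omega>)))\<^sup>2)"
      by (rule integrable_const_bound[where B = "B\<^sup>2"]) (auto intro!: power_mono B)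
    have re: "(cmod (?G z))\<^sup>2 = (cmod (F z))\<^sup>2 - 2 * Re (cnj \<mu> * F z) + (cmod \<mu>)\<^sup>2" for z
      unfolding cmod_power2 by (simp add: power2_eq_square algebra_simps)
    have iR: "integrable M (\<lambda>\<omega>. Re (cnj \<mu> * F (X l \<omega>)))"
      by (intro integrable_Re integrable_mult_right iF l)
    have R: "(\<integral>\<omega>. Re (cnj \<mu> * F (X l \<omega>)) \<partial>M) = (cmod \<mu>)\<^sup>2"
    proof -
      have "(\<integral>\<omega>. Re (cnj \<mu> * F (X l \<omega>)) \<partial>M) = Re (\<integral>\<omega>. cnj \<mu> * F (X l \<omega>) \<partial>M)"
        by (rule integral_Re) (intro integrable_mult_right iF l)
      also have "\<dots> = (cmod \<mu>)\<^sup>2"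
        unfolding integral_mult_right_zero mean[OF l] cmod_power2 by (simp add: power2_eq_square)
      finally show ?thesis .
    qed
    have "(\<integral>\<omega>. (cmod (?G (X l \<omega>)))\<^sup>2 \<partial>M) = (\<integral>\<omega>. (cmod (F (X l \<omega>)))\<^sup>2 \<partial>M) - (cmod \<mu>)\<^sup>2"
    proof -
      have "(\<integral>\<omega>. (cmod (F (X l \<omega>)))\<^sup>2 - 2 * Re (cnj \<mu> * F (X l \<omega>)) + (cmod \<mu>)\<^sup>2 \<partial>M) =
         (\<integral>\<omega>. (cmod (F (X l \<omega>)))\<^sup>2 \<partial>M) - 2 * (cmod \<mu>)\<^sup>2 + (\<integral>\<omega>. (cmod \<mu>)\<^sup>2 \<partial>M)"
        by (simp only: Bochner_Integration.integral_add[OF Bochner_Integration.integrable_diff[OF iF2 integrable_mult_right[OF iR]] integrable_const]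
          Bochner_Integration.integral_diff[OF iF2 integrable_mult_right[OF iR]] integral_mult_right_zero R)
      then show ?thesis unfolding re by (simp add: prob_space)
    qed
    then show ?thesis by simp
  qed
  show "(\<integral>\<omega>. (cmod (?a \<omega>))\<^sup>2 \<partial>M) \<le> 1 / (real n)\<^sup>2 * (\<Sum>l=1..n. \<integral>\<omega>. (cmod (F (X l \<omega>)))\<^sup>2 \<partial>M)"
    unfolding eq by (intro mult_left_mono sum_mono le) auto
qed

end

lemma cmod_pattern_kernel: "cmod (pattern_kernel k j z) = \<bar>pattern_fun k j (fst z)\<bar>"
  by (simp add: pattern_kernel_def case_prod_beta norm_mult norm_exp_eq_Re)

theorem corollary2:
  fixes M :: "'a measure"
    and \<rho> :: "nat \<Rightarrow> nat \<Rightarrow> complex"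
    and p :: "real \<times> real \<Rightarrow> real"
    and X :: "nat \<Rightarrow> 'a \<Rightarrow> real \<times> real"
    and N :: "nat \<Rightarrow> nat"
    and W\<rho> :: "real \<times> real \<Rightarrow> complex"
    and W :: "nat \<Rightarrow> nat \<Rightarrow> real \<times> real \<Rightarrow> complex"
  assumes "density_matrix \<rho>"
    and "quadrature_density \<rho> p"
    and "prob_space M"
    and "prob_space.indep_vars M (\<lambda>_. quadrature_space) X {1..}"
    and "\<And>l. l \<ge> 1 \<Longrightarrow> distributed M quadrature_space (X l) (\<lambda>z. ennreal (p z))"
    and "\<And>n. n \<ge> 1 \<Longrightarrow> N n > 0"
    and "filterlim N at_top sequentially"
    and "(\<lambda>n. real (N n)) \<in> o(\<lambda>n. real n powr (3 / 7))"
    and "wigner_function \<rho> W\<rho>"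
    and "\<And>k j. wigner_function (unit_matrix k j) (W k j)"
  shows "(\<forall>n\<ge>1. integrable M (\<lambda>\<omega>. (L2_norm lborel (\<lambda>z.
          wigner_truncation (matrix_estimator (\<lambda>l. X l \<omega>) n) W (N n) z - W\<rho> z))\<^sup>2)) \<and>
    (\<lambda>n. (\<integral>\<omega>. (L2_norm lborel (\<lambda>z.
          wigner_truncation (matrix_estimator (\<lambda>l. X l \<omega>) n) W (N n) z - W\<rho> z))\<^sup>2 \<partial>M)
        - (L2_norm lborel (\<lambda>z. wigner_truncation \<rho> W (N n) z - W\<rho> z))\<^sup>2)
      \<in> O(\<lambda>n. real (N n) powr (7 / 3) / real n)"
proof -
  let ?Q = "\<lambda>n \<omega>. (L2_norm lborel (\<lambda>z.
    wigner_truncation (matrix_estimator (\<lambda>l. X l \<omega>) n) W (N n) z - W\<rho> z))\<^sup>2"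
  let ?T = "\<lambda>n. (L2_norm lborel (\<lambda>z. wigner_truncation \<rho> W (N n) z - W\<rho> z))\<^sup>2"
  interpret prob_space M by fact
  obtain C where C: "\<And>m x. m \<ge> 1 \<Longrightarrow> (\<Sum>k<m. \<Sum>j<m. (pattern_fun k j x)\<^sup>2) \<le> C * real m powr (7 / 3)"
    using sum_pattern_fun_square_bound by blast
  let ?c = "1 / (2 * pi)"
  have W: "W k j \<in> L2 lborel" for k j
    using wigner_function_unit_matrix[OF assms(10), of k j] by (simp add: has_L2_fourier_def)
  have W\<rho>: "W\<rho> \<in> L2 lborel"
    using assms(9) by (auto simp: wigner_function_def has_L2_fourier_def)
  have X[measurable]: "X l \<in> M \<rightarrow>\<^sub>M quadrature_space" if "l \<ge> 1" for l
    using assms(5)[OF that] by (rule distributed_measurable)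
  have main: "integrable M (\<lambda>\<omega>. ?Q n \<omega>) \<and>
     (\<exists>d. (\<integral>\<omega>. ?Q n \<omega> \<partial>M)
        - ?T n = d \<and> 0 \<le> d \<and> d \<le> ?c * C * (real (N n) powr (7 / 3) / real n))"
    if n: "n \<ge> 1" for n
  proof -
    let ?I = "{..<N n} \<times> {..<N n}"
    let ?a = "\<lambda>i \<omega>. matrix_estimator (\<lambda>l. X l \<omega>) n (fst i) (snd i) - \<rho> (fst i) (snd i)"
    let ?w = "\<lambda>i. W (fst i) (snd i)"
    \<comment> \<open>The bias is deterministic; it plays the part of the remainder in the
      orthogonal expansion.\<close>
    let ?R = "\<lambda>z. wigner_truncation \<rho> W (N n) z - W\<rho> z"
    have tr: "wigner_truncation r W m z = (\<Sum>i\<in>{..<m} \<times> {..<m}. r (fst i) (snd i) * W (fst i) (snd i) z)" for r m z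
      unfolding wigner_truncation_def by (simp add: sum.cartesian_product case_prod_unfold)
    have sumL2: "(\<lambda>z. \<Sum>i\<in>J. r i * ?w i z) \<in> L2 lborel" if "finite J" for J :: "(nat \<times> nat) set" and r
      using that
    proof (induction J)
      case empty
      show ?case by (simp add: L2_def)
    next
      case (insert i J)
      then show ?case using L2_lincomb[OF W insert.IH, of "r i" "fst i" "snd i" 1] by simp
    qed
    have R: "?R \<in> L2 lborel"
      using L2_lincomb[OF sumL2 W\<rho>, of ?I 1 "\<lambda>i. \<rho> (fst i) (snd i)" "- 1"] by (simp add: tr)
    have orth: "(LBINT z. ?w i z * cnj (?w j z)) = (if i = j then of_real ?c else 0)" for i j
      unfolding wigner_unit_orthogonal[OF assms(10)] by (auto simp: prod_eq_iff)
    let ?b = "\<lambda>i. \<integral>z. ?w i z * cnj (?R z) \<partial>lborel"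
    have expand: "?Q n \<omega> =
        ?c * (\<Sum>i\<in>?I. (cmod (?a i \<omega>))\<^sup>2) + 2 * Re (\<Sum>i\<in>?I. ?a i \<omega> * ?b i) + (L2_norm lborel ?R)\<^sup>2" for \<omega>
    proof -
      have s: "(L2_norm lborel f)\<^sup>2 = (LBINT z. (cmod (f z))\<^sup>2)" for f :: "real \<times> real \<Rightarrow> complex"
        by (simp add: L2_norm_def)
      have "wigner_truncation (matrix_estimator (\<lambda>l. X l \<omega>) n) W (N n) z - W\<rho> z = (\<Sum>i\<in>?I. ?a i \<omega> * ?w i z) + ?R z" for z
        unfolding tr by (simp add: left_diff_distrib sum_subtractf)
      then have "?Q n \<omega> =
         (LBINT z. (cmod ((\<Sum>i\<in>?I. ?a i \<omega> * ?w i z) + ?R z))\<^sup>2)"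
        unfolding s by (simp only:)
      also have "\<dots> = ?c * (\<Sum>i\<in>?I. (cmod (?a i \<omega>))\<^sup>2) + 2 * Re (\<Sum>i\<in>?I. ?a i \<omega> * ?b i) + (LBINT z. (cmod (?R z))\<^sup>2)"
        by (rule L2_orthogonal_expansion) (use W R orth in auto)
      finally show ?thesis unfolding s .
    qed
    have mean: "integrable M (?a i)" "(\<integral>\<omega>. ?a i \<omega> \<partial>M) = 0" "integrable M (\<lambda>\<omega>. (cmod (?a i \<omega>))\<^sup>2)"
      "(\<integral>\<omega>. (cmod (?a i \<omega>))\<^sup>2 \<partial>M) \<le> 1 / (real n)\<^sup>2 * (\<Sum>l=1..n. \<integral>\<omega>. (cmod (pattern_kernel (fst i) (snd i) (X l \<omega>)))\<^sup>2 \<partial>M)" for i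
    proof -
      obtain B where B: "\<And>z. cmod (pattern_kernel (fst i) (snd i) z) \<le> B" using pattern_kernel_bounded by blast
      note * = expectation_square_mean[OF assms(4) borel_measurable_pattern_kernel B
          expectation_pattern_kernel[OF assms(3,1,2,5)] n]
      show "integrable M (?a i)" "(\<integral>\<omega>. ?a i \<omega> \<partial>M) = 0" "integrable M (\<lambda>\<omega>. (cmod (?a i \<omega>))\<^sup>2)"
        "(\<integral>\<omega>. (cmod (?a i \<omega>))\<^sup>2 \<partial>M) \<le> 1 / (real n)\<^sup>2 * (\<Sum>l=1..n. \<integral>\<omega>. (cmod (pattern_kernel (fst i) (snd i) (X l \<omega>)))\<^sup>2 \<partial>M)"
        unfolding matrix_estimator_def using * by blast+
    qed
    have i1: "integrable M (\<lambda>\<omega>. ?c * (\<Sum>i\<in>?I. (cmod (?a i \<omega>))\<^sup>2))"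
      by (intro integrable_mult_right Bochner_Integration.integrable_sum mean)
    have i2c: "integrable M (\<lambda>\<omega>. \<Sum>i\<in>?I. ?a i \<omega> * ?b i)"
      by (intro Bochner_Integration.integrable_sum integrable_mult_left mean)
    have i2: "integrable M (\<lambda>\<omega>. 2 * Re (\<Sum>i\<in>?I. ?a i \<omega> * ?b i))"
      by (intro integrable_mult_right integrable_Re i2c)
    have int: "integrable M (\<lambda>\<omega>. ?Q n \<omega>)"
      unfolding expand by (intro Bochner_Integration.integrable_add i1 i2 integrable_const)
    \<comment> \<open>The inner products \<open>?b i\<close> with the bias do not depend on
      \<open>\<omega>\<close>, so the cross term vanishes in expectation because the errors
      \<open>?a i\<close> are centred.\<close>
    have cross: "(\<integral>\<omega>. 2 * Re (\<Sum>i\<in>?I. ?a i \<omega> * ?b i) \<partial>M) = 0"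
    proof -
      have "(\<integral>\<omega>. (\<Sum>i\<in>?I. ?a i \<omega> * ?b i) \<partial>M) = (\<Sum>i\<in>?I. \<integral>\<omega>. ?a i \<omega> * ?b i \<partial>M)"
        by (rule Bochner_Integration.integral_sum) (intro integrable_mult_left mean)
      also have "\<dots> = 0" unfolding integral_mult_left_zero mean(2) by simp
      finally show ?thesis unfolding integral_mult_right_zero integral_Re[OF i2c] by simp
    qed
    let ?d = "?c * (\<Sum>i\<in>?I. \<integral>\<omega>. (cmod (?a i \<omega>))\<^sup>2 \<partial>M)"
    have "(\<integral>\<omega>. ?Q n \<omega> \<partial>M) =
       (\<integral>\<omega>. ?c * (\<Sum>i\<in>?I. (cmod (?a i \<omega>))\<^sup>2) \<partial>M) + (\<integral>\<omega>. 2 * Re (\<Sum>i\<in>?I. ?a i \<omega> * ?b i) \<partial>M) + (\<integral>\<omega>. (L2_norm lborel ?R)\<^sup>2 \<partial>M)"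
      unfolding expand
      by (simp only: Bochner_Integration.integral_add[OF Bochner_Integration.integrable_add[OF i1 i2] integrable_const]
          Bochner_Integration.integral_add[OF i1 i2])
    also have "(\<integral>\<omega>. ?c * (\<Sum>i\<in>?I. (cmod (?a i \<omega>))\<^sup>2) \<partial>M) = ?d"
      unfolding integral_mult_right_zero by (subst Bochner_Integration.integral_sum) (auto intro: mean)
    also have "(\<integral>\<omega>. (L2_norm lborel ?R)\<^sup>2 \<partial>M) = (L2_norm lborel ?R)\<^sup>2" by (simp add: prob_space)
    finally have eq: "(\<integral>\<omega>. ?Q n \<omega> \<partial>M)
        - (L2_norm lborel ?R)\<^sup>2 = ?d" unfolding cross by simp
    have d0: "0 \<le> ?d" by (intro mult_nonneg_nonneg sum_nonneg integral_nonneg_AE) auto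
    have "(\<Sum>i\<in>?I. \<integral>\<omega>. (cmod (?a i \<omega>))\<^sup>2 \<partial>M) \<le>
       (\<Sum>i\<in>?I. 1 / (real n)\<^sup>2 * (\<Sum>l=1..n. \<integral>\<omega>. (cmod (pattern_kernel (fst i) (snd i) (X l \<omega>)))\<^sup>2 \<partial>M))"
      by (intro sum_mono mean)
    also have "\<dots> = 1 / (real n)\<^sup>2 * (\<Sum>l=1..n. \<Sum>i\<in>?I. \<integral>\<omega>. (cmod (pattern_kernel (fst i) (snd i) (X l \<omega>)))\<^sup>2 \<partial>M)"
      unfolding sum_distrib_left[symmetric] by (subst sum.swap) (rule refl)
    \<comment> \<open>The sum over matrix entries is taken inside the expectation, where the growth
      estimate holds at every observed point. The \<open>n\<close> observations divided by
      \<open>n^2\<close> leave the factor \<open>1 / n\<close>.\<close>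
    also have "\<dots> \<le> 1 / (real n)\<^sup>2 * (\<Sum>l=1..n. C * real (N n) powr (7 / 3))"
    proof (intro mult_left_mono sum_mono)
      fix l assume "l \<in> {1..n}"
      then have l: "l \<ge> 1" by simp
      have [measurable]: "X l \<in> M \<rightarrow>\<^sub>M quadrature_space" by (rule X[OF l])
      have iF: "integrable M (\<lambda>\<omega>. (cmod (pattern_kernel k j (X l \<omega>)))\<^sup>2)" for k j
      proof -
        obtain B where B: "\<And>z. cmod (pattern_kernel k j z) \<le> B" using pattern_kernel_bounded by blast
        have "norm ((cmod (pattern_kernel k j z))\<^sup>2) \<le> B\<^sup>2" for z
          using power_mono[OF B norm_ge_zero] by simp
        then show ?thesis by (intro integrable_const_bound[where B = "B\<^sup>2"] AE_I2) simp_all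
      qed
      have "(\<Sum>i\<in>?I. \<integral>\<omega>. (cmod (pattern_kernel (fst i) (snd i) (X l \<omega>)))\<^sup>2 \<partial>M) =
         (\<integral>\<omega>. (\<Sum>i\<in>?I. (cmod (pattern_kernel (fst i) (snd i) (X l \<omega>)))\<^sup>2) \<partial>M)"
        by (rule Bochner_Integration.integral_sum[symmetric]) (rule iF)
      also have "\<dots> \<le> (\<integral>\<omega>. C * real (N n) powr (7 / 3) \<partial>M)"
      proof (rule integral_mono)
        show "integrable M (\<lambda>\<omega>. \<Sum>i\<in>?I. (cmod (pattern_kernel (fst i) (snd i) (X l \<omega>)))\<^sup>2)"
          by (intro Bochner_Integration.integrable_sum iF)
        fix \<omega>
        have "(\<Sum>i\<in>?I. (cmod (pattern_kernel (fst i) (snd i) (X l \<omega>)))\<^sup>2) = (\<Sum>k<N n. \<Sum>j<N n. (pattern_fun k j (fst (X l \<omega>)))\<^sup>2)"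
          by (simp add: cmod_pattern_kernel sum.cartesian_product case_prod_unfold)
        also have "\<dots> \<le> C * real (N n) powr (7 / 3)" using assms(6)[OF n] by (intro C) simp
        finally show "(\<Sum>i\<in>?I. (cmod (pattern_kernel (fst i) (snd i) (X l \<omega>)))\<^sup>2) \<le> C * real (N n) powr (7 / 3)" .
      qed simp
      also have "\<dots> = C * real (N n) powr (7 / 3)" by (simp add: prob_space)
      finally show "(\<Sum>i\<in>?I. \<integral>\<omega>. (cmod (pattern_kernel (fst i) (snd i) (X l \<omega>)))\<^sup>2 \<partial>M) \<le> C * real (N n) powr (7 / 3)" .
    qed simp
    also have "\<dots> = C * (real (N n) powr (7 / 3) / real n)" using n by (simp add: power2_eq_square)
    finally have "?d \<le> ?c * (C * (real (N n) powr (7 / 3) / real n))" by (rule mult_left_mono) simp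
    with int eq d0 show ?thesis by (simp only: mult.assoc) blast
  qed
  have "(\<lambda>n. (\<integral>\<omega>. ?Q n \<omega> \<partial>M)
        - ?T n)
      \<in> O(\<lambda>n. real (N n) powr (7 / 3) / real n)"
  proof (rule bigoI[where c = "?c * C"], rule eventually_sequentiallyI[where c = 1])
    fix n :: nat assume "n \<ge> 1"
    from main[OF this] show "norm ((\<integral>\<omega>. ?Q n \<omega> \<partial>M)
        - ?T n) \<le> ?c * C * norm (real (N n) powr (7 / 3) / real n)"
      by auto
  qed
  then show ?thesis using main by blast
qed

end
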